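(* Let $X$ be a compact Hausdorff space, let $U\subseteq X$ be an open subset, and let $F=C_0(U)$, regarded as a correspondence from $C(X)$ to $C_0(U)$, with associated tensor product functor $\mathcal H_{C(X)}\to\mathcal H_{C_0(U)}$ (restriction of continuous fields of Hilbert spaces from $X$ to $U$). This functor has a local adjoint, namely extension of continuous fields by zero, i.e. the tensor product functor $\mathcal H_{C_0(U)}\to\mathcal H_{C(X)}$ represented by $E=C_0(U)$ viewed as a correspondence from $C_0(U)$ to $C(X)$. The local adjoint is an adjoint if and only if $U$ is both open and closed in $X$.
   Context: A Hilbert $A$-module is a right $A$-module with an $A$-valued inner product (antilinear in the first variable), complete in the norm $\|x\|=\|\langle x,x\rangle\|^{1/2}$. $\mathfrak B_A(X,Y)$ denotes the adjointable operators and $\mathfrak K_A(X,Y)$ the closed linear span of the operators $y\otimes x^*\colon z\mapsto y\langle x,z\rangle$. $\mathcal H_A$ is the category of Hilbert $A$-modules and adjointable maps; for $A$ commutative with spectrum $Z$ it is equivalent to the category of continuous fields of Hilbert spaces over $Z$. A correspondence from $A$ to $B$ is a Hilbert $B$-module $F$ with a nondegenerate $*$-homomorphism $A\to\mathfrak B_B(F,F)$. For a Hilbert $A$-module $M$, $M\otimes_AF$ is the Hilbert $B$-module completion of the algebraic tensor product for $\langle m_1\otimes f_1,m_2\otimes f_2\rangle=\langle f_1,\langle m_1,m_2\rangle f_2\rangle$. For correspondences $F$ from $A$ to $B$ and $E$ from $B$ to $A$, the functors $\otimes_AF$ and $\otimes_BE$ are adjoint (resp. locally adjoint) if there is an isomorphism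 $\mathfrak B_B(M\otimes_AF,M')\cong\mathfrak B_A(M,M'\otimes_BE)$ natural in $M\in\mathcal H_A$, $M'\in\mathcal H_B$ (resp. an isomorphism $\mathfrak K_B(M\otimes_AF,M')\cong\mathfrak K_A(M,M'\otimes_BE)$, natural in $M,M'$ and given by continuous linear maps). Both $F$ and $E$ are $C_0(U)$ with inner product $\langle f,g\rangle=\bar fg$ and left and right actions by pointwise multiplication; for $E$, the inner product takes values in $C_0(U)\subseteq C(X)$ (extension by zero). *)

theory Defs
  imports "HOL-Analysis.Analysis"
begin

text \<open>
  Algebras and modules are records with explicit carriers, because the statement quantifies over
  all Hilbert modules over algebras that depend on a space \<open>X\<close> and a subset \<open>U\<close>.
\<close>

section \<open>Complex vector spaces and C*-algebras\<close>

record 'v cspace =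
  carr :: "'v set"
  zer :: 'v
  add :: "'v \<Rightarrow> 'v \<Rightarrow> 'v"
  scl :: "complex \<Rightarrow> 'v \<Rightarrow> 'v"

record 'a calg = "'a cspace" +
  mul :: "'a \<Rightarrow> 'a \<Rightarrow> 'a"
  star :: "'a \<Rightarrow> 'a"
  nrm :: "'a \<Rightarrow> real"

definition diff :: "('v, 'z) cspace_scheme \<Rightarrow> 'v \<Rightarrow> 'v \<Rightarrow> 'v" where
  "diff V x y = add V x (scl V (-1) y)"

definition vsum :: "('v, 'z) cspace_scheme \<Rightarrow> 'v list \<Rightarrow> 'v" where
  "vsum V xs = foldr (add V) xs (zer V)"

definition cauchy_seq :: "('v, 'z) cspace_scheme \<Rightarrow> ('v \<Rightarrow> real) \<Rightarrow> (nat \<Rightarrow> 'v) \<Rightarrow> bool" where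
  "cauchy_seq V \<nu> s \<longleftrightarrow> (\<forall>n. s n \<in> carr V) \<and>
     (\<forall>\<epsilon>>0. \<exists>k. \<forall>i\<ge>k. \<forall>j\<ge>k. \<nu> (diff V (s i) (s j)) < \<epsilon>)"

definition norm_complete :: "('v, 'z) cspace_scheme \<Rightarrow> ('v \<Rightarrow> real) \<Rightarrow> bool" where
  "norm_complete V \<nu> \<longleftrightarrow>
     (\<forall>s. cauchy_seq V \<nu> s \<longrightarrow> (\<exists>x\<in>carr V. (\<lambda>n. \<nu> (diff V (s n) x)) \<longlonglongrightarrow> 0))"

locale complex_space =
  fixes V :: "('v, 'z) cspace_scheme"
  assumes zer_closed: "zer V \<in> carr V"
    and add_closed: "\<lbrakk>x \<in> carr V; y \<in> carr V\<rbrakk> \<Longrightarrow> add V x y \<in> carr V"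
    and scl_closed: "x \<in> carr V \<Longrightarrow> scl V c x \<in> carr V"
    and add_assoc: "\<lbrakk>x \<in> carr V; y \<in> carr V; z \<in> carr V\<rbrakk>
          \<Longrightarrow> add V (add V x y) z = add V x (add V y z)"
    and add_commute: "\<lbrakk>x \<in> carr V; y \<in> carr V\<rbrakk> \<Longrightarrow> add V x y = add V y x"
    and add_zer: "x \<in> carr V \<Longrightarrow> add V x (zer V) = x"
    and diff_self: "x \<in> carr V \<Longrightarrow> diff V x x = zer V"
    and scl_one: "x \<in> carr V \<Longrightarrow> scl V 1 x = x"
    and scl_scl: "x \<in> carr V \<Longrightarrow> scl V c (scl V d x) = scl V (c * d) x"
    and scl_add_left: "x \<in> carr V \<Longrightarrow> scl V (c + d) x = add V (scl V c x) (scl V d x)"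
    and scl_add_right: "\<lbrakk>x \<in> carr V; y \<in> carr V\<rbrakk>
          \<Longrightarrow> scl V c (add V x y) = add V (scl V c x) (scl V c y)"

text \<open>C*-algebras need not be unital.\<close>

locale c_star_algebra = complex_space A for A :: "'a calg" +
  assumes mul_closed: "\<lbrakk>a \<in> carr A; b \<in> carr A\<rbrakk> \<Longrightarrow> mul A a b \<in> carr A"
    and mul_assoc: "\<lbrakk>a \<in> carr A; b \<in> carr A; c \<in> carr A\<rbrakk>
          \<Longrightarrow> mul A (mul A a b) c = mul A a (mul A b c)"
    and mul_add_left: "\<lbrakk>a \<in> carr A; b \<in> carr A; c \<in> carr A\<rbrakk>
          \<Longrightarrow> mul A (add A a b) c = add A (mul A a c) (mul A b c)"
    and mul_add_right: "\<lbrakk>a \<in> carr A; b \<in> carr A; c \<in> carr A\<rbrakk>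
          \<Longrightarrow> mul A a (add A b c) = add A (mul A a b) (mul A a c)"
    and mul_scl_left: "\<lbrakk>a \<in> carr A; b \<in> carr A\<rbrakk> \<Longrightarrow> mul A (scl A r a) b = scl A r (mul A a b)"
    and mul_scl_right: "\<lbrakk>a \<in> carr A; b \<in> carr A\<rbrakk> \<Longrightarrow> mul A a (scl A r b) = scl A r (mul A a b)"
    and star_closed: "a \<in> carr A \<Longrightarrow> star A a \<in> carr A"
    and star_star: "a \<in> carr A \<Longrightarrow> star A (star A a) = a"
    and star_add: "\<lbrakk>a \<in> carr A; b \<in> carr A\<rbrakk> \<Longrightarrow> star A (add A a b) = add A (star A a) (star A b)"
    and star_scl: "a \<in> carr A \<Longrightarrow> star A (scl A r a) = scl A (cnj r) (star A a)"
    and star_mul: "\<lbrakk>a \<in> carr A; b \<in> carr A\<rbrakk> \<Longrightarrow> star A (mul A a b) = mul A (star A b) (star A a)"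
    and nrm_nonneg: "a \<in> carr A \<Longrightarrow> 0 \<le> nrm A a"
    and nrm_eq_0: "\<lbrakk>a \<in> carr A; nrm A a = 0\<rbrakk> \<Longrightarrow> a = zer A"
    and nrm_scl: "a \<in> carr A \<Longrightarrow> nrm A (scl A r a) = cmod r * nrm A a"
    and nrm_add: "\<lbrakk>a \<in> carr A; b \<in> carr A\<rbrakk> \<Longrightarrow> nrm A (add A a b) \<le> nrm A a + nrm A b"
    and nrm_mul: "\<lbrakk>a \<in> carr A; b \<in> carr A\<rbrakk> \<Longrightarrow> nrm A (mul A a b) \<le> nrm A a * nrm A b"
    and nrm_star_mul: "a \<in> carr A \<Longrightarrow> nrm A (mul A (star A a) a) = (nrm A a)\<^sup>2"
    and alg_complete: "norm_complete A (nrm A)"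

section \<open>Hilbert modules and their operators\<close>

record ('a, 'm) hmod = "'m cspace" +
  act :: "'m \<Rightarrow> 'a \<Rightarrow> 'm"
  ip :: "'m \<Rightarrow> 'm \<Rightarrow> 'a"

definition hnorm :: "'a calg \<Rightarrow> ('a, 'm, 'z) hmod_scheme \<Rightarrow> 'm \<Rightarrow> real" where
  "hnorm A M x = sqrt (nrm A (ip M x x))"

locale hilbert_module = A: c_star_algebra A + M: complex_space M
  for A :: "'a calg" and M :: "('a, 'm, 'z) hmod_scheme" +
  assumes act_closed: "\<lbrakk>x \<in> carr M; a \<in> carr A\<rbrakk> \<Longrightarrow> act M x a \<in> carr M"
    and act_add_left: "\<lbrakk>x \<in> carr M; y \<in> carr M; a \<in> carr A\<rbrakk>
          \<Longrightarrow> act M (add M x y) a = add M (act M x a) (act M y a)"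
    and act_add_right: "\<lbrakk>x \<in> carr M; a \<in> carr A; b \<in> carr A\<rbrakk>
          \<Longrightarrow> act M x (add A a b) = add M (act M x a) (act M x b)"
    and act_scl_left: "\<lbrakk>x \<in> carr M; a \<in> carr A\<rbrakk> \<Longrightarrow> act M (scl M r x) a = scl M r (act M x a)"
    and act_scl_right: "\<lbrakk>x \<in> carr M; a \<in> carr A\<rbrakk> \<Longrightarrow> act M x (scl A r a) = scl M r (act M x a)"
    and act_mul: "\<lbrakk>x \<in> carr M; a \<in> carr A; b \<in> carr A\<rbrakk>
          \<Longrightarrow> act M x (mul A a b) = act M (act M x a) b"
    and ip_closed: "\<lbrakk>x \<in> carr M; y \<in> carr M\<rbrakk> \<Longrightarrow> ip M x y \<in> carr A"
    and ip_add: "\<lbrakk>x \<in> carr M; y \<in> carr M; z \<in> carr M\<rbrakk>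
          \<Longrightarrow> ip M x (add M y z) = add A (ip M x y) (ip M x z)"
    and ip_scl: "\<lbrakk>x \<in> carr M; y \<in> carr M\<rbrakk> \<Longrightarrow> ip M x (scl M r y) = scl A r (ip M x y)"
    and ip_act: "\<lbrakk>x \<in> carr M; y \<in> carr M; a \<in> carr A\<rbrakk>
          \<Longrightarrow> ip M x (act M y a) = mul A (ip M x y) a"
    and ip_star: "\<lbrakk>x \<in> carr M; y \<in> carr M\<rbrakk> \<Longrightarrow> star A (ip M x y) = ip M y x"
    and ip_positive: "x \<in> carr M \<Longrightarrow> \<exists>a\<in>carr A. ip M x x = mul A (star A a) a"
    and ip_definite: "\<lbrakk>x \<in> carr M; ip M x x = zer A\<rbrakk> \<Longrightarrow> x = zer M"
    and module_complete: "norm_complete M (hnorm A M)"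

text \<open>
  \<open>op_bound A M N c T\<close> says that the operator norm of \<open>T\<close> is at most \<open>c\<close>.  Operators are
  functions on the carrier, \<open>undefined\<close> elsewhere, so that equality of operators is equality.
  Adjointable maps are automatically linear and bounded; boundedness is nevertheless recorded.
\<close>

definition op_bound :: "'a calg \<Rightarrow> ('a, 'm, 'y) hmod_scheme \<Rightarrow> ('a, 'n, 'z) hmod_scheme
    \<Rightarrow> real \<Rightarrow> ('m \<Rightarrow> 'n) \<Rightarrow> bool" where
  "op_bound A M N c T \<longleftrightarrow> 0 \<le> c \<and> (\<forall>x\<in>carr M. hnorm A N (T x) \<le> c * hnorm A M x)"

definition adjointable_ops :: "'a calg \<Rightarrow> ('a, 'm, 'y) hmod_scheme \<Rightarrow> ('a, 'n, 'z) hmod_scheme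
    \<Rightarrow> ('m \<Rightarrow> 'n) set" where
  "adjointable_ops A M N = {T \<in> carr M \<rightarrow>\<^sub>E carr N. (\<exists>c. op_bound A M N c T) \<and>
     (\<exists>S \<in> carr N \<rightarrow> carr M. \<forall>x\<in>carr M. \<forall>y\<in>carr N. ip N (T x) y = ip M x (S y))}"

text \<open>Finite sums of operators \<open>y \<otimes> x\<^sup>*\<close>, given by the list of pairs \<open>(y, x)\<close>.\<close>

definition finite_rank_op :: "('a, 'm, 'y) hmod_scheme \<Rightarrow> ('a, 'n, 'z) hmod_scheme
    \<Rightarrow> ('n \<times> 'm) list \<Rightarrow> 'm \<Rightarrow> 'n" where
  "finite_rank_op M N ps = (\<lambda>z\<in>carr M. vsum N (map (\<lambda>(y, x). act N y (ip M x z)) ps))"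

definition compact_ops :: "'a calg \<Rightarrow> ('a, 'm, 'y) hmod_scheme \<Rightarrow> ('a, 'n, 'z) hmod_scheme
    \<Rightarrow> ('m \<Rightarrow> 'n) set" where
  "compact_ops A M N = {T \<in> adjointable_ops A M N. \<forall>\<epsilon>>0. \<exists>ps \<in> lists (carr N \<times> carr M).
     op_bound A M N \<epsilon> (\<lambda>z\<in>carr M. diff N (T z) (finite_rank_op M N ps z))}"

definition op_add :: "('m, 'y) cspace_scheme \<Rightarrow> ('n, 'z) cspace_scheme
    \<Rightarrow> ('m \<Rightarrow> 'n) \<Rightarrow> ('m \<Rightarrow> 'n) \<Rightarrow> 'm \<Rightarrow> 'n" where
  "op_add M N S T = (\<lambda>x\<in>carr M. add N (S x) (T x))"

definition op_scl :: "('m, 'y) cspace_scheme \<Rightarrow> ('n, 'z) cspace_scheme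
    \<Rightarrow> complex \<Rightarrow> ('m \<Rightarrow> 'n) \<Rightarrow> 'm \<Rightarrow> 'n" where
  "op_scl M N c T = (\<lambda>x\<in>carr M. scl N c (T x))"

section \<open>Correspondences and tensor products\<close>

record ('a, 'b, 'f) corr = "('b, 'f) hmod" +
  lact :: "'a \<Rightarrow> 'f \<Rightarrow> 'f"

locale correspondence = A: c_star_algebra A + hilbert_module B F
  for A :: "'a calg" and B :: "'b calg" and F :: "('a, 'b, 'f, 'z) corr_scheme" +
  assumes lact_adjointable: "a \<in> carr A \<Longrightarrow> restrict (lact F a) (carr F) \<in> adjointable_ops B F F"
    and lact_add: "\<lbrakk>a \<in> carr A; a' \<in> carr A; f \<in> carr F\<rbrakk>
          \<Longrightarrow> lact F (add A a a') f = add F (lact F a f) (lact F a' f)"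
    and lact_scl: "\<lbrakk>a \<in> carr A; f \<in> carr F\<rbrakk> \<Longrightarrow> lact F (scl A r a) f = scl F r (lact F a f)"
    and lact_mul: "\<lbrakk>a \<in> carr A; a' \<in> carr A; f \<in> carr F\<rbrakk>
          \<Longrightarrow> lact F (mul A a a') f = lact F a (lact F a' f)"
    and lact_star: "\<lbrakk>a \<in> carr A; f \<in> carr F; g \<in> carr F\<rbrakk>
          \<Longrightarrow> ip F (lact F a f) g = ip F f (lact F (star A a) g)"
    and nondegenerate: "\<lbrakk>f \<in> carr F; 0 < \<epsilon>\<rbrakk> \<Longrightarrow> \<exists>ps \<in> lists (carr A \<times> carr F).
          hnorm B F (diff F f (vsum F (map (\<lambda>(a, g). lact F a g) ps))) < \<epsilon>"

text \<open>
  The elements \<open>\<Sum>\<^sub>i m\<^sub>i \<otimes> f\<^sub>i\<close> of the algebraic tensor product are represented by lists of pairs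
  \<open>(m\<^sub>i, f\<^sub>i)\<close>.  The bilinearity and balancing relations are not imposed here: they hold up to
  vectors of seminorm \<open>0\<close>, so the separated completion below imposes them.
\<close>

definition alg_tensor :: "'b calg \<Rightarrow> ('a, 'm, 'y) hmod_scheme \<Rightarrow> ('a, 'b, 'f, 'z) corr_scheme
    \<Rightarrow> ('b, ('m \<times> 'f) list) hmod" where
  "alg_tensor B M F =
    \<lparr> carr = lists (carr M \<times> carr F),
      zer = [],
      add = (@),
      scl = (\<lambda>c. map (\<lambda>(m, f). (scl M c m, f))),
      act = (\<lambda>xs b. map (\<lambda>(m, f). (m, act F f b)) xs),
      ip = (\<lambda>xs ys. vsum B [ip F f (lact F (ip M m m') f'). (m, f) \<leftarrow> xs, (m', f') \<leftarrow> ys]) \<rparr>"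

text \<open>Separated completion: Cauchy sequences modulo sequences whose difference tends to \<open>0\<close>.\<close>

definition cauchy_class :: "'b calg \<Rightarrow> ('b, 'p, 'z) hmod_scheme \<Rightarrow> (nat \<Rightarrow> 'p) \<Rightarrow> (nat \<Rightarrow> 'p) set"
  where
  "cauchy_class B P s =
    {t. cauchy_seq P (hnorm B P) t \<and> (\<lambda>n. hnorm B P (diff P (s n) (t n))) \<longlonglongrightarrow> 0}"

definition rep :: "'v set \<Rightarrow> 'v" where
  "rep c = (SOME s. s \<in> c)"

definition completion :: "'b calg \<Rightarrow> ('b, 'p, 'z) hmod_scheme \<Rightarrow> ('b, (nat \<Rightarrow> 'p) set) hmod" where
  "completion B P =
    \<lparr> carr = cauchy_class B P ` {s. cauchy_seq P (hnorm B P) s},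
      zer = cauchy_class B P (\<lambda>_. zer P),
      add = (\<lambda>c d. cauchy_class B P (\<lambda>n. add P (rep c n) (rep d n))),
      scl = (\<lambda>r c. cauchy_class B P (\<lambda>n. scl P r (rep c n))),
      act = (\<lambda>c b. cauchy_class B P (\<lambda>n. act P (rep c n) b)),
      ip = (\<lambda>c d. THE b. b \<in> carr B \<and>
              (\<lambda>n. nrm B (diff B (ip P (rep c n) (rep d n)) b)) \<longlonglongrightarrow> 0) \<rparr>"

definition tensor :: "'b calg \<Rightarrow> ('a, 'm, 'y) hmod_scheme \<Rightarrow> ('a, 'b, 'f, 'z) corr_scheme
    \<Rightarrow> ('b, (nat \<Rightarrow> ('m \<times> 'f) list) set) hmod" where
  "tensor B M F = completion B (alg_tensor B M F)"

text \<open>The operator \<open>t \<otimes> 1\<close> from \<open>M \<otimes> F\<close> to \<open>N \<otimes> F\<close>.\<close>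

definition tensor_map :: "'b calg \<Rightarrow> ('a, 'm, 'x) hmod_scheme \<Rightarrow> ('a, 'n, 'y) hmod_scheme
    \<Rightarrow> ('a, 'b, 'f, 'z) corr_scheme \<Rightarrow> ('m \<Rightarrow> 'n)
    \<Rightarrow> (nat \<Rightarrow> ('m \<times> 'f) list) set \<Rightarrow> (nat \<Rightarrow> ('n \<times> 'f) list) set" where
  "tensor_map B M N F t = (\<lambda>c\<in>carr (tensor B M F).
     cauchy_class B (alg_tensor B N F) (\<lambda>n. map (\<lambda>(m, f). (t m, f)) (rep c n)))"

section \<open>Adjoint and locally adjoint tensor product functors\<close>

text \<open>
  The objects of \<open>\<H>\<^sub>A\<close> are the Hilbert \<open>A\<close>-modules whose carrier is a set of elements of the type
  \<open>'m\<close>, and those of \<open>\<H>\<^sub>B\<close> the ones with carrier in \<open>'n\<close>; the two types play the role of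
  universes.  A family \<open>\<Phi> M N\<close> of maps from operators \<open>M \<otimes>\<^sub>A F \<rightarrow> N\<close> to operators
  \<open>M \<rightarrow> N \<otimes>\<^sub>B E\<close> is natural on the sets \<open>D M N\<close>.
\<close>

definition natural_hom_map ::
  "'a calg \<Rightarrow> 'b calg \<Rightarrow> ('a, 'b, 'f) corr \<Rightarrow> ('b, 'a, 'e) corr
   \<Rightarrow> (('a, 'm) hmod \<Rightarrow> ('b, 'n) hmod \<Rightarrow> ((nat \<Rightarrow> ('m \<times> 'f) list) set \<Rightarrow> 'n) set)
   \<Rightarrow> (('a, 'm) hmod \<Rightarrow> ('b, 'n) hmod \<Rightarrow>
        ((nat \<Rightarrow> ('m \<times> 'f) list) set \<Rightarrow> 'n) \<Rightarrow> 'm \<Rightarrow> (nat \<Rightarrow> ('n \<times> 'e) list) set) \<Rightarrow> bool" where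
  "natural_hom_map A B F E D \<Phi> \<longleftrightarrow>
    (\<forall>M M' N N' s t T.
       hilbert_module A M \<and> hilbert_module A M' \<and> hilbert_module B N \<and> hilbert_module B N' \<and>
       s \<in> adjointable_ops A M' M \<and> t \<in> adjointable_ops B N N' \<and> T \<in> D M N \<longrightarrow>
       \<Phi> M' N' (compose (carr (tensor B M' F)) t
                  (compose (carr (tensor B M' F)) T (tensor_map B M' M F s)))
       = compose (carr M') (tensor_map A N N' E t) (compose (carr M') (\<Phi> M N T) s))"

text \<open>
  Adjointness in the usual sense of functors: natural bijections of Hom-sets (linearity of the
  bijections then follows from naturality).
\<close>

definition adjoint_tensor_functors ::
  "'m itself \<Rightarrow> 'n itself \<Rightarrow> 'a calg \<Rightarrow> 'b calg \<Rightarrow> ('a, 'b, 'f) corr \<Rightarrow> ('b, 'a, 'e) corr \<Rightarrow> bool"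
  where
  "adjoint_tensor_functors (_ :: 'm itself) (_ :: 'n itself) A B F E \<longleftrightarrow>
    (\<exists>\<Phi> :: ('a, 'm) hmod \<Rightarrow> ('b, 'n) hmod \<Rightarrow> _.
      (\<forall>M N. hilbert_module A M \<and> hilbert_module B N \<longrightarrow>
         bij_betw (\<Phi> M N) (adjointable_ops B (tensor B M F) N)
                          (adjointable_ops A M (tensor A N E))) \<and>
      natural_hom_map A B F E (\<lambda>M N. adjointable_ops B (tensor B M F) N) \<Phi>)"

definition locally_adjoint_tensor_functors ::
  "'m itself \<Rightarrow> 'n itself \<Rightarrow> 'a calg \<Rightarrow> 'b calg \<Rightarrow> ('a, 'b, 'f) corr \<Rightarrow> ('b, 'a, 'e) corr \<Rightarrow> bool"
  where
  "locally_adjoint_tensor_functors (_ :: 'm itself) (_ :: 'n itself) A B F E \<longleftrightarrow>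
    (\<exists>\<Phi> :: ('a, 'm) hmod \<Rightarrow> ('b, 'n) hmod \<Rightarrow> _.
      (\<forall>M N. hilbert_module A M \<and> hilbert_module B N \<longrightarrow>
         (let MF = tensor B M F; NE = tensor A N E; K = compact_ops B MF N in
           bij_betw (\<Phi> M N) K (compact_ops A M NE) \<and>
           (\<forall>S\<in>K. \<forall>T\<in>K. \<Phi> M N (op_add MF N S T) = op_add M NE (\<Phi> M N S) (\<Phi> M N T)) \<and>
           (\<forall>r. \<forall>T\<in>K. \<Phi> M N (op_scl MF N r T) = op_scl M NE r (\<Phi> M N T)) \<and>
           (\<exists>C. \<forall>T\<in>K. \<forall>c. op_bound B MF N c T \<longrightarrow> op_bound A M NE (C * c) (\<Phi> M N T)) \<and>
           (\<exists>C. \<forall>T\<in>K. \<forall>c. op_bound A M NE c (\<Phi> M N T) \<longrightarrow> op_bound B MF N (C * c) T))) \<and>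
      natural_hom_map A B F E (\<lambda>M N. compact_ops B (tensor B M F) N) \<Phi>)"

section \<open>Function algebras\<close>

text \<open>
  Functions on a space are represented as functions on the whole type that vanish off the space.
  With this convention extension by zero \<open>C\<^sub>0(U) \<subseteq> C(X)\<close> is an inclusion of sets, and the
  supremum over the type is the supremum over the space (and \<open>0\<close> for the empty space).
\<close>

definition cont_funs :: "'x topology \<Rightarrow> ('x \<Rightarrow> complex) set" where
  "cont_funs Z = {f. continuous_map Z euclidean f \<and> (\<forall>x. x \<notin> topspace Z \<longrightarrow> f x = 0)}"

definition C0_funs :: "'x topology \<Rightarrow> ('x \<Rightarrow> complex) set" where
  "C0_funs Z = {f \<in> cont_funs Z. \<forall>\<epsilon>>0. compactin Z {x \<in> topspace Z. \<epsilon> \<le> cmod (f x)}}"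

definition function_alg :: "('x \<Rightarrow> complex) set \<Rightarrow> ('x \<Rightarrow> complex) calg" where
  "function_alg S =
    \<lparr> carr = S,
      zer = (\<lambda>_. 0),
      add = (\<lambda>f g x. f x + g x),
      scl = (\<lambda>c f x. c * f x),
      mul = (\<lambda>f g x. f x * g x),
      star = (\<lambda>f x. cnj (f x)),
      nrm = (\<lambda>f. SUP x. cmod (f x)) \<rparr>"

definition C_alg :: "'x topology \<Rightarrow> ('x \<Rightarrow> complex) calg" where
  "C_alg X = function_alg (cont_funs X)"

definition C0_alg :: "'x topology \<Rightarrow> ('x \<Rightarrow> complex) calg" where
  "C0_alg Z = function_alg (C0_funs Z)"

text \<open>
  Since extension by zero is an inclusion, the correspondence \<open>F\<close> from \<open>C(X)\<close> to \<open>C\<^sub>0(U)\<close> and the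
  correspondence \<open>E\<close> from \<open>C\<^sub>0(U)\<close> to \<open>C(X)\<close> have the same underlying data, for \<open>Z = U\<close>.
\<close>

definition C0_corr :: "'x topology \<Rightarrow> ('x \<Rightarrow> complex, 'x \<Rightarrow> complex, 'x \<Rightarrow> complex) corr" where
  "C0_corr Z =
    \<lparr> carr = C0_funs Z,
      zer = (\<lambda>_. 0),
      add = (\<lambda>f g x. f x + g x),
      scl = (\<lambda>c f x. c * f x),
      act = (\<lambda>f a x. f x * a x),
      ip = (\<lambda>f g x. cnj (f x) * g x),
      lact = (\<lambda>a f x. a x * f x) \<rparr>"

section \<open>Continuous fields of Hilbert spaces\<close>

text \<open>Hilbert spaces are Hilbert modules over the C*-algebra of complex numbers.\<close>

definition complex_alg :: "complex calg" where
  "complex_alg = \<lparr> carr = UNIV, zer = 0, add = (+), scl = (*), mul = (*), star = cnj, nrm = cmod \<rparr>"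

text \<open>A field of Hilbert spaces over \<open>Z\<close> with its continuous sections, functions on \<open>topspace Z\<close>.\<close>

record ('x, 'h) hfield =
  fib :: "'x \<Rightarrow> (complex, 'h) hmod"
  sec :: "('x \<Rightarrow> 'h) set"

text \<open>Sections that are locally uniformly approximable by members of \<open>G\<close>.\<close>

definition locally_approximable ::
  "'x topology \<Rightarrow> ('x \<Rightarrow> (complex, 'h) hmod) \<Rightarrow> ('x \<Rightarrow> 'h) set \<Rightarrow> ('x \<Rightarrow> 'h) set" where
  "locally_approximable Z H G = {s \<in> (\<Pi>\<^sub>E z\<in>topspace Z. carr (H z)).
     \<forall>z\<in>topspace Z. \<forall>\<epsilon>>0. \<exists>W. openin Z W \<and> z \<in> W \<and>
       (\<exists>g\<in>G. \<forall>w\<in>W. hnorm complex_alg (H w) (diff (H w) (s w) (g w)) < \<epsilon>)}"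

text \<open>
  The continuous field of a Hilbert \<open>C\<^sub>0(Z)\<close>-module \<open>M\<close>: the fibre at \<open>z\<close> is the quotient of \<open>M\<close> by
  \<open>{m. \<langle>m,m\<rangle>(z) = 0}\<close> (which is already complete), and the elements of \<open>M\<close> generate the
  continuous sections.
\<close>

definition fib_class :: "('x \<Rightarrow> complex, 'm, 'z) hmod_scheme \<Rightarrow> 'x \<Rightarrow> 'm \<Rightarrow> 'm set" where
  "fib_class M z m = {m' \<in> carr M. ip M (diff M m m') (diff M m m') z = 0}"

definition fibre :: "('x \<Rightarrow> complex, 'm, 'z) hmod_scheme \<Rightarrow> 'x \<Rightarrow> (complex, 'm set) hmod" where
  "fibre M z =
    \<lparr> carr = fib_class M z ` carr M,
      zer = fib_class M z (zer M),
      add = (\<lambda>p q. fib_class M z (add M (rep p) (rep q))),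
      scl = (\<lambda>c p. fib_class M z (scl M c (rep p))),
      act = (\<lambda>p c. fib_class M z (scl M c (rep p))),
      ip = (\<lambda>p q. ip M (rep p) (rep q) z) \<rparr>"

definition field_of :: "'x topology \<Rightarrow> ('x \<Rightarrow> complex, 'm, 'z) hmod_scheme \<Rightarrow> ('x, 'm set) hfield"
  where
  "field_of Z M =
    \<lparr> fib = fibre M,
      sec = locally_approximable Z (fibre M) {(\<lambda>z\<in>topspace Z. fib_class M z m) | m. m \<in> carr M} \<rparr>"

text \<open>The map that an operator \<open>t\<close> from \<open>M\<close> to \<open>N\<close> induces on the fibres at \<open>z\<close>.\<close>

definition fibre_map :: "('x \<Rightarrow> complex, 'n, 'z) hmod_scheme \<Rightarrow> ('m \<Rightarrow> 'n) \<Rightarrow> 'x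
    \<Rightarrow> 'm set \<Rightarrow> 'n set" where
  "fibre_map N t z p = fib_class N z (t (rep p))"

definition restrict_field :: "'x topology \<Rightarrow> 'x set \<Rightarrow> ('x, 'h) hfield \<Rightarrow> ('x, 'h) hfield" where
  "restrict_field X U H =
    \<lparr> fib = fib H,
      sec = locally_approximable (subtopology X U) (fib H) ((\<lambda>s. restrict s U) ` sec H) \<rparr>"

definition zero_hilbert_space :: "(complex, 'h) hmod" where
  "zero_hilbert_space =
    \<lparr> carr = {undefined}, zer = undefined, add = (\<lambda>_ _. undefined), scl = (\<lambda>_ _. undefined),
      act = (\<lambda>_ _. undefined), ip = (\<lambda>_ _. 0) \<rparr>"

text \<open>
  Extension by zero of a field on \<open>U\<close>: the fibres off \<open>U\<close> are zero, and a section is continuous if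
  it is continuous on \<open>U\<close> and its norm is a continuous function on \<open>X\<close> (so tends to \<open>0\<close> at the
  boundary of \<open>U\<close>).
\<close>

definition extend_field :: "'x topology \<Rightarrow> 'x set \<Rightarrow> ('x, 'h) hfield \<Rightarrow> ('x, 'h) hfield" where
  "extend_field X U H =
    (let H' = (\<lambda>x. if x \<in> U then fib H x else zero_hilbert_space) in
    \<lparr> fib = H',
      sec = {s \<in> (\<Pi>\<^sub>E x\<in>topspace X. carr (H' x)). restrict s U \<in> sec H \<and>
               continuous_map X euclideanreal (\<lambda>x. hnorm complex_alg (H' x) (s x))} \<rparr>)"

text \<open>
  Isomorphisms of fields: fibrewise unitaries (inner product preserving bijections, hence linear)
  that match the continuous sections.
\<close>

definition field_iso :: "'x topology \<Rightarrow> ('x \<Rightarrow> 'h \<Rightarrow> 'k) \<Rightarrow> ('x, 'h) hfield \<Rightarrow> ('x, 'k) hfield \<Rightarrow> bool"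
  where
  "field_iso Z V H K \<longleftrightarrow>
    (\<forall>z\<in>topspace Z. bij_betw (V z) (carr (fib H z)) (carr (fib K z)) \<and>
       (\<forall>p\<in>carr (fib H z). \<forall>q\<in>carr (fib H z). ip (fib K z) (V z p) (V z q) = ip (fib H z) p q)) \<and>
    (\<lambda>s. \<lambda>z\<in>topspace Z. V z (s z)) ` sec H = sec K"

text \<open>
  Under the passage from modules to fields, \<open>\<otimes> F\<close> is naturally isomorphic to restriction of fields
  from \<open>X\<close> to \<open>U\<close>, respectively \<open>\<otimes> E\<close> to extension of fields by zero.  In the second case the
  naturality squares off \<open>U\<close> commute trivially, since their target is a zero space.
\<close>

definition tensor_is_restriction :: "'m itself \<Rightarrow> 'x topology \<Rightarrow> 'x set
    \<Rightarrow> ('x \<Rightarrow> complex, 'x \<Rightarrow> complex, 'f) corr \<Rightarrow> bool" where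
  "tensor_is_restriction (_ :: 'm itself) X U F \<longleftrightarrow>
    (let A = C_alg X; B = C0_alg (subtopology X U) in
     \<exists>V :: ('x \<Rightarrow> complex, 'm) hmod \<Rightarrow> _.
      (\<forall>M. hilbert_module A M \<longrightarrow>
         field_iso (subtopology X U) (V M) (field_of (subtopology X U) (tensor B M F))
                                           (restrict_field X U (field_of X M))) \<and>
      (\<forall>M N t. hilbert_module A M \<and> hilbert_module A N \<and> t \<in> adjointable_ops A M N \<longrightarrow>
         (\<forall>u\<in>U. \<forall>p\<in>carr (fibre (tensor B M F) u).
            V N u (fibre_map (tensor B N F) (tensor_map B M N F t) u p)
            = fibre_map N t u (V M u p))))"

definition tensor_is_extension :: "'n itself \<Rightarrow> 'x topology \<Rightarrow> 'x set
    \<Rightarrow> ('x \<Rightarrow> complex, 'x \<Rightarrow> complex, 'e) corr \<Rightarrow> bool" where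
  "tensor_is_extension (_ :: 'n itself) X U E \<longleftrightarrow>
    (let A = C_alg X; B = C0_alg (subtopology X U) in
     \<exists>V :: ('x \<Rightarrow> complex, 'n) hmod \<Rightarrow> _.
      (\<forall>M. hilbert_module B M \<longrightarrow>
         field_iso X (V M) (field_of X (tensor A M E))
                           (extend_field X U (field_of (subtopology X U) M))) \<and>
      (\<forall>M N t. hilbert_module B M \<and> hilbert_module B N \<and> t \<in> adjointable_ops B M N \<longrightarrow>
         (\<forall>u\<in>U. \<forall>p\<in>carr (fibre (tensor A M E) u).
            V N u (fibre_map (tensor A N E) (tensor_map A M N E t) u p)
            = fibre_map N t u (V M u p))))"

end

theory Submission
  imports Defs
begin

text \<open>
  Evaluation \<open>m \<otimes> f \<mapsto> m f\<close> is isometric, so it identifies \<open>M \<otimes> C\<^sub>0(U)\<close> with the submodule of those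
  \<open>m \<in> M\<close> for which \<open>\<langle>m, m\<rangle>\<close> vanishes off \<open>U\<close>.  For a Hilbert \<open>C(X)\<close>-module \<open>M\<close> this is the module
  of the restricted field; for a Hilbert \<open>C\<^sub>0(U)\<close>-module \<open>N\<close> it is all of \<open>N\<close>, now acted on by \<open>C(X)\<close>.
  Under these identifications the hom-set map is the inverse of restricting operators \<open>M \<rightarrow> N\<close> to
  that submodule.  Restriction is isometric, because \<open>(T z) f = T (z f)\<close> and \<open>z f\<close> lies in the
  submodule.  Compact operators extend, because \<open>y \<otimes> x\<^sup>*\<close> does when \<open>\<langle>x, x\<rangle>\<close> vanishes off \<open>U\<close>;
  arbitrary operators extend along the projection \<open>1\<^sub>U\<close> when \<open>U\<close> is clopen.

  Conversely, an adjunction sends the identification \<open>C(X) \<otimes> F \<cong> C\<^sub>0(U)\<close> to multiplication by some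
  \<open>h \<in> C\<^sub>0(U)\<close>, and naturality makes every \<open>g \<in> C\<^sub>0(U)\<close> the image of \<open>h\<close> under an adjointable
  operator, so that \<open>\<bar>g\<bar> \<le> c \<bar>h\<bar>\<close>.  Taking for \<open>g\<close> a bump function and then \<open>\<surd>\<bar>h\<bar>\<close> shows that \<open>\<bar>h\<bar>\<close>
  is bounded below on \<open>U\<close>, so \<open>U\<close> is closed.
\<close>

section \<open>Continuous functions vanishing off a set\<close>

text \<open>With functions extended by zero, C_0(U) and C(X) are two ideals \<open>van X V\<close>
  of one algebra, \<open>V = U\<close> and \<open>V = topspace X\<close>, so a single development
  covers modules over both, and norm estimates become pointwise estimates. Two obstacles shape the
  proof. A C_0(U)-module \<open>N\<close> carries no given action of C(X), yet N \<otimes> E needs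
  one; it is obtained as a limit and pinned down by inner products. And extending an operator
  \<open>T\<close> from the submodule to \<open>M\<close>, with adjoint \<open>R\<close>, requires
  for each \<open>z\<close> a vector \<open>w\<close> of \<open>N\<close> with <w, y> = <z, R y> for
  all \<open>y\<close>. Near a point of \<open>U\<close> the vector T (z f) does this when f is 1
  there, but such local vectors need not assemble to an element of \<open>N\<close>, whose norm must
  tend to 0 at the boundary of \<open>U\<close>. Compactness of \<open>T\<close>, or closedness of
  \<open>U\<close>, is what produces \<open>w\<close>. Restriction meets no such obstacle: the
  adjoint of an operator M \<rightarrow> N takes its values in the submodule by itself. In the
  converse, the square root of \<bar>h\<bar> is a useful test function because it lies in C_0(U)
  again but decays more slowly than \<open>h\<close>, so h can dominate it only by being bounded
  away from 0 on \<open>U\<close>.\<close>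

definition van :: "'x topology \<Rightarrow> 'x set \<Rightarrow> ('x \<Rightarrow> complex) set" where
  "van X V = {f \<in> cont_funs X. \<forall>x. x \<notin> V \<longrightarrow> f x = 0}"

lemma continuous_map_mult_complex:
  fixes f g :: "'x \<Rightarrow> complex"
  assumes "continuous_map X euclidean f" and "continuous_map X euclidean g"
  shows "continuous_map X euclidean (\<lambda>x. f x * g x)"
  using assms by (simp add: continuous_map_atin tendsto_mult)

lemma continuous_map_compose_on:
  assumes "continuous_map X euclidean f" and "continuous_on UNIV h"
  shows "continuous_map X euclidean (\<lambda>x. h (f x))"
  using continuous_map_compose[OF assms(1), of euclidean h] assms(2) by (simp add: o_def)

lemma van_contD: "f \<in> van X V \<Longrightarrow> continuous_map X euclidean f"
  by (simp add: van_def cont_funs_def)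

lemma van_zero_outside: "f \<in> van X V \<Longrightarrow> x \<notin> V \<Longrightarrow> f x = 0"
  by (simp add: van_def)

lemma van_mono: "V \<subseteq> W \<Longrightarrow> van X V \<subseteq> van X W"
  by (auto simp: van_def)

lemma vanI:
  assumes "continuous_map X euclidean f" and "\<And>x. x \<notin> V \<Longrightarrow> f x = 0"
    and "\<And>x. x \<notin> topspace X \<Longrightarrow> f x = 0"
  shows "f \<in> van X V"
  using assms by (simp add: van_def cont_funs_def)

lemma van_topspace: "van X (topspace X) = cont_funs X"
  by (auto simp: van_def cont_funs_def)

lemma van_zero: "(\<lambda>_. 0) \<in> van X V"
  by (simp add: van_def cont_funs_def)

lemma van_add: "f \<in> van X V \<Longrightarrow> g \<in> van X V \<Longrightarrow> (\<lambda>x. f x + g x) \<in> van X V"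
  by (auto simp: van_def cont_funs_def intro!: continuous_map_add)

lemma van_mult_ideal: "f \<in> van X V \<Longrightarrow> g \<in> cont_funs X \<Longrightarrow> (\<lambda>x. f x * g x) \<in> van X V"
  by (auto simp: van_def cont_funs_def intro!: continuous_map_mult_complex)

lemma van_mult: "f \<in> van X V \<Longrightarrow> g \<in> van X W \<Longrightarrow> (\<lambda>x. f x * g x) \<in> van X V"
  by (rule van_mult_ideal) (auto simp: van_def)

lemma van_mult': "f \<in> van X V \<Longrightarrow> g \<in> van X W \<Longrightarrow> (\<lambda>x. f x * g x) \<in> van X W"
  using van_mult[of g X W f V] by (simp add: mult.commute)

lemma van_compose:
  assumes "f \<in> van X V" and "continuous_on UNIV h" and "h 0 = 0"
  shows "(\<lambda>x. h (f x)) \<in> van X V"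
  using assms continuous_map_compose_on[of X f h] by (auto simp: van_def cont_funs_def)

lemma van_scl: "f \<in> van X V \<Longrightarrow> (\<lambda>x. c * f x) \<in> van X V"
  by (rule van_compose) (auto intro!: continuous_intros)

lemma van_diff: "f \<in> van X V \<Longrightarrow> g \<in> van X V \<Longrightarrow> (\<lambda>x. f x - g x) \<in> van X V"
  using van_add[of f X V "\<lambda>x. (-1) * g x"] van_scl[of g X V "-1"] by simp

lemma van_cnj: "f \<in> van X V \<Longrightarrow> (\<lambda>x. cnj (f x)) \<in> van X V"
  by (rule van_compose) (auto intro!: continuous_intros)

section \<open>Function algebras in the supremum norm\<close>

lemma function_alg_sel [simp]:
  "carr (function_alg S) = S" "zer (function_alg S) = (\<lambda>_. 0)"
  "add (function_alg S) = (\<lambda>f g x. f x + g x)" "scl (function_alg S) = (\<lambda>c f x. c * f x)"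
  "mul (function_alg S) = (\<lambda>f g x. f x * g x)" "star (function_alg S) = (\<lambda>f x. cnj (f x))"
  "nrm (function_alg S) = (\<lambda>f. SUP x. cmod (f x))"
  by (simp_all add: function_alg_def)

lemma diff_function_alg [simp]: "diff (function_alg S) f g = (\<lambda>x. f x - g x)"
  by (simp add: diff_def)

lemma SUP_cmod_ge:
  fixes f :: "'x \<Rightarrow> complex"
  assumes "\<And>x. cmod (f x) \<le> c"
  shows "cmod (f x) \<le> (SUP x. cmod (f x))"
  by (rule cSUP_upper) (use assms in \<open>auto intro!: bdd_aboveI[of _ c]\<close>)

lemma SUP_cmod_le: "(\<And>x. cmod (f x) \<le> c) \<Longrightarrow> (SUP x. cmod (f x)) \<le> c"
  by (auto intro: cSUP_least)

lemma SUP_cmod_scale: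
  fixes f :: "'x \<Rightarrow> complex"
  assumes "\<And>x. cmod (f x) \<le> c"
  shows "(SUP x. cmod (r * f x)) = cmod r * (SUP x. cmod (f x))"
proof -
  have le: "(SUP x. cmod (r * g x)) \<le> cmod r * (SUP x. cmod (g x))"
    if "\<And>x. cmod (g x) \<le> c" for c r and g :: "'x \<Rightarrow> complex"
    by (rule SUP_cmod_le) (auto simp: norm_mult intro: mult_left_mono SUP_cmod_ge[OF that])
  show ?thesis
  proof (cases "r = 0")
    case False
    have "cmod (r * f x) \<le> cmod r * c" for x
      using assms[of x] by (simp add: norm_mult mult_left_mono)
    from le[of "\<lambda>x. r * f x", OF this, of "inverse r"] False
    have "cmod r * (SUP x. cmod (f x)) \<le> (SUP x. cmod (r * f x))"
      by (simp add: norm_divide field_simps)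
    then show ?thesis using le[OF assms] by (intro antisym)
  qed simp
qed

lemma SUP_cmod_square:
  assumes "\<And>x. cmod (f x) \<le> c"
  shows "(SUP x. cmod (cnj (f x) * f x)) = (SUP x. cmod (f x))\<^sup>2"
proof (rule antisym)
  have ub: "cmod (f x) \<le> (SUP x. cmod (f x))" for x
    by (rule SUP_cmod_ge[OF assms])
  show "(SUP x. cmod (cnj (f x) * f x)) \<le> (SUP x. cmod (f x))\<^sup>2"
    using ub by (auto intro!: cSUP_least power_mono simp: norm_mult simp flip: power2_eq_square)
  have ub2: "cmod (f x)^2 \<le> (SUP x. cmod (cnj (f x) * f x))" for x
  proof -
    have "cmod (cnj (f x) * f x) \<le> (SUP x. cmod (cnj (f x) * f x))"
      by (rule SUP_cmod_ge[of "\<lambda>x. cnj (f x) * f x" "c^2"])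
        (use assms in \<open>simp add: norm_mult power_mono flip: power2_eq_square\<close>)
    thus ?thesis by (simp add: norm_mult power2_eq_square)
  qed
  have nn: "0 \<le> (SUP x. cmod (cnj (f x) * f x))"
    using ub2[of undefined] by (meson order_trans zero_le_power2)
  have "(SUP x. cmod (f x)) \<le> sqrt (SUP x. cmod (cnj (f x) * f x))"
    by (rule cSUP_least) (use ub2 real_le_rsqrt in auto)
  moreover have "0 \<le> (SUP x. cmod (f x))"
    using ub[of undefined] norm_ge_zero order_trans by blast
  ultimately show "(SUP x. cmod (f x))\<^sup>2 \<le> (SUP x. cmod (cnj (f x) * f x))"
    using nn by (metis power_mono real_sqrt_pow2)
qed

locale compact_Hausdorff =
  fixes X :: "'x topology"
  assumes compact: "compact_space X" and Hausdorff: "Hausdorff_space X"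
begin

lemma cont_bounded:
  assumes "f \<in> cont_funs X"
  obtains c where "0 \<le> c" and "\<And>x. cmod (f x) \<le> c"
proof -
  have "compactin euclidean (f ` topspace X)"
    using assms compact image_compactin[of X "topspace X" euclidean f]
    by (simp add: cont_funs_def compact_space_def)
  then have "bounded (f ` topspace X)"
    by (simp add: compact_imp_bounded)
  then obtain c where "\<forall>y\<in>f ` topspace X. norm y \<le> c"
    by (auto simp: bounded_iff)
  then have "cmod (f x) \<le> max c 0" for x
    using assms by (cases "x \<in> topspace X") (auto simp: cont_funs_def)
  then show thesis using that[of "max c 0"] by auto
qed

lemma van_bounded:
  assumes "f \<in> van X V"
  obtains c where "0 \<le> c" and "\<And>x. cmod (f x) \<le> c"
  using assms cont_bounded[of f] by (auto simp: van_def)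

lemma van_complete: "norm_complete (function_alg (van X V)) (nrm (function_alg (van X V)))"
  unfolding norm_complete_def
proof (intro allI impI)
  fix s assume s: "cauchy_seq (function_alg (van X V)) (nrm (function_alg (van X V))) s"
  then have sv: "s n \<in> van X V" for n
    by (simp add: cauchy_seq_def)
  \<comment> \<open>A supremum dominates its terms only if the set is bounded above, so the
    differences are bounded before the norm is compared with values at points.\<close>
  have bd: "\<exists>c. \<forall>x. cmod (s i x - s j x) \<le> c" for i j
  proof -
    have "(\<lambda>x. s i x - s j x) \<in> van X V"
      by (intro van_diff sv)
    then show ?thesis using van_bounded by metis
  qed
  have uc: "\<exists>k. \<forall>i\<ge>k. \<forall>j\<ge>k. \<forall>x. cmod (s i x - s j x) < e" if "e > 0" for e
  proof -
    obtain k where k: "\<forall>i\<ge>k. \<forall>j\<ge>k. (SUP x. cmod (s i x - s j x)) < e"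
      using s \<open>e > 0\<close> unfolding cauchy_seq_def diff_function_alg function_alg_sel by meson
    have "cmod (s i x - s j x) < e" if "i \<ge> k" "j \<ge> k" for i j x
    proof -
      obtain c where "\<And>x. cmod (s i x - s j x) \<le> c" using bd by blast
      from SUP_cmod_ge[of "\<lambda>x. s i x - s j x", OF this] k that show ?thesis by (meson le_less_trans)
    qed
    then show ?thesis by blast
  qed
  have "Cauchy (\<lambda>n. s n x)" for x
    unfolding Cauchy_def dist_norm using uc by blast
  then have lim: "(\<lambda>n. s n x) \<longlonglongrightarrow> lim (\<lambda>n. s n x)" for x
    by (simp add: Cauchy_convergent_iff convergent_LIMSEQ_iff)
  define g where "g x = lim (\<lambda>n. s n x)" for x
  have close: "\<exists>k. \<forall>i\<ge>k. \<forall>x. cmod (s i x - g x) \<le> e" if "e > 0" for e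
  proof -
    obtain k where k: "\<forall>i\<ge>k. \<forall>j\<ge>k. \<forall>x. cmod (s i x - s j x) < e" using uc[OF \<open>e > 0\<close>] by blast
    have "cmod (s i x - g x) \<le> e" if "i \<ge> k" for i x
    proof (rule LIMSEQ_le_const2)
      show "(\<lambda>j. cmod (s i x - s j x)) \<longlonglongrightarrow> cmod (s i x - g x)"
        unfolding g_def by (intro tendsto_intros lim)
      show "\<exists>N. \<forall>n\<ge>N. cmod (s i x - s n x) \<le> e" using k that by (meson less_imp_le)
    qed
    then show ?thesis by blast
  qed
  have "continuous_map X Met_TC.mtopology g"
  proof (rule Met_TC.continuous_map_uniform_limit[where F = sequentially and f = s])
    show "\<forall>\<^sub>F n in sequentially. continuous_map X Met_TC.mtopology (s n)"
      using van_contD[OF sv] by (simp add: mtopology_is_euclidean)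
    show "\<forall>\<^sub>F n in sequentially. \<forall>x\<in>topspace X. g x \<in> UNIV \<and> dist (s n x) (g x) < e" if "0 < e" for e
    proof -
      obtain k where "\<forall>i\<ge>k. \<forall>x. cmod (s i x - g x) \<le> e/2"
        using close[of "e/2"] half_gt_zero[OF \<open>0 < e\<close>] by blast
      then have "\<forall>i\<ge>k. \<forall>x. cmod (s i x - g x) < e" using that by (smt (verit) field_sum_of_halves)
      then show ?thesis by (auto simp: eventually_sequentially dist_norm)
    qed
  qed auto
  moreover have "g x = 0" if "x \<notin> V \<or> x \<notin> topspace X" for x
  proof -
    have "s n x = 0" for n using sv[of n] that by (auto simp: van_def cont_funs_def)
    then show ?thesis by (simp add: g_def)
  qed
  ultimately have gv: "g \<in> van X V" by (intro vanI) (auto simp: mtopology_is_euclidean)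
  have "(\<lambda>n. (SUP x. cmod (s n x - g x))) \<longlonglongrightarrow> 0"
  proof (rule LIMSEQ_I)
    fix r :: real assume "r > 0"
    then obtain k where k: "\<forall>i\<ge>k. \<forall>x. cmod (s i x - g x) \<le> r/2"
      using close[of "r/2"] half_gt_zero by blast
    have "norm ((SUP x. cmod (s n x - g x)) - 0) < r" if "n \<ge> k" for n
    proof -
      have "(SUP x. cmod (s n x - g x)) \<le> r/2"
        by (rule SUP_cmod_le) (use k that in auto)
      moreover have "0 \<le> (SUP x. cmod (s n x - g x))"
        using SUP_cmod_ge[of "\<lambda>x. s n x - g x" "r/2" undefined] k that norm_ge_zero order_trans by blast
      ultimately show ?thesis using \<open>r > 0\<close> by simp
    qed
    then show "\<exists>no. \<forall>n\<ge>no. norm ((SUP x. cmod (s n x - g x)) - 0) < r" by blast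
  qed
  then show "\<exists>x\<in>carr (function_alg (van X V)).
     (\<lambda>n. nrm (function_alg (van X V)) (diff (function_alg (van X V)) (s n) x)) \<longlonglongrightarrow> 0"
    using gv by auto
qed

lemma c_star_algebra_van: "c_star_algebra (function_alg (van X V))"
proof -
  have ge: "cmod (f x) \<le> (SUP x. cmod (f x))" if "f \<in> van X V" for f x
    using van_bounded[OF that] SUP_cmod_ge[of f] by metis
  show ?thesis
  proof (unfold_locales, goal_cases)
    case (23 f)
    then have "cmod (f undefined) \<le> (SUP x. cmod (f x))" by (intro ge) simp
    then have "0 \<le> (SUP x. cmod (f x))" using norm_ge_zero order_trans by blast
    then show ?case by simp
  next
    case (24 f)
    then have "cmod (f x) \<le> 0" for x using ge[of f x] by simp
    then show ?case by (simp add: fun_eq_iff)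
  next
    case (25 f r)
    then obtain c where "\<And>x. cmod (f x) \<le> c" using van_bounded[of f V] by auto
    from SUP_cmod_scale[OF this] show ?case by simp
  next
    case (26 f g)
    then show ?case using ge[of f] ge[of g]
      by (auto intro!: cSUP_least order_trans[OF norm_triangle_ineq] add_mono)
  next
    case (27 f g)
    then have "cmod (f undefined) \<le> (SUP x. cmod (f x))" by (intro ge) simp
    then have "0 \<le> (SUP x. cmod (f x))" using norm_ge_zero order_trans by blast
    with 27 show ?case using ge[of f] ge[of g]
      by (auto intro!: cSUP_least mult_mono simp: norm_mult)
  next
    case (28 f)
    then obtain c where "\<And>x. cmod (f x) \<le> c" using van_bounded[of f V] by auto
    from SUP_cmod_square[OF this] show ?case by simp
  next
    case 29 then show ?case by (rule van_complete)
  qed (auto simp: van_zero van_add van_scl van_mult van_cnj algebra_simps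
      diff_def intro: van_mult)
qed

text \<open>Only continuity at the boundary of \<open>U\<close> is at stake. The preimage of a
  neighbourhood of 0 contains the complement of {\<bar>f\<bar> \<ge> e} for some e > 0, and this set
  is compact, hence closed in X. Conversely {\<bar>f\<bar> \<ge> e} is closed in the compact space
  and contained in \<open>U\<close>.\<close>

lemma C0_funs_eq_van:
  assumes U: "openin X U"
  shows "C0_funs (subtopology X U) = van X U"
proof (intro set_eqI iffI)
  have top: "topspace (subtopology X U) = U"
    using openin_subset[OF U] by auto
  fix f
  {
    assume f: "f \<in> C0_funs (subtopology X U)"
    then have cf: "continuous_map (subtopology X U) euclidean f" and z: "\<And>x. x \<notin> U \<Longrightarrow> f x = 0"
      by (auto simp: C0_funs_def cont_funs_def top)
    have "openin X {x \<in> topspace X. f x \<in> W}" if "open W" for W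
    proof -
      have "openin (subtopology X U) {x \<in> U. f x \<in> W}"
        using openin_continuous_map_preimage[OF cf, of W, unfolded top] that by simp
      then have 1: "openin X {x \<in> U. f x \<in> W}"
        using U openin_trans_full by blast
      show ?thesis
      proof (cases "0 \<in> W")
        case False
        then have "x \<in> U" if "f x \<in> W" for x
          using z[of x] that False by metis
        then have "{x \<in> topspace X. f x \<in> W} = {x \<in> U. f x \<in> W}"
          using openin_subset[OF U] by auto
        with 1 show ?thesis by simp
      next
        case True
        then obtain e where e: "e > 0" "ball 0 e \<subseteq> W"
          by (rule openE[OF \<open>open W\<close>])
        have "compactin (subtopology X U) {x \<in> U. e \<le> cmod (f x)}"
          using f e(1) unfolding C0_funs_def top mem_Collect_eq by simp
        then have "compactin X {x \<in> U. e \<le> cmod (f x)}"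
          unfolding compactin_subtopology by blast
        then have "closedin X {x \<in> U. e \<le> cmod (f x)}"
          by (rule compactin_imp_closedin[OF Hausdorff])
        then have "openin X (topspace X - {x \<in> U. e \<le> cmod (f x)})"
          by (rule openin_diff[OF openin_topspace])
        moreover have "{x \<in> topspace X. f x \<in> W}
            = {x \<in> U. f x \<in> W} \<union> (topspace X - {x \<in> U. e \<le> cmod (f x)})"
        proof -
          have "f x \<in> W" if "x \<notin> U \<or> \<not> e \<le> cmod (f x)" for x
            using that e True z[of x] by (auto simp: subset_iff)
          then show ?thesis using openin_subset[OF U] by blast
        qed
        ultimately show ?thesis using 1 by auto
      qed
    qed
    then have "continuous_map X euclidean f" by (simp add: continuous_map)
    then show "f \<in> van X U"
      using z openin_subset[OF U] by (auto intro: vanI)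
  next
    assume f: "f \<in> van X U"
    have "compactin (subtopology X U) {x \<in> U. e \<le> cmod (f x)}" if "e > 0" for e
    proof -
      have "closedin X {x \<in> topspace X. f x \<in> {z. e \<le> cmod z}}"
        by (rule closedin_continuous_map_preimage[OF van_contD[OF f]])
          (auto intro!: closed_Collect_le continuous_intros)
      moreover have "{x \<in> topspace X. f x \<in> {z. e \<le> cmod z}} = {x \<in> U. e \<le> cmod (f x)}"
        using van_zero_outside[OF f] that openin_subset[OF U] by force
      ultimately show ?thesis
        using closedin_compact_space[OF compact] by (auto simp: compactin_subtopology)
    qed
    then show "f \<in> C0_funs (subtopology X U)"
      using van_contD[OF f] van_zero_outside[OF f] unfolding C0_funs_def cont_funs_def top
      by (simp add: continuous_map_from_subtopology)
  }
qed

lemma C0_alg_eq_van: "openin X U \<Longrightarrow> C0_alg (subtopology X U) = function_alg (van X U)"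
  by (simp add: C0_alg_def C0_funs_eq_van)

lemma C_alg_eq_van: "C_alg X = function_alg (van X (topspace X))"
  by (simp add: C_alg_def van_topspace)

text \<open>Urysohn's lemma in a compact Hausdorff, hence normal, space. Multiplication by such an
  \<open>f\<close> moves a vector into the submodule vanishing off \<open>U\<close> without changing
  its pairings at \<open>u\<close>; this localises statements at a point of
  \<open>U\<close>.\<close>

lemma bump:
  assumes "openin X U" and "u \<in> U"
  obtains f where "f \<in> van X U" and "f u = 1" and "\<And>x. cmod (f x) \<le> 1"
proof -
  have "normal_space X"
    using compact Hausdorff compact_Hausdorff_or_regular_imp_normal_space by blast
  moreover have "closedin X {u}"
    using assms Hausdorff openin_subset by (intro closedin_Hausdorff_singleton) auto
  ultimately obtain g where g: "continuous_map X (top_of_set {0..1::real}) g"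
      and g0: "g ` (topspace X - U) \<subseteq> {0}" and g1: "g ` {u} \<subseteq> {1}"
    using Urysohn_lemma[of X "topspace X - U" "{u}" 0 1] assms
    by (auto simp: disjnt_def)
  have gc: "continuous_map X euclideanreal g" and g01: "\<And>x. x \<in> topspace X \<Longrightarrow> 0 \<le> g x \<and> g x \<le> 1"
    using g by (auto simp: continuous_map_in_subtopology)
  define f where "f x = (if x \<in> topspace X then complex_of_real (g x) else 0)" for x
  have "continuous_map X euclidean (\<lambda>x. complex_of_real (g x))"
    using continuous_map_compose[OF gc, of euclidean complex_of_real]
    by (simp add: o_def continuous_on_of_real)
  then have "continuous_map X euclidean f"
    by (rule continuous_map_eq) (simp add: f_def)
  then have "f \<in> van X U"
    using g0 by (intro vanI) (auto simp: f_def)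
  moreover have "f u = 1" using g1 assms openin_subset by (auto simp: f_def)
  moreover have "cmod (f x) \<le> 1" for x using g01[of x] by (auto simp: f_def)
  ultimately show thesis by (rule that)
qed

text \<open>The function min(1, \<bar>h\<bar> / \<epsilon>) is continuous and vanishes where
  \<open>h\<close> does. It is exactly 1 where \<bar>h\<bar> \<ge> \<epsilon>, so multiplication by
  1 - f leaves only the part where \<open>h\<close> is small, and the values in [0, 1] keep
  \<open>f\<close> and 1 - f from enlarging anything.\<close>

lemma approx_unit:
  assumes "h \<in> van X U" and "\<epsilon> > 0"
  obtains f where "f \<in> van X U" and "\<And>x. cmod (f x) \<le> 1" and "\<And>x. cmod (1 - f x) \<le> 1"
    and "\<And>x. cnj (f x) = f x" and "\<And>x. cmod (h x) \<ge> \<epsilon> \<Longrightarrow> f x = 1"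
proof
  define g :: "complex \<Rightarrow> complex" where "g z = of_real (min 1 (cmod z / \<epsilon>))" for z
  show "(\<lambda>x. g (h x)) \<in> van X U"
    by (rule van_compose[OF assms(1)]) (use assms(2) in \<open>auto simp: g_def intro!: continuous_intros\<close>)
  have g01: "0 \<le> min 1 (cmod z / \<epsilon>) \<and> min 1 (cmod z / \<epsilon>) \<le> 1" for z
    using assms(2) by auto
  show "cmod (g (h x)) \<le> 1" for x using g01[of "h x"] by (simp add: g_def)
  show "cmod (1 - g (h x)) \<le> 1" for x
  proof -
    have "1 - g (h x) = of_real (1 - min 1 (cmod (h x) / \<epsilon>))" by (simp add: g_def)
    then show ?thesis using g01[of "h x"] by (metis abs_of_nonneg diff_ge_0_iff_ge
        diff_le_eq le_add_same_cancel1 norm_of_real)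
  qed
  show "cnj (g (h x)) = g (h x)" for x by (simp add: g_def)
  show "g (h x) = 1" if "cmod (h x) \<ge> \<epsilon>" for x using that assms(2) by (simp add: g_def)
qed

end

section \<open>C_0(U) as a Hilbert module and as a correspondence\<close>

lemma C0_corr_sel [simp]:
  "carr (C0_corr Z) = C0_funs Z" "zer (C0_corr Z) = (\<lambda>_. 0)"
  "add (C0_corr Z) = (\<lambda>f g x. f x + g x)" "scl (C0_corr Z) = (\<lambda>c f x. c * f x)"
  "act (C0_corr Z) = (\<lambda>f a x. f x * a x)" "ip (C0_corr Z) = (\<lambda>f g x. cnj (f x) * g x)"
  "lact (C0_corr Z) = (\<lambda>a f x. a x * f x)"
  by (simp_all add: C0_corr_def)

lemma diff_C0_corr [simp]: "diff (C0_corr Z) f g = (\<lambda>x. f x - g x)"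
  by (simp add: diff_def)

context compact_Hausdorff
begin

lemma hnorm_C0_corr:
  assumes "f \<in> van X V"
  shows "hnorm (function_alg S) (C0_corr Z) f = (SUP x. cmod (f x))"
proof -
  obtain c where c: "\<And>x. cmod (f x) \<le> c" using van_bounded[OF assms] by metis
  have "0 \<le> (SUP x. cmod (f x))"
    using SUP_cmod_ge[of f, OF c] norm_ge_zero order_trans by blast
  with SUP_cmod_square[of f, OF c] show ?thesis by (simp add: hnorm_def)
qed

text \<open>The choice \<open>W = U\<close> gives the module \<open>F\<close> over C_0(U),
  \<open>W = topspace X\<close> gives \<open>E\<close> over C(X), and
  \<open>U = W = topspace X\<close> gives C(X) over itself, which the converse needs. Inner products
  lie in C_0(U), so completeness reduces to that of \<open>van X U\<close>.\<close>

lemma hilbert_module_C0_corr: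
  assumes U: "openin X U" and UW: "U \<subseteq> W"
  shows "hilbert_module (function_alg (van X W)) (C0_corr (subtopology X U))"
proof -
  interpret W: c_star_algebra "function_alg (van X W)" by (rule c_star_algebra_van)
  have mono: "f \<in> van X U \<Longrightarrow> f \<in> van X W" for f using van_mono[OF UW] by blast
  show ?thesis
  proof (unfold_locales, goal_cases)
    case (23 f)
    then have "f \<in> van X U" using U by (simp add: C0_funs_eq_van)
    then show ?case by (intro bexI[of _ f]) (auto intro: mono)
  next
    case 25
    show ?case unfolding norm_complete_def
    proof (intro allI impI)
      fix s assume s: "cauchy_seq (C0_corr (subtopology X U))
          (hnorm (function_alg (van X W)) (C0_corr (subtopology X U))) s"
      then have sv: "s n \<in> van X U" for n
        using U by (simp add: cauchy_seq_def C0_funs_eq_van)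
      have hn: "hnorm (function_alg (van X W)) (C0_corr (subtopology X U)) (\<lambda>x. f x - g x)
          = (SUP x. cmod (f x - g x))" if "f \<in> van X U" "g \<in> van X U" for f g
        by (rule hnorm_C0_corr[OF van_diff[OF that]])
      have "cauchy_seq (function_alg (van X U)) (nrm (function_alg (van X U))) s"
        using s U sv by (simp add: cauchy_seq_def hn)
      then obtain f where "f \<in> van X U" "(\<lambda>n. SUP x. cmod (s n x - f x)) \<longlonglongrightarrow> 0"
        using van_complete[of U] unfolding norm_complete_def by auto
      then show "\<exists>x\<in>carr (C0_corr (subtopology X U)).
          (\<lambda>n. hnorm (function_alg (van X W)) (C0_corr (subtopology X U))
            (diff (C0_corr (subtopology X U)) (s n) x)) \<longlonglongrightarrow> 0"
        using U sv by (intro bexI[of _ f]) (simp_all add: hn C0_funs_eq_van)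
    qed
  next
    case (18 f g)
    then have "(\<lambda>x. cnj (f x) * g x) \<in> van X U" using U by (auto simp: C0_funs_eq_van intro: van_mult van_cnj)
    then show ?case by (simp add: mono)
  qed (use U in \<open>auto simp: C0_funs_eq_van van_zero van_add van_scl van_mult van_cnj algebra_simps
      fun_eq_iff diff_def intro: van_mult van_mult' mono\<close>)
qed

lemma correspondence_C0_corr:
  assumes U: "openin X U" and UV: "U \<subseteq> V" and UW: "U \<subseteq> W"
  shows "correspondence (function_alg (van X V)) (function_alg (van X W))
    (C0_corr (subtopology X U))"
proof -
  interpret W: hilbert_module "function_alg (van X W)" "C0_corr (subtopology X U)"
    by (rule hilbert_module_C0_corr[OF U UW])
  interpret V: c_star_algebra "function_alg (van X V)" by (rule c_star_algebra_van)
  let ?F = "C0_corr (subtopology X U)"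
  note eq = C0_funs_eq_van[OF U]
  show ?thesis
  proof (unfold_locales, goal_cases)
    case (1 a)
    then have a: "a \<in> van X V" by simp
    then obtain c where c: "0 \<le> c" "\<And>x. cmod (a x) \<le> c" using van_bounded by metis
    have "op_bound (function_alg (van X W)) ?F ?F c (restrict (lact ?F a) (carr ?F))"
    proof -
      have "(SUP x. cmod (a x * f x)) \<le> c * (SUP x. cmod (f x))" if f: "f \<in> van X U" for f
      proof (rule SUP_cmod_le)
        fix x
        obtain d where d: "\<And>x. cmod (f x) \<le> d" using van_bounded[OF f] by metis
        show "cmod (a x * f x) \<le> c * (SUP x. cmod (f x))"
          using c by (auto simp: norm_mult intro!: mult_mono SUP_cmod_ge[OF d])
      qed
      then show ?thesis
        using c a by (auto simp: op_bound_def eq hnorm_C0_corr[of _ U] hnorm_C0_corr[OF van_mult'])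
    qed
    moreover have "\<exists>S\<in>carr ?F \<rightarrow> carr ?F. \<forall>x\<in>carr ?F. \<forall>y\<in>carr ?F.
        ip ?F (restrict (lact ?F a) (carr ?F) x) y = ip ?F x (S y)"
      using a by (intro bexI[of _ "lact ?F (\<lambda>x. cnj (a x))"])
        (auto simp: eq mult.assoc intro!: van_mult'[of _ X V] van_cnj)
    ultimately show ?case
      using a by (auto simp: adjointable_ops_def eq intro: van_mult')
  next
    case (6 f \<epsilon>)
    then have f: "f \<in> van X U" by (simp add: eq)
    \<comment> \<open>A single product \<open>e f\<close> approximates \<open>f\<close>: the
      difference is 0 where \<bar>f\<bar> \<ge> \<epsilon>/2 and at most \<bar>f\<bar>
      elsewhere.\<close>
    then obtain e where e: "e \<in> van X U" "\<And>x. cmod (1 - e x) \<le> 1"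
        "\<And>x. cmod (f x) \<ge> \<epsilon>/2 \<Longrightarrow> e x = 1"
      using approx_unit[OF f half_gt_zero[OF 6(2)]] by metis
    have "cmod (f x - e x * f x) \<le> \<epsilon>/2" for x
    proof -
      have "cmod (f x - e x * f x) = cmod (1 - e x) * cmod (f x)"
        by (simp add: left_diff_distrib flip: norm_mult)
      also have "\<dots> \<le> \<epsilon>/2"
      proof (cases "cmod (f x) \<ge> \<epsilon>/2")
        case False
        have "cmod (1 - e x) * cmod (f x) \<le> 1 * cmod (f x)"
          by (rule mult_right_mono) (use e in auto)
        with False show ?thesis by simp
      qed (use e 6 in auto)
      finally show ?thesis .
    qed
    then have "(SUP x. cmod (f x - e x * f x)) \<le> \<epsilon>/2"
      by (rule SUP_cmod_le)
    moreover have "(\<lambda>x. f x - e x * f x) \<in> van X U"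
      using f e by (intro van_diff van_mult)
    ultimately have "hnorm (function_alg (van X W)) ?F
        (diff ?F f (vsum ?F (map (\<lambda>(a, g). lact ?F a g) [(e, f)]))) < \<epsilon>"
      using 6 by (simp add: vsum_def hnorm_C0_corr)
    moreover have "[(e, f)] \<in> lists (carr (function_alg (van X V)) \<times> carr ?F)"
      using e f van_mono[OF UV] by (auto simp: eq)
    ultimately show ?case by blast
  qed (auto simp: eq algebra_simps)
qed

end

section \<open>Modules with function-valued inner products\<close>

definition hn :: "('x \<Rightarrow> complex, 'm, 'z) hmod_scheme \<Rightarrow> 'm \<Rightarrow> real" where
  "hn M x = sqrt (SUP u. cmod (ip M x x u))"

text \<open>The seminorm whose quotient is the fibre at \<open>u\<close>. The norm \<open>hn\<close>
  is its supremum over \<open>u\<close>, so norm bounds are proved point by point through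
  \<open>hn_le\<close> and used through \<open>pn_le_hn\<close>.\<close>

definition pn :: "('x \<Rightarrow> complex, 'm, 'z) hmod_scheme \<Rightarrow> 'x \<Rightarrow> 'm \<Rightarrow> real" where
  "pn M u x = sqrt (cmod (ip M x x u))"

lemma hnorm_function_alg [simp]: "hnorm (function_alg S) M = hn M"
  by (simp add: fun_eq_iff hnorm_def hn_def)

lemma pn_nonneg [simp]: "0 \<le> pn M u x"
  by (simp add: pn_def)

lemma pn_eq_0_iff: "pn M u x = 0 \<longleftrightarrow> ip M x x u = 0"
  by (simp add: pn_def)

text \<open>Completeness is left out so that submodules and separated completions are covered alike.\<close>

locale fmod = complex_space M
  for S :: "('x \<Rightarrow> complex) set" and M :: "('x \<Rightarrow> complex, 'm, 'z) hmod_scheme" +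
  assumes bounded: "f \<in> S \<Longrightarrow> \<exists>c. \<forall>u. cmod (f u) \<le> c"
    and ip_in: "\<lbrakk>x \<in> carr M; y \<in> carr M\<rbrakk> \<Longrightarrow> ip M x y \<in> S"
    and ip_add: "\<lbrakk>x \<in> carr M; y \<in> carr M; z \<in> carr M\<rbrakk>
          \<Longrightarrow> ip M x (add M y z) u = ip M x y u + ip M x z u"
    and ip_scl: "\<lbrakk>x \<in> carr M; y \<in> carr M\<rbrakk> \<Longrightarrow> ip M x (scl M c y) u = c * ip M x y u"
    and ip_cnj: "\<lbrakk>x \<in> carr M; y \<in> carr M\<rbrakk> \<Longrightarrow> cnj (ip M x y u) = ip M y x u"
    and ip_pos: "x \<in> carr M \<Longrightarrow> 0 \<le> Re (ip M x x u)"
    and ip_definite: "\<lbrakk>x \<in> carr M; \<And>u. ip M x x u = 0\<rbrakk> \<Longrightarrow> x = zer M"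
    and act_closed: "\<lbrakk>x \<in> carr M; b \<in> S\<rbrakk> \<Longrightarrow> act M x b \<in> carr M"
    and ip_act: "\<lbrakk>x \<in> carr M; y \<in> carr M; b \<in> S\<rbrakk> \<Longrightarrow> ip M x (act M y b) u = ip M x y u * b u"
begin

lemma ip_add_left: "\<lbrakk>x \<in> carr M; y \<in> carr M; z \<in> carr M\<rbrakk>
    \<Longrightarrow> ip M (add M x y) z u = ip M x z u + ip M y z u"
  using ip_cnj[of z "add M x y" u] by (simp add: add_closed ip_add ip_cnj)

lemma ip_scl_left: "\<lbrakk>x \<in> carr M; y \<in> carr M\<rbrakk> \<Longrightarrow> ip M (scl M c x) y u = cnj c * ip M x y u"
  using ip_cnj[of y "scl M c x" u] by (simp add: scl_closed ip_scl ip_cnj)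

lemma ip_act_left: "\<lbrakk>x \<in> carr M; y \<in> carr M; b \<in> S\<rbrakk>
    \<Longrightarrow> ip M (act M x b) y u = cnj (b u) * ip M x y u"
  using ip_cnj[of y "act M x b" u, symmetric] by (simp add: act_closed ip_act ip_cnj)

lemma diff_closed: "\<lbrakk>x \<in> carr M; y \<in> carr M\<rbrakk> \<Longrightarrow> diff M x y \<in> carr M"
  by (simp add: diff_def add_closed scl_closed)

lemma ip_diff: "\<lbrakk>x \<in> carr M; y \<in> carr M; z \<in> carr M\<rbrakk>
    \<Longrightarrow> ip M x (diff M y z) u = ip M x y u - ip M x z u"
  by (simp add: diff_def ip_add ip_scl scl_closed)

lemma ip_diff_left: "\<lbrakk>x \<in> carr M; y \<in> carr M; z \<in> carr M\<rbrakk>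
    \<Longrightarrow> ip M (diff M x y) z u = ip M x z u - ip M y z u"
  by (simp add: diff_def ip_add_left ip_scl_left scl_closed)

lemma ip_zer: "x \<in> carr M \<Longrightarrow> ip M x (zer M) u = 0"
  using ip_diff[of x "zer M" "zer M" u] by (simp add: diff_self zer_closed)

lemma ip_zer_left: "x \<in> carr M \<Longrightarrow> ip M (zer M) x u = 0"
  using ip_diff_left[of "zer M" "zer M" x u] by (simp add: diff_self zer_closed)

lemmas ip_simps = ip_add ip_add_left ip_scl ip_scl_left ip_act ip_act_left ip_diff ip_diff_left
  ip_zer ip_zer_left

lemmas closed = zer_closed add_closed scl_closed diff_closed act_closed

lemma ip_self_real: "x \<in> carr M \<Longrightarrow> ip M x x u = of_real ((pn M u x)\<^sup>2)"
proof -
  assume x: "x \<in> carr M"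
  then have "Im (ip M x x u) = 0"
    using arg_cong[OF ip_cnj[OF x x, of u], of Im] by simp
  then have "ip M x x u = of_real (Re (ip M x x u))" by (simp add: complex_eq_iff)
  moreover from this have "cmod (ip M x x u) = Re (ip M x x u)"
    using ip_pos[OF x, of u] by (metis abs_of_nonneg norm_of_real)
  ultimately show ?thesis using ip_pos[OF x, of u] by (simp add: pn_def flip: of_real_power)
qed

lemma diff_zer_imp_eq:
  assumes "x \<in> carr M" "y \<in> carr M" "diff M x y = zer M"
  shows "x = y"
proof -
  have "x = add M x (add M (scl M (-1) y) y)"
    using assms by (metis add_commute add_zer diff_def diff_self scl_closed)
  also have "\<dots> = add M (diff M x y) y"
    using assms by (simp add: add_assoc[symmetric] diff_def scl_closed)
  also have "\<dots> = y"
    using assms by (metis add_commute add_zer zer_closed)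
  finally show ?thesis .
qed

text \<open>Definiteness applied to \<open>diff M x y\<close>. Through this lemma an identity
  between module elements becomes an identity of complex numbers at each point.\<close>

lemma ip_eqI:
  assumes x: "x \<in> carr M" and y: "y \<in> carr M"
    and eq: "\<And>w u. w \<in> carr M \<Longrightarrow> ip M w x u = ip M w y u"
  shows "x = y"
proof (rule diff_zer_imp_eq[OF x y], rule ip_definite)
  show "diff M x y \<in> carr M" using x y by (rule diff_closed)
  then show "ip M (diff M x y) (diff M x y) u = 0" for u
    using x y eq by (simp add: ip_diff)
qed

lemma Cauchy_Schwarz:
  assumes x: "x \<in> carr M" and y: "y \<in> carr M"
  shows "cmod (ip M x y u) \<le> pn M u x * pn M u y"
proof -
  define a b d where "a = (pn M u x)\<^sup>2" and "b = ip M x y u" and "d = (pn M u y)\<^sup>2"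
  have a: "ip M x x u = of_real a" and d: "ip M y y u = of_real d"
    using x y by (simp_all add: a_def d_def ip_self_real)
  \<comment> \<open>Positivity of the inner square of x + t y at \<open>u\<close>. The phase of t =
    - r * cnj b makes both cross terms equal to - r \<bar>b\<bar>^2; for d > 0 the choice r = 1/d
    gives the inequality.\<close>
  have key: "0 \<le> a - 2 * r * (cmod b)\<^sup>2 + r\<^sup>2 * (cmod b)\<^sup>2 * d" for r :: real
  proof -
    let ?t = "- (of_real r * cnj b)"
    have m: "add M x (scl M ?t y) \<in> carr M" using x y by (simp add: closed)
    have b': "ip M y x u = cnj b" using x y by (simp add: b_def ip_cnj)
    have "ip M (add M x (scl M ?t y)) (add M x (scl M ?t y)) u
        = of_real a - of_real (2 * r) * (b * cnj b) + of_real (r\<^sup>2) * (b * cnj b) * of_real d"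
      using x y by (simp add: ip_simps closed a d b' flip: b_def)
        (simp add: algebra_simps power2_eq_square)
    also have "\<dots> = of_real (a - 2 * r * (cmod b)\<^sup>2 + r\<^sup>2 * (cmod b)\<^sup>2 * d)"
      by (simp add: complex_norm_square[symmetric])
    finally show ?thesis using ip_pos[OF m, of u] by (metis Re_complex_of_real)
  qed
  have "(cmod b)\<^sup>2 \<le> a * d"
  proof (cases "d = 0")
    case False
    then have "d > 0" by (simp add: d_def)
    have "0 \<le> a - (cmod b)\<^sup>2 / d"
      using key[of "1/d"] False by (simp add: power2_eq_square divide_simps split: if_splits)
    with \<open>d > 0\<close> show ?thesis by (simp add: field_simps)
  next
    case True
    have "(cmod b)\<^sup>2 = 0"
    proof (rule ccontr)
      assume nz: "(cmod b)\<^sup>2 \<noteq> 0"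
      \<comment> \<open>For d = 0 the quadratic in \<open>r\<close> is affine; this \<open>r\<close>
        is chosen to make its value -1.\<close>
      have "0 \<le> a - 2 * ((a + 1) / (2 * (cmod b)\<^sup>2)) * (cmod b)\<^sup>2"
        using key[of "(a + 1) / (2 * (cmod b)\<^sup>2)"] True by simp
      with nz show False by (simp add: field_simps)
    qed
    with True show ?thesis by simp
  qed
  then have "(cmod b)\<^sup>2 \<le> (pn M u x * pn M u y)\<^sup>2"
    by (simp add: a_def d_def power_mult_distrib)
  then show ?thesis by (simp add: b_def abs_le_square_iff[symmetric])
qed

lemma pn_add:
  assumes x: "x \<in> carr M" and y: "y \<in> carr M"
  shows "pn M u (add M x y) \<le> pn M u x + pn M u y"
proof -
  have "of_real ((pn M u (add M x y))\<^sup>2)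
      = of_real ((pn M u x)\<^sup>2) + ip M x y u + ip M y x u + of_real ((pn M u y)\<^sup>2)"
    using x y by (simp add: ip_self_real[symmetric] ip_simps closed del: of_real_power)
  then have "(pn M u (add M x y))\<^sup>2 = Re (of_real ((pn M u x)\<^sup>2) + ip M x y u + ip M y x u + of_real ((pn M u y)\<^sup>2))"
    by (metis Re_complex_of_real)
  also have "\<dots> = (pn M u x)\<^sup>2 + Re (ip M x y u) + Re (ip M y x u) + (pn M u y)\<^sup>2"
    by (simp del: of_real_power)
  also have "\<dots> \<le> (pn M u x)\<^sup>2 + pn M u x * pn M u y + pn M u y * pn M u x + (pn M u y)\<^sup>2"
    using Cauchy_Schwarz[OF x y, of u] Cauchy_Schwarz[OF y x, of u]
      complex_Re_le_cmod[of "ip M x y u"] complex_Re_le_cmod[of "ip M y x u"] by linarith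
  also have "\<dots> = (pn M u x + pn M u y)\<^sup>2" by (simp add: power2_eq_square algebra_simps)
  finally show ?thesis by (rule power2_le_imp_le) simp
qed

lemma pn_scl: "x \<in> carr M \<Longrightarrow> pn M u (scl M c x) = cmod c * pn M u x"
  by (simp add: pn_def ip_simps closed norm_mult real_sqrt_mult)

lemma pn_act: "\<lbrakk>x \<in> carr M; b \<in> S\<rbrakk> \<Longrightarrow> pn M u (act M x b) = pn M u x * cmod (b u)"
  by (simp add: pn_def ip_simps closed norm_mult real_sqrt_mult)

lemma pn_zer [simp]: "pn M u (zer M) = 0"
  by (simp add: pn_def ip_zer zer_closed)

lemma pn_diff_commute: "\<lbrakk>x \<in> carr M; y \<in> carr M\<rbrakk> \<Longrightarrow> pn M u (diff M x y) = pn M u (diff M y x)"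
  by (simp add: pn_def ip_simps closed algebra_simps)

lemma pn_triangle:
  assumes "x \<in> carr M" "y \<in> carr M" "z \<in> carr M"
  shows "pn M u (diff M x z) \<le> pn M u (diff M x y) + pn M u (diff M y z)"
proof -
  have "diff M x z = add M (diff M x y) (diff M y z)"
    by (rule ip_eqI) (use assms in \<open>simp_all add: ip_simps closed\<close>)
  then show ?thesis using assms by (simp add: pn_add closed)
qed

lemma pn_le_pn_diff: "\<lbrakk>x \<in> carr M; y \<in> carr M\<rbrakk> \<Longrightarrow> pn M u x \<le> pn M u (diff M x y) + pn M u y"
proof -
  assume xy: "x \<in> carr M" "y \<in> carr M"
  have "x = add M (diff M x y) y"
    by (rule ip_eqI) (use xy in \<open>simp_all add: ip_simps closed\<close>)
  then show ?thesis using xy by (metis pn_add diff_closed)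
qed

lemma pn_le_hn: "x \<in> carr M \<Longrightarrow> pn M u x \<le> hn M x"
proof -
  assume "x \<in> carr M"
  then obtain c where "\<And>u. cmod (ip M x x u) \<le> c" using bounded[OF ip_in] by metis
  then show ?thesis
    unfolding pn_def hn_def by (intro real_sqrt_le_mono SUP_cmod_ge)
qed

lemma hn_nonneg: "x \<in> carr M \<Longrightarrow> 0 \<le> hn M x"
  by (rule order_trans[OF pn_nonneg pn_le_hn[of x undefined]])

lemma hn_diff_commute: "\<lbrakk>x \<in> carr M; y \<in> carr M\<rbrakk> \<Longrightarrow> hn M (diff M x y) = hn M (diff M y x)"
  by (simp add: hn_def ip_simps closed algebra_simps)

end

lemma hn_le:
  assumes "0 \<le> c" and "\<And>u. pn M u x \<le> c"
  shows "hn M x \<le> c"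
proof -
  have "cmod (ip M x x u) \<le> c\<^sup>2" for u
    using assms(2)[of u] unfolding pn_def by (simp add: sqrt_le_D)
  then have "(SUP u. cmod (ip M x x u)) \<le> c\<^sup>2" by (rule SUP_cmod_le)
  then show ?thesis
    unfolding hn_def using assms(1) by (intro real_le_lsqrt)
qed

context fmod
begin

lemma hn_zer [simp]: "hn M (zer M) = 0"
  by (simp add: hn_def ip_zer zer_closed)

lemma hn_diff_self [simp]: "x \<in> carr M \<Longrightarrow> hn M (diff M x x) = 0"
  by (simp add: diff_self)

lemma hn_add:
  assumes "x \<in> carr M" and "y \<in> carr M"
  shows "hn M (add M x y) \<le> hn M x + hn M y"
proof (rule hn_le)
  show "0 \<le> hn M x + hn M y" using assms hn_nonneg by simp
  show "pn M u (add M x y) \<le> hn M x + hn M y" for u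
    using pn_add[OF assms, of u] pn_le_hn[OF assms(1), of u] pn_le_hn[OF assms(2), of u] by linarith
qed

lemma hn_triangle:
  assumes "x \<in> carr M" and "y \<in> carr M" and "z \<in> carr M"
  shows "hn M (diff M x z) \<le> hn M (diff M x y) + hn M (diff M y z)"
proof -
  have "diff M x z = add M (diff M x y) (diff M y z)"
    by (rule ip_eqI) (use assms in \<open>simp_all add: ip_simps closed\<close>)
  then show ?thesis using assms by (simp add: hn_add closed)
qed

lemma hn_LIMSEQ_0:
  assumes "\<And>n. d n \<in> carr M" and "\<And>n. hn M (d n) \<le> a n" and "a \<longlonglongrightarrow> 0"
  shows "(\<lambda>n. hn M (d n)) \<longlonglongrightarrow> 0"
  by (rule Lim_null_comparison[OF always_eventually assms(3)]) (use assms hn_nonneg in simp)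

lemma hn_scl_le:
  assumes "x \<in> carr M"
  shows "hn M (scl M c x) \<le> cmod c * hn M x"
proof (rule hn_le)
  show "0 \<le> cmod c * hn M x" using hn_nonneg[OF assms] by simp
  show "pn M u (scl M c x) \<le> cmod c * hn M x" for u
    using mult_left_mono[OF pn_le_hn[OF assms, of u] norm_ge_zero[of c]] assms by (simp only: pn_scl)
qed

lemma ip_LIMSEQ:
  assumes s: "\<And>n. s n \<in> carr M" and x: "x \<in> carr M" and y: "y \<in> carr M"
    and lim: "(\<lambda>n. hn M (diff M (s n) x)) \<longlonglongrightarrow> 0"
  shows "(\<lambda>n. ip M y (s n) u) \<longlonglongrightarrow> ip M y x u"
proof -
  have bd: "norm (ip M y (s n) u - ip M y x u) \<le> pn M u y * hn M (diff M (s n) x)" for n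
  proof -
    have d: "diff M (s n) x \<in> carr M" using s x by (rule diff_closed)
    have "cmod (ip M y (diff M (s n) x) u) \<le> pn M u y * pn M u (diff M (s n) x)"
      using y d by (rule Cauchy_Schwarz)
    also have "\<dots> \<le> pn M u y * hn M (diff M (s n) x)"
      using pn_le_hn[OF d] by (simp add: mult_left_mono)
    finally show ?thesis using s x y by (simp add: ip_diff)
  qed
  have "(\<lambda>n. pn M u y * hn M (diff M (s n) x)) \<longlonglongrightarrow> 0"
    using tendsto_mult_right_zero[OF lim] by simp
  then have "(\<lambda>n. ip M y (s n) u - ip M y x u) \<longlonglongrightarrow> 0"
    by (rule Lim_null_comparison[OF always_eventually, rotated]) (simp add: bd)
  then show ?thesis by (rule LIM_zero_cancel)
qed

lemma limit_unique:
  assumes s: "\<And>n. s n \<in> carr M" and x: "x \<in> carr M" and y: "y \<in> carr M"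
    and "(\<lambda>n. hn M (diff M (s n) x)) \<longlonglongrightarrow> 0" and "(\<lambda>n. hn M (diff M (s n) y)) \<longlonglongrightarrow> 0"
  shows "x = y"
proof (rule ip_eqI[OF x y])
  show "ip M w x u = ip M w y u" if w: "w \<in> carr M" for w u
    using ip_LIMSEQ[OF s x w assms(4)] ip_LIMSEQ[OF s y w assms(5)] by (rule LIMSEQ_unique)
qed

lemma vsum_Cons: "vsum M (x # xs) = add M x (vsum M xs)"
  by (simp add: vsum_def)

lemma vsum_Nil: "vsum M [] = zer M"
  by (simp add: vsum_def)

lemma vsum_closed: "set xs \<subseteq> carr M \<Longrightarrow> vsum M xs \<in> carr M"
  by (induction xs) (auto simp: vsum_Nil vsum_Cons closed)

lemma ip_vsum: "\<lbrakk>x \<in> carr M; set ys \<subseteq> carr M\<rbrakk> \<Longrightarrow> ip M x (vsum M ys) u = (\<Sum>y\<leftarrow>ys. ip M x y u)"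
  by (induction ys) (auto simp: vsum_Nil vsum_Cons ip_simps vsum_closed)

lemma ip_vsum_left:
  "\<lbrakk>x \<in> carr M; set ys \<subseteq> carr M\<rbrakk> \<Longrightarrow> ip M (vsum M ys) x u = (\<Sum>y\<leftarrow>ys. ip M y x u)"
  by (induction ys) (auto simp: vsum_Nil vsum_Cons ip_simps vsum_closed)

end

context compact_Hausdorff
begin

lemma fmod_hilbert_module:
  assumes "hilbert_module (function_alg (van X V)) M"
  shows "fmod (van X V) M"
proof -
  interpret H: hilbert_module "function_alg (van X V)" M by fact
  show ?thesis
  proof (unfold_locales, goal_cases)
    case (1 f) then show ?case using van_bounded by metis
  next
    case (3 x y z u) then show ?case using H.ip_add[of x y z] by simp
  next
    case (4 x y c u) then show ?case using H.ip_scl[of x y] by simp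
  next
    case (5 x y u) then show ?case using H.ip_star[of x y] by (simp add: fun_eq_iff)
  next
    case (6 x u) then show ?case using H.ip_positive[of x] by auto
  next
    case (7 x) then show ?case using H.ip_definite[of x] by (simp add: fun_eq_iff)
  next
    case (9 x y b u) then show ?case using H.ip_act[of x y b] by simp
  qed (use H.ip_closed H.act_closed in auto)
qed

end

section \<open>Adjointable and compact operators\<close>

definition fbound :: "('x \<Rightarrow> complex, 'm, 'y) hmod_scheme \<Rightarrow> ('x \<Rightarrow> complex, 'n, 'z) hmod_scheme
    \<Rightarrow> real \<Rightarrow> ('m \<Rightarrow> 'n) \<Rightarrow> bool" where
  "fbound M N c T \<longleftrightarrow> 0 \<le> c \<and> (\<forall>x\<in>carr M. hn N (T x) \<le> c * hn M x)"

definition is_adj :: "('x \<Rightarrow> complex, 'm, 'y) hmod_scheme \<Rightarrow> ('x \<Rightarrow> complex, 'n, 'z) hmod_scheme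
    \<Rightarrow> ('m \<Rightarrow> 'n) \<Rightarrow> ('n \<Rightarrow> 'm) \<Rightarrow> bool" where
  "is_adj M N T R \<longleftrightarrow> T \<in> carr M \<rightarrow> carr N \<and> R \<in> carr N \<rightarrow> carr M \<and>
     (\<forall>x\<in>carr M. \<forall>y\<in>carr N. ip N (T x) y = ip M x (R y))"

text \<open>Neither the bound nor the adjoint refers to a scalar algebra, so operators from a
  C(X)-module to a C_0(U)-module make sense, and changing the algebra that acts does not change the
  set of adjointable operators.\<close>

definition fadj :: "('x \<Rightarrow> complex, 'm, 'y) hmod_scheme \<Rightarrow> ('x \<Rightarrow> complex, 'n, 'z) hmod_scheme
    \<Rightarrow> ('m \<Rightarrow> 'n) set" where
  "fadj M N = {T \<in> extensional (carr M). (\<exists>c. fbound M N c T) \<and> (\<exists>R. is_adj M N T R)}"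

definition fcomp :: "('x \<Rightarrow> complex, 'm, 'y) hmod_scheme \<Rightarrow> ('x \<Rightarrow> complex, 'n, 'z) hmod_scheme
    \<Rightarrow> ('m \<Rightarrow> 'n) set" where
  "fcomp M N = {T \<in> fadj M N. \<forall>\<epsilon>>0. \<exists>ps \<in> lists (carr N \<times> carr M).
     fbound M N \<epsilon> (\<lambda>z. diff N (T z) (finite_rank_op M N ps z))}"

lemma op_bound_function_alg: "op_bound (function_alg S) M N c T = fbound M N c T"
  by (simp add: op_bound_def fbound_def)

lemma fbound_cong: "(\<And>x. x \<in> carr M \<Longrightarrow> T x = T' x) \<Longrightarrow> fbound M N c T = fbound M N c T'"
  by (simp add: fbound_def)

lemma adjointable_ops_function_alg: "adjointable_ops (function_alg S) M N = fadj M N"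
  by (auto simp: adjointable_ops_def op_bound_function_alg fadj_def is_adj_def PiE_def)

lemma compact_ops_function_alg: "compact_ops (function_alg S) M N = fcomp M N"
proof -
  have "fbound M N \<epsilon> (\<lambda>z\<in>carr M. diff N (T z) (finite_rank_op M N ps z))
      = fbound M N \<epsilon> (\<lambda>z. diff N (T z) (finite_rank_op M N ps z))" for \<epsilon> T ps
    by (rule fbound_cong) simp
  then show ?thesis
    by (simp add: compact_ops_def fcomp_def op_bound_function_alg adjointable_ops_function_alg)
qed

lemma fadj_mem: "T \<in> fadj M N \<Longrightarrow> x \<in> carr M \<Longrightarrow> T x \<in> carr N"
  by (auto simp: fadj_def is_adj_def)

lemma fadj_ext: "T \<in> fadj M N \<Longrightarrow> T \<in> extensional (carr M)"
  by (simp add: fadj_def)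

lemma fcomp_subset: "fcomp M N \<subseteq> fadj M N"
  by (auto simp: fcomp_def)

lemma fadjE:
  assumes "T \<in> fadj M N"
  obtains R c where "is_adj M N T R" and "fbound M N c T"
  using assms by (auto simp: fadj_def)

lemma fadjI:
  "\<lbrakk>T \<in> extensional (carr M); is_adj M N T R; fbound M N c T\<rbrakk> \<Longrightarrow> T \<in> fadj M N"
  by (auto simp: fadj_def)

lemma is_adjI:
  assumes "\<And>x. x \<in> carr M \<Longrightarrow> T x \<in> carr N" and "\<And>y. y \<in> carr N \<Longrightarrow> R y \<in> carr M"
    and "\<And>x y u. \<lbrakk>x \<in> carr M; y \<in> carr N\<rbrakk> \<Longrightarrow> ip N (T x) y u = ip M x (R y) u"
  shows "is_adj M N T R"
  using assms by (auto simp: is_adj_def)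

lemma is_adj_fun: "is_adj M N T R \<Longrightarrow> x \<in> carr M \<Longrightarrow> T x \<in> carr N"
  by (auto simp: is_adj_def)

lemma is_adj_adj: "is_adj M N T R \<Longrightarrow> y \<in> carr N \<Longrightarrow> R y \<in> carr M"
  by (auto simp: is_adj_def)

lemma is_adj_ip: "is_adj M N T R \<Longrightarrow> x \<in> carr M \<Longrightarrow> y \<in> carr N \<Longrightarrow> ip N (T x) y u = ip M x (R y) u"
  by (simp add: is_adj_def)

lemma is_adj_cong:
  assumes "\<And>x. x \<in> carr M \<Longrightarrow> T x = T' x"
  shows "is_adj M N T R = is_adj M N T' R"
  using assms by (auto simp: is_adj_def Pi_iff)

lemma is_adj_compose:
  assumes "is_adj M N T R" and "is_adj N K T' R'"
  shows "is_adj M K (\<lambda>x. T' (T x)) (\<lambda>y. R (R' y))"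
proof (rule is_adjI)
  show "ip K (T' (T x)) y u = ip M x (R (R' y)) u" if "x \<in> carr M" "y \<in> carr K" for x y u
    using that assms by (simp add: is_adj_ip is_adj_fun is_adj_adj)
qed (use assms in \<open>simp_all add: is_adj_fun is_adj_adj\<close>)

lemma fbound_compose:
  assumes "fbound M N c T" and "fbound N K d T'" and "\<And>x. x \<in> carr M \<Longrightarrow> T x \<in> carr N"
  shows "fbound M K (d * c) (\<lambda>x. T' (T x))"
  unfolding fbound_def
proof (intro conjI ballI)
  show "0 \<le> d * c" using assms by (simp add: fbound_def)
  fix x assume x: "x \<in> carr M"
  have "hn K (T' (T x)) \<le> d * hn N (T x)" using assms x by (simp add: fbound_def)
  also have "\<dots> \<le> d * (c * hn M x)"
    using assms(1,2) x by (intro mult_left_mono) (auto simp: fbound_def)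
  finally show "hn K (T' (T x)) \<le> d * c * hn M x" by simp
qed

lemma fadj_compose:
  assumes "T \<in> fadj M N" and "T' \<in> fadj N K"
  shows "compose (carr M) T' T \<in> fadj M K"
proof -
  obtain R c where T: "is_adj M N T R" "fbound M N c T" using assms(1) by (rule fadjE)
  obtain R' c' where T': "is_adj N K T' R'" "fbound N K c' T'" using assms(2) by (rule fadjE)
  show ?thesis
  proof (rule fadjI)
    show "compose (carr M) T' T \<in> extensional (carr M)" by (rule compose_extensional)
    show "is_adj M K (compose (carr M) T' T) (\<lambda>y. R (R' y))"
      using is_adj_compose[OF T(1) T'(1)]
      by (subst is_adj_cong[where T' = "\<lambda>x. T' (T x)"]) (simp_all add: compose_eq)
    show "fbound M K (c' * c) (compose (carr M) T' T)"
      using fbound_compose[OF T(2) T'(2)] is_adj_fun[OF T(1)]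
      by (subst fbound_cong[where T' = "\<lambda>x. T' (T x)"]) (simp_all add: compose_eq)
  qed
qed

text \<open>A surjection that preserves inner products is unitary: the right inverse \<psi> is an
  adjoint, and the bound is 1. No linearity has to be checked first.\<close>

lemma fadj_isometry:
  assumes "\<phi> \<in> extensional (carr M)" and "\<And>x. x \<in> carr M \<Longrightarrow> \<phi> x \<in> carr N"
    and "\<And>y. y \<in> carr N \<Longrightarrow> \<psi> y \<in> carr M" and "\<And>y. y \<in> carr N \<Longrightarrow> \<phi> (\<psi> y) = y"
    and "\<And>x y. \<lbrakk>x \<in> carr M; y \<in> carr M\<rbrakk> \<Longrightarrow> ip N (\<phi> x) (\<phi> y) = ip M x y"
  shows "\<phi> \<in> fadj M N"
proof (rule fadjI)
  show "is_adj M N \<phi> \<psi>"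
  proof (rule is_adjI)
    show "ip N (\<phi> x) y u = ip M x (\<psi> y) u" if "x \<in> carr M" "y \<in> carr N" for x y u
      using assms(5)[OF that(1) assms(3)[OF that(2)]] assms(4)[OF that(2)] by simp
  qed (use assms in auto)
  show "fbound M N 1 \<phi>" using assms(5) by (simp add: fbound_def hn_def)
qed (use assms in auto)

locale fmod_pair = M: fmod S M + N: fmod S N
  for S :: "('x \<Rightarrow> complex) set"
    and M :: "('x \<Rightarrow> complex, 'm, 'y) hmod_scheme" and N :: "('x \<Rightarrow> complex, 'n, 'z) hmod_scheme"
begin

lemma is_adj_sym:
  assumes "is_adj M N T R"
  shows "is_adj N M R T"
proof (rule is_adjI)
  fix y x u assume y: "y \<in> carr N" and x: "x \<in> carr M"
  show "ip M (R y) x u = ip N y (T x) u"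
    using is_adj_ip[OF assms x y, of u] M.ip_cnj[OF x is_adj_adj[OF assms y], of u]
      N.ip_cnj[OF is_adj_fun[OF assms x] y, of u] by metis
qed (use assms in \<open>auto simp: is_adj_def\<close>)

lemma is_adj_ip_right: "\<lbrakk>is_adj M N T R; x \<in> carr M; y \<in> carr N\<rbrakk> \<Longrightarrow> ip N y (T x) u = ip M (R y) x u"
  using is_adj_ip[OF is_adj_sym] by metis

context
  fixes T R assumes T: "is_adj M N T R"
begin

text \<open>Moving \<open>T\<close> to the other side of a pairing with a test vector leaves an
  expression that is additive in the argument, so linearity follows from the adjoint alone. The same
  argument gives compatibility with the action.\<close>

lemma adj_diff: "\<lbrakk>x \<in> carr M; y \<in> carr M\<rbrakk> \<Longrightarrow> T (diff M x y) = diff N (T x) (T y)"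
  by (rule N.ip_eqI) (simp_all add: is_adj_fun[OF T] is_adj_adj[OF T] is_adj_ip_right[OF T]
      M.closed N.closed M.ip_simps N.ip_simps)

lemma adj_act: "\<lbrakk>x \<in> carr M; b \<in> S\<rbrakk> \<Longrightarrow> T (act M x b) = act N (T x) b"
  by (rule N.ip_eqI) (simp_all add: is_adj_fun[OF T] is_adj_adj[OF T] is_adj_ip_right[OF T]
      M.closed N.closed M.ip_simps N.ip_simps)

text \<open>By Cauchy-Schwarz <T x, T x> = <x, R (T x)> vanishes at each point where
  \<open>x\<close> has seminorm 0. This is why operators respect both the submodule of vectors
  vanishing off \<open>U\<close> and the passage to fibres.\<close>

lemma adj_pn_eq_0:
  assumes x: "x \<in> carr M" and z: "pn M u x = 0"
  shows "pn N u (T x) = 0"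
proof -
  have "cmod (ip M x (R (T x)) u) \<le> pn M u x * pn M u (R (T x))"
    using x by (intro M.Cauchy_Schwarz) (simp_all add: is_adj_fun[OF T] is_adj_adj[OF T])
  then have "ip N (T x) (T x) u = 0"
    using z x by (simp add: is_adj_ip[OF T] is_adj_fun[OF T])
  then show ?thesis by (simp add: pn_eq_0_iff)
qed

end

lemma finite_rank_summands:
  assumes "z \<in> carr M" and "ps \<in> lists (carr N \<times> carr M)"
  shows "set (map (\<lambda>(y, x). act N y (ip M x z)) ps) \<subseteq> carr N"
  using assms by (auto simp: in_lists_conv_set intro!: N.act_closed M.ip_in)

lemma finite_rank_closed:
  assumes "z \<in> carr M" and "ps \<in> lists (carr N \<times> carr M)"
  shows "finite_rank_op M N ps z \<in> carr N"
  using N.vsum_closed[OF finite_rank_summands[OF assms]] assms(1) by (simp add: finite_rank_op_def)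

lemma ip_finite_rank:
  assumes z: "z \<in> carr M" and ps: "ps \<in> lists (carr N \<times> carr M)" and w: "w \<in> carr N"
  shows "ip N w (finite_rank_op M N ps z) u = (\<Sum>(y, x)\<leftarrow>ps. ip N w y u * ip M x z u)"
proof -
  have "ip N w (finite_rank_op M N ps z) u
      = (\<Sum>y\<leftarrow>map (\<lambda>(y, x). act N y (ip M x z)) ps. ip N w y u)"
    using N.ip_vsum[OF w finite_rank_summands[OF z ps]] z by (simp add: finite_rank_op_def)
  also have "\<dots> = (\<Sum>(y, x)\<leftarrow>ps. ip N w y u * ip M x z u)"
    using ps w z by (induction ps) (auto simp: N.ip_act M.ip_in)
  finally show ?thesis .
qed

lemma finite_rank_act:
  assumes z: "z \<in> carr M" and ps: "ps \<in> lists (carr N \<times> carr M)" and b: "b \<in> S"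
  shows "finite_rank_op M N ps (act M z b) = act N (finite_rank_op M N ps z) b"
proof (rule N.ip_eqI)
  fix w u assume w: "w \<in> carr N"
  have "(\<Sum>(y, x)\<leftarrow>ps. ip N w y u * ip M x (act M z b) u)
      = (\<Sum>(y, x)\<leftarrow>ps. ip N w y u * ip M x z u) * b u"
    using ps z b by (induction ps) (auto simp: M.ip_act algebra_simps)
  then show "ip N w (finite_rank_op M N ps (act M z b)) u
      = ip N w (act N (finite_rank_op M N ps z) b) u"
    using assms w by (simp add: ip_finite_rank N.ip_act M.act_closed finite_rank_closed)
qed (use assms in \<open>simp_all add: finite_rank_closed M.closed N.closed\<close>)

lemma op_add_fadj:
  assumes "T \<in> fadj M N" and "T' \<in> fadj M N"
  shows "op_add M N T T' \<in> fadj M N"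
proof -
  obtain R c where T: "is_adj M N T R" "fbound M N c T" using assms(1) by (rule fadjE)
  obtain R' c' where T': "is_adj M N T' R'" "fbound M N c' T'" using assms(2) by (rule fadjE)
  note m = is_adj_fun[OF T(1)] is_adj_fun[OF T'(1)] is_adj_adj[OF T(1)] is_adj_adj[OF T'(1)]
  show ?thesis
  proof (rule fadjI)
    show "op_add M N T T' \<in> extensional (carr M)" by (simp add: op_add_def)
    show "is_adj M N (op_add M N T T') (\<lambda>y. add M (R y) (R' y))"
      by (rule is_adjI) (simp_all add: op_add_def m M.closed N.closed M.ip_simps N.ip_simps
          is_adj_ip[OF T(1)] is_adj_ip[OF T'(1)])
    show "fbound M N (c + c') (op_add M N T T')"
      unfolding fbound_def
    proof (intro conjI ballI)
      show "0 \<le> c + c'" using T T' by (simp add: fbound_def)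
      fix x assume x: "x \<in> carr M"
      have "hn N (op_add M N T T' x) \<le> hn N (T x) + hn N (T' x)"
        using N.hn_add[OF m(1)[OF x] m(2)[OF x]] x by (simp add: op_add_def)
      also have "\<dots> \<le> c * hn M x + c' * hn M x"
        using T T' x by (intro add_mono) (auto simp: fbound_def)
      finally show "hn N (op_add M N T T' x) \<le> (c + c') * hn M x" by (simp add: algebra_simps)
    qed
  qed
qed

lemma op_scl_fadj:
  assumes "T \<in> fadj M N"
  shows "op_scl M N r T \<in> fadj M N"
proof -
  obtain R c where T: "is_adj M N T R" "fbound M N c T" using assms(1) by (rule fadjE)
  note m = is_adj_fun[OF T(1)] is_adj_adj[OF T(1)]
  show ?thesis
  proof (rule fadjI)
    show "op_scl M N r T \<in> extensional (carr M)" by (simp add: op_scl_def)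
    show "is_adj M N (op_scl M N r T) (\<lambda>y. scl M (cnj r) (R y))"
      by (rule is_adjI) (simp_all add: op_scl_def m M.closed N.closed M.ip_simps N.ip_simps
          is_adj_ip[OF T(1)])
    show "fbound M N (cmod r * c) (op_scl M N r T)"
      unfolding fbound_def
    proof (intro conjI ballI)
      show "0 \<le> cmod r * c" using T by (simp add: fbound_def)
      fix x assume x: "x \<in> carr M"
      have "hn N (op_scl M N r T x) \<le> cmod r * hn N (T x)"
        using N.hn_scl_le[OF m(1)[OF x]] x by (simp add: op_scl_def)
      also have "\<dots> \<le> cmod r * (c * hn M x)"
        using T x by (intro mult_left_mono) (auto simp: fbound_def)
      finally show "hn N (op_scl M N r T x) \<le> cmod r * c * hn M x" by (simp add: algebra_simps)
    qed
  qed
qed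

end

text \<open>The factor \<open>c\<close> is there for composition with an operator bounded by
  \<open>c\<close>, which multiplies the approximation error by \<open>c\<close>. Dividing
  \<epsilon> by \<open>c + 1\<close> instead of \<open>c\<close> covers
  \<open>c = 0\<close>.\<close>

lemma fcompI:
  assumes M: "fmod S M" and T: "T \<in> fadj M N" and c: "0 \<le> c"
    and approx: "\<And>\<epsilon>. \<epsilon> > 0 \<Longrightarrow> \<exists>ps \<in> lists (carr N \<times> carr M). \<forall>z\<in>carr M.
      hn N (diff N (T z) (finite_rank_op M N ps z)) \<le> c * (\<epsilon> * hn M z)"
  shows "T \<in> fcomp M N"
  unfolding fcomp_def
proof (intro CollectI conjI allI impI T)
  fix \<epsilon> :: real assume \<epsilon>: "\<epsilon> > 0"
  then have "\<epsilon> / (c + 1) > 0" using c by simp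
  from approx[OF this] obtain ps where ps: "ps \<in> lists (carr N \<times> carr M)"
    and b: "\<And>z. z \<in> carr M \<Longrightarrow>
      hn N (diff N (T z) (finite_rank_op M N ps z)) \<le> c * (\<epsilon> / (c + 1) * hn M z)" by blast
  have "c * (\<epsilon> / (c + 1)) \<le> \<epsilon>" using c \<epsilon> by (simp add: divide_simps)
  from mult_right_mono[OF this fmod.hn_nonneg[OF M]]
  have "c * (\<epsilon> / (c + 1) * hn M z) \<le> \<epsilon> * hn M z" if "z \<in> carr M" for z
    using that by (simp only: mult.assoc)
  then have "fbound M N \<epsilon> (\<lambda>z. diff N (T z) (finite_rank_op M N ps z))"
    unfolding fbound_def using b \<epsilon> order_trans[OF b] by simp
  with ps show "\<exists>ps\<in>lists (carr N \<times> carr M).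
      fbound M N \<epsilon> (\<lambda>z. diff N (T z) (finite_rank_op M N ps z))" by blast
qed

lemma fcompE:
  assumes "T \<in> fcomp M N" and "\<epsilon> > 0"
  obtains ps where "ps \<in> lists (carr N \<times> carr M)"
    and "\<forall>z\<in>carr M. hn N (diff N (T z) (finite_rank_op M N ps z)) \<le> \<epsilon> * hn M z"
  using assms unfolding fcomp_def fbound_def by blast

text \<open>Composing with \<open>t\<close> turns y \<otimes> x* into (t y) \<otimes> x*, so
  finite-rank approximants go to finite-rank approximants. With its counterpart on the right, this
  lets compactness pass through the unitary identifications of tensor products with
  submodules.\<close>

lemma fcomp_compose_left:
  assumes "fmod S M" and "fmod S N" and "fmod S K"
    and T: "T \<in> fcomp M N" and t: "t \<in> fadj N K"
  shows "compose (carr M) t T \<in> fcomp M K"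
proof -
  interpret MN: fmod_pair S M N by (intro fmod_pair.intro assms)
  interpret MK: fmod_pair S M K by (intro fmod_pair.intro assms)
  interpret NK: fmod_pair S N K by (intro fmod_pair.intro assms)
  obtain R c where adj: "is_adj N K t R" and bd: "fbound N K c t" using t by (rule fadjE)
  note tm = is_adj_fun[OF adj] is_adj_adj[OF adj]
  have Ta: "T \<in> fadj M N" using T fcomp_subset by blast
  note Tm = fadj_mem[OF Ta]
  show ?thesis
  proof (rule fcompI[OF assms(1) fadj_compose[OF Ta t]])
    show c: "0 \<le> c" using bd by (simp add: fbound_def)
    fix \<epsilon> :: real assume "\<epsilon> > 0"
    with T obtain ps where ps: "ps \<in> lists (carr N \<times> carr M)"
      and b: "\<forall>z\<in>carr M. hn N (diff N (T z) (finite_rank_op M N ps z)) \<le> \<epsilon> * hn M z"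
      by (rule fcompE)
    define qs where "qs = map (\<lambda>(y, x). (t y, x)) ps"
    have qs: "qs \<in> lists (carr K \<times> carr M)"
      using ps tm by (auto simp: qs_def in_lists_conv_set)
    have eq: "t (finite_rank_op M N ps z) = finite_rank_op M K qs z" if z: "z \<in> carr M" for z
    proof (rule MK.N.ip_eqI)
      fix w u assume w: "w \<in> carr K"
      have "(\<Sum>(y, x)\<leftarrow>ps. ip N (R w) y u * ip M x z u) = (\<Sum>(y, x)\<leftarrow>qs. ip K w y u * ip M x z u)"
        using ps w unfolding qs_def by (induction ps) (auto simp: NK.is_adj_ip_right[OF adj])
      then show "ip K w (t (finite_rank_op M N ps z)) u = ip K w (finite_rank_op M K qs z) u"
        using w z ps qs tm by (simp add: MN.ip_finite_rank MK.ip_finite_rank MN.finite_rank_closed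
            NK.is_adj_ip_right[OF adj])
    qed (use z ps qs tm in \<open>simp_all add: MN.finite_rank_closed MK.finite_rank_closed\<close>)
    have "hn K (diff K (compose (carr M) t T z) (finite_rank_op M K qs z)) \<le> c * (\<epsilon> * hn M z)"
      if z: "z \<in> carr M" for z
    proof -
      have "hn K (diff K (compose (carr M) t T z) (finite_rank_op M K qs z))
          = hn K (t (diff N (T z) (finite_rank_op M N ps z)))"
        using z ps by (simp add: compose_eq eq[symmetric] NK.adj_diff[OF adj] Tm MN.finite_rank_closed)
      also have "\<dots> \<le> c * hn N (diff N (T z) (finite_rank_op M N ps z))"
        using bd z ps by (simp add: fbound_def Tm MN.finite_rank_closed MN.N.diff_closed)
      also have "\<dots> \<le> c * (\<epsilon> * hn M z)"
        using bspec[OF b z] c by (rule mult_left_mono)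
      finally show ?thesis .
    qed
    with qs show "\<exists>ps \<in> lists (carr K \<times> carr M). \<forall>z\<in>carr M.
        hn K (diff K (compose (carr M) t T z) (finite_rank_op M K ps z)) \<le> c * (\<epsilon> * hn M z)"
      by blast
  qed
qed

text \<open>Here \<open>s\<close> moves into the right leg through its adjoint \<open>R\<close>: y
  \<otimes> x* after \<open>s\<close> is y \<otimes> (R x)*, of rank one again.\<close>

lemma fcomp_compose_right:
  assumes "fmod S L" and "fmod S M" and "fmod S N"
    and T: "T \<in> fcomp M N" and s: "s \<in> fadj L M"
  shows "compose (carr L) T s \<in> fcomp L N"
proof -
  interpret LM: fmod_pair S L M by (intro fmod_pair.intro assms)
  interpret MN: fmod_pair S M N by (intro fmod_pair.intro assms)
  interpret LN: fmod_pair S L N by (intro fmod_pair.intro assms)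
  obtain R c where adj: "is_adj L M s R" and bd: "fbound L M c s" using s by (rule fadjE)
  note sm = is_adj_fun[OF adj] is_adj_adj[OF adj]
  have Ta: "T \<in> fadj M N" using T fcomp_subset by blast
  note Tm = fadj_mem[OF Ta]
  show ?thesis
  proof (rule fcompI[OF assms(1) fadj_compose[OF s Ta]])
    show c: "0 \<le> c" using bd by (simp add: fbound_def)
    fix \<epsilon> :: real assume \<epsilon>: "\<epsilon> > 0"
    with T obtain ps where ps: "ps \<in> lists (carr N \<times> carr M)"
      and b: "\<forall>z\<in>carr M. hn N (diff N (T z) (finite_rank_op M N ps z)) \<le> \<epsilon> * hn M z"
      by (rule fcompE)
    define qs where "qs = map (\<lambda>(y, x). (y, R x)) ps"
    have qs: "qs \<in> lists (carr N \<times> carr L)"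
      using ps sm by (auto simp: qs_def in_lists_conv_set)
    have eq: "finite_rank_op M N ps (s z) = finite_rank_op L N qs z" if z: "z \<in> carr L" for z
    proof (rule MN.N.ip_eqI)
      fix w u assume w: "w \<in> carr N"
      have "(\<Sum>(y, x)\<leftarrow>ps. ip N w y u * ip M x (s z) u) = (\<Sum>(y, x)\<leftarrow>qs. ip N w y u * ip L x z u)"
        using ps z unfolding qs_def by (induction ps) (auto simp: LM.is_adj_ip_right[OF adj])
      then show "ip N w (finite_rank_op M N ps (s z)) u = ip N w (finite_rank_op L N qs z) u"
        using w z ps qs sm by (simp add: MN.ip_finite_rank LN.ip_finite_rank)
    qed (use z ps qs sm in \<open>simp_all add: MN.finite_rank_closed LN.finite_rank_closed\<close>)
    have "hn N (diff N (compose (carr L) T s z) (finite_rank_op L N qs z)) \<le> c * (\<epsilon> * hn L z)"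
      if z: "z \<in> carr L" for z
    proof -
      have "hn N (diff N (compose (carr L) T s z) (finite_rank_op L N qs z)) \<le> \<epsilon> * hn M (s z)"
        using bspec[OF b sm(1)[OF z]] z by (simp add: compose_eq eq)
      also have "\<dots> \<le> \<epsilon> * (c * hn L z)"
        using bd z \<epsilon> by (intro mult_left_mono) (auto simp: fbound_def)
      finally show ?thesis by (simp only: mult_ac)
    qed
    with qs show "\<exists>ps \<in> lists (carr N \<times> carr L). \<forall>z\<in>carr L.
        hn N (diff N (compose (carr L) T s z) (finite_rank_op L N ps z)) \<le> c * (\<epsilon> * hn L z)"
      by blast
  qed
qed

section \<open>Tensor products with \<open>C\<^sub>0(U)\<close>\<close>

definition ev :: "('x \<Rightarrow> complex, 'm, 'z) hmod_scheme \<Rightarrow> ('m \<times> ('x \<Rightarrow> complex)) list \<Rightarrow> 'm" where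
  "ev M xs = vsum M (map (\<lambda>(m, f). act M m f) xs)"

text \<open>This is the closed span of the products m f with f in C_0(U): limits of such sums vanish
  off \<open>U\<close> (\<open>limit_vanish\<close>), and a vector vanishing off \<open>U\<close> is
  approximated by its own products (\<open>vanish_approx\<close>).\<close>

definition vanish :: "'x set \<Rightarrow> ('x \<Rightarrow> complex, 'm, 'z) hmod_scheme \<Rightarrow> 'm set" where
  "vanish U M = {m \<in> carr M. \<forall>u. u \<notin> U \<longrightarrow> ip M m m u = 0}"

text \<open>The point of \<open>M \<otimes> C\<^sub>0(U)\<close> that the evaluation \<open>m \<otimes> f \<mapsto> m f\<close> identifies with \<open>m\<close>.\<close>

definition tcls :: "'x topology \<Rightarrow> 'x set \<Rightarrow> ('x \<Rightarrow> complex, 'm, 'z) hmod_scheme \<Rightarrow> 'm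
    \<Rightarrow> (nat \<Rightarrow> ('m \<times> ('x \<Rightarrow> complex)) list) set" where
  "tcls X U M m = {t. (\<forall>n. t n \<in> lists (carr M \<times> van X U)) \<and>
     (\<lambda>n. hn M (diff M (ev M (t n)) m)) \<longlonglongrightarrow> 0}"

text \<open>
  The action of \<open>C(X)\<close> on the elements that vanish off \<open>U\<close>.  It has to be characterised by inner
  products because \<open>act M\<close> need only be meaningful for the smaller algebra \<open>C\<^sub>0(U)\<close>.
\<close>

definition mact :: "('x \<Rightarrow> complex, 'm, 'z) hmod_scheme \<Rightarrow> 'm \<Rightarrow> ('x \<Rightarrow> complex) \<Rightarrow> 'm" where
  "mact M m b = (SOME m'. m' \<in> carr M \<and> (\<forall>y\<in>carr M. \<forall>u. ip M y m' u = ip M y m u * b u))"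

text \<open>A model of both tensor products. For a C(X)-module it is M \<otimes> F with scalars from
  C_0(U); for a C_0(U)-module the carrier is unchanged and only the action grows, to one of
  C(X).\<close>

definition submod :: "'x set \<Rightarrow> ('x \<Rightarrow> complex, 'm, 'z) hmod_scheme
    \<Rightarrow> ('x \<Rightarrow> complex, 'm, 'z) hmod_scheme" where
  "submod U M = M\<lparr>carr := vanish U M, act := mact M\<rparr>"

lemma submod_sel [simp]:
  "carr (submod U M) = vanish U M" "zer (submod U M) = zer M" "add (submod U M) = add M"
  "scl (submod U M) = scl M" "act (submod U M) = mact M" "ip (submod U M) = ip M"
  by (simp_all add: submod_def)

lemma diff_submod [simp]: "diff (submod U M) = diff M"
  by (simp add: diff_def fun_eq_iff)

lemma hn_submod [simp]: "hn (submod U M) = hn M"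
  by (simp add: hn_def fun_eq_iff)

lemma pn_submod [simp]: "pn (submod U M) = pn M"
  by (simp add: pn_def fun_eq_iff)

lemma vanish_carr: "m \<in> vanish U M \<Longrightarrow> m \<in> carr M"
  by (simp add: vanish_def)

lemma vanish_pn: "m \<in> vanish U M \<Longrightarrow> u \<notin> U \<Longrightarrow> pn M u m = 0"
  by (simp add: vanish_def pn_eq_0_iff)

lemma vanishI: "m \<in> carr M \<Longrightarrow> (\<And>u. u \<notin> U \<Longrightarrow> pn M u m = 0) \<Longrightarrow> m \<in> vanish U M"
  by (simp add: vanish_def pn_eq_0_iff)

lemma van_cont: "f \<in> van X V \<Longrightarrow> f \<in> cont_funs X"
  by (simp add: van_def)

lemma vsum_function_alg: "vsum (function_alg S) gs = (\<lambda>u. \<Sum>g\<leftarrow>gs. g u)"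
  by (induction gs) (auto simp: vsum_def fun_eq_iff)

lemma sum_list_concat:
  fixes xss :: "'c :: comm_monoid_add list list"
  shows "sum_list (concat xss) = sum_list (map sum_list xss)"
  by (induction xss) simp_all

text \<open>Transport of structure along \<phi>. Applied to the map \<open>cls\<close>, it gives the
  tensor product the module axioms of \<open>submod U M\<close>, without any calculation with
  representatives of classes.\<close>

lemma fmod_transport:
  assumes "fmod S Q" and carr: "carr T = \<phi> ` carr Q" and zer: "zer T = \<phi> (zer Q)"
    and add: "\<And>x y. \<lbrakk>x \<in> carr Q; y \<in> carr Q\<rbrakk> \<Longrightarrow> add T (\<phi> x) (\<phi> y) = \<phi> (add Q x y)"
    and scl: "\<And>x c. x \<in> carr Q \<Longrightarrow> scl T c (\<phi> x) = \<phi> (scl Q c x)"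
    and act: "\<And>x b. \<lbrakk>x \<in> carr Q; b \<in> S\<rbrakk> \<Longrightarrow> act T (\<phi> x) b = \<phi> (act Q x b)"
    and ip: "\<And>x y. \<lbrakk>x \<in> carr Q; y \<in> carr Q\<rbrakk> \<Longrightarrow> ip T (\<phi> x) (\<phi> y) = ip Q x y"
  shows "fmod S T"
proof -
  interpret Q: fmod S Q by fact
  have diff: "diff T (\<phi> x) (\<phi> y) = \<phi> (diff Q x y)" if "x \<in> carr Q" "y \<in> carr Q" for x y
    using that by (simp add: diff_def add scl Q.closed)
  note eqs = carr zer add scl act ip Q.closed Q.ip_simps
  show ?thesis
  proof (unfold_locales, goal_cases)
    case 4 then show ?case by (auto simp: eqs Q.add_assoc)
  next
    case (5 x y)
    then obtain a b where "a \<in> carr Q" "x = \<phi> a" "b \<in> carr Q" "y = \<phi> b" by (auto simp: carr)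
    then show ?case by (simp add: add Q.add_commute)
  next
    case 6 then show ?case by (auto simp: eqs Q.add_zer)
  next
    case 7 then show ?case by (auto simp: carr diff zer Q.diff_self)
  next
    case 8 then show ?case by (auto simp: eqs Q.scl_one)
  next
    case 9 then show ?case by (auto simp: eqs Q.scl_scl)
  next
    case 10 then show ?case by (auto simp: eqs Q.scl_add_left)
  next
    case 11 then show ?case by (auto simp: eqs Q.scl_add_right)
  next
    case 12 then show ?case by (rule Q.bounded)
  next
    case 13 then show ?case by (auto simp: carr ip Q.ip_in)
  next
    case 16 then show ?case by (auto simp: carr ip Q.ip_cnj)
  next
    case 17 then show ?case by (auto simp: carr ip Q.ip_pos)
  next
    case (18 x)
    then obtain a where a: "a \<in> carr Q" "x = \<phi> a" by (auto simp: carr)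
    have "a = zer Q" using 18(2) a by (intro Q.ip_definite) (simp_all add: ip)
    then show ?case by (simp add: a zer)
  qed (auto simp: eqs)
qed

context fmod
begin

lemma Cauchy_Schwarz_hn:
  assumes "x \<in> carr M" and "y \<in> carr M"
  shows "cmod (ip M x y u) \<le> hn M x * hn M y"
proof -
  have "pn M u x * pn M u y \<le> hn M x * hn M y"
    by (rule mult_mono[OF pn_le_hn[OF assms(1)] pn_le_hn[OF assms(2)] hn_nonneg[OF assms(1)] pn_nonneg])
  then show ?thesis using Cauchy_Schwarz[OF assms, of u] by linarith
qed

lemma mact_eqI:
  assumes "m' \<in> carr M" and "\<And>y u. y \<in> carr M \<Longrightarrow> ip M y m' u = ip M y m u * b u"
  shows "mact M m b = m'"
proof -
  have "mact M m b \<in> carr M \<and> (\<forall>y\<in>carr M. \<forall>u. ip M y (mact M m b) u = ip M y m u * b u)"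
    unfolding mact_def by (rule someI[of _ m']) (use assms in auto)
  then show ?thesis using assms by (intro ip_eqI) auto
qed

lemma mact_eq_act: "\<lbrakk>m \<in> carr M; b \<in> S\<rbrakk> \<Longrightarrow> mact M m b = act M m b"
  by (rule mact_eqI) (simp_all add: ip_act act_closed)

end

text \<open>\<open>V\<close> stands for the algebra that acts on \<open>M\<close>, \<open>W\<close>
  for the one that acts on the tensor product: \<open>V = topspace X\<close> and
  \<open>W = U\<close> for M \<otimes> F, the other way round for N \<otimes> E.\<close>

locale tensored = compact_Hausdorff X + fmod "van X V" M
  for X :: "'x topology" and V :: "'x set" and M :: "('x \<Rightarrow> complex, 'm, 'z) hmod_scheme" +
  fixes U W :: "'x set"
  assumes complete: "norm_complete M (hn M)"
    and U: "openin X U" and UV: "U \<subseteq> V" and UW: "U \<subseteq> W"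
begin

abbreviation F where "F \<equiv> C0_corr (subtopology X U)"
abbreviation B where "B \<equiv> function_alg (van X W)"
abbreviation P where "P \<equiv> alg_tensor B M F"
abbreviation T where "T \<equiv> tensor B M F"
abbreviation L where "L \<equiv> lists (carr M \<times> van X U)"
abbreviation MU where "MU \<equiv> vanish U M"
abbreviation cls where "cls \<equiv> tcls X U M"

lemma C0V: "f \<in> van X U \<Longrightarrow> f \<in> van X V"
  using van_mono[OF UV] by blast

section \<open>Evaluation on the algebraic tensor product\<close>

lemma ev_summands: "xs \<in> L \<Longrightarrow> set (map (\<lambda>(m, f). act M m f) xs) \<subseteq> carr M"
  by (auto simp: in_lists_conv_set intro!: act_closed C0V)

lemma ev_closed: "xs \<in> L \<Longrightarrow> ev M xs \<in> carr M"
  unfolding ev_def by (rule vsum_closed[OF ev_summands])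

lemma ip_ev: "xs \<in> L \<Longrightarrow> w \<in> carr M \<Longrightarrow> ip M w (ev M xs) u = (\<Sum>(m, f)\<leftarrow>xs. ip M w m u * f u)"
proof -
  assume xs: "xs \<in> L" and w: "w \<in> carr M"
  have "ip M w (ev M xs) u = (\<Sum>y\<leftarrow>map (\<lambda>(m, f). act M m f) xs. ip M w y u)"
    unfolding ev_def by (rule ip_vsum[OF w ev_summands[OF xs]])
  also have "\<dots> = (\<Sum>(m, f)\<leftarrow>xs. ip M w m u * f u)"
    using xs w by (induction xs) (auto simp: ip_act C0V)
  finally show ?thesis .
qed

lemma ip_ev_left:
  "xs \<in> L \<Longrightarrow> w \<in> carr M \<Longrightarrow> ip M (ev M xs) w u = (\<Sum>(m, f)\<leftarrow>xs. cnj (f u) * ip M m w u)"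
proof -
  assume xs: "xs \<in> L" and w: "w \<in> carr M"
  have "ip M (ev M xs) w u = (\<Sum>y\<leftarrow>map (\<lambda>(m, f). act M m f) xs. ip M y w u)"
    unfolding ev_def by (rule ip_vsum_left[OF w ev_summands[OF xs]])
  also have "\<dots> = (\<Sum>(m, f)\<leftarrow>xs. cnj (f u) * ip M m w u)"
    using xs w by (induction xs) (auto simp: ip_act_left C0V)
  finally show ?thesis .
qed

lemma ev_append: "xs \<in> L \<Longrightarrow> ys \<in> L \<Longrightarrow> ev M (xs @ ys) = add M (ev M xs) (ev M ys)"
  by (rule ip_eqI) (simp_all add: ip_ev ev_closed closed ip_simps)

lemma scl_L: "xs \<in> L \<Longrightarrow> map (\<lambda>(m, f). (scl M c m, f)) xs \<in> L"
  by (auto simp: in_lists_conv_set closed)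

lemma ev_scl:
  assumes xs: "xs \<in> L"
  shows "ev M (map (\<lambda>(m, f). (scl M c m, f)) xs) = scl M c (ev M xs)"
proof (rule ip_eqI)
  fix w u assume w: "w \<in> carr M"
  have "(\<Sum>(m, f)\<leftarrow>map (\<lambda>(m, f). (scl M c m, f)) xs. ip M w m u * f u)
      = c * (\<Sum>(m, f)\<leftarrow>xs. ip M w m u * f u)"
    using xs w by (induction xs) (auto simp: ip_scl algebra_simps)
  then show "ip M w (ev M (map (\<lambda>(m, f). (scl M c m, f)) xs)) u = ip M w (scl M c (ev M xs)) u"
    using w ip_ev[OF scl_L[OF xs] w] by (simp add: ip_ev xs ip_scl ev_closed)
qed (use xs scl_L in \<open>simp_all add: ev_closed closed\<close>)

lemma act_L: "xs \<in> L \<Longrightarrow> b \<in> cont_funs X \<Longrightarrow> map (\<lambda>(m, f). (m, \<lambda>x. f x * b x)) xs \<in> L"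
  by (auto simp: in_lists_conv_set intro!: van_mult_ideal)

lemma ip_ev_act:
  assumes xs: "xs \<in> L" and b: "b \<in> cont_funs X" and w: "w \<in> carr M"
  shows "ip M w (ev M (map (\<lambda>(m, f). (m, \<lambda>x. f x * b x)) xs)) u = ip M w (ev M xs) u * b u"
proof -
  have "(\<Sum>(m, f)\<leftarrow>map (\<lambda>(m, f). (m, \<lambda>x. f x * b x)) xs. ip M w m u * f u)
      = (\<Sum>(m, f)\<leftarrow>xs. ip M w m u * f u) * b u"
    by (induction xs) (auto simp: algebra_simps)
  then show ?thesis using ip_ev[OF act_L[OF xs b] w] by (simp add: ip_ev xs w)
qed

lemma P_sel [simp]: "carr P = L" "zer P = []" "add P = (@)"
  "scl P = (\<lambda>c. map (\<lambda>(m, f). (scl M c m, f)))"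
  "act P = (\<lambda>xs b. map (\<lambda>(m, f). (m, \<lambda>x. f x * b x)) xs)"
  by (simp_all add: alg_tensor_def C0_funs_eq_van[OF U])

text \<open>Since C_0(U) is commutative and acts by multiplication, both sides at \<open>u\<close>
  are the double sum of the terms cnj (f u) <m, m'>(u) f'(u). This is the isometry of evaluation; in
  particular the completion divides out exactly the lists that evaluate to zero.\<close>

lemma ip_P:
  assumes xs: "xs \<in> L" and ys: "ys \<in> L"
  shows "ip P xs ys = ip M (ev M xs) (ev M ys)"
proof
  fix u
  have inner: "(\<Sum>(m', f')\<leftarrow>ys. cnj (f u) * (ip M m m' u * f' u)) = cnj (f u) * ip M m (ev M ys) u"
    if "m \<in> carr M" for m f
    using ip_ev[OF ys that] by (simp add: sum_list_const_mult[symmetric] split_def)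
  have "ip P xs ys u = (\<Sum>(m, f)\<leftarrow>xs. \<Sum>(m', f')\<leftarrow>ys. cnj (f u) * (ip M m m' u * f' u))"
    by (simp add: alg_tensor_def vsum_function_alg map_concat sum_list_concat o_def split_def
        del: function_alg_sel)
  also have "\<dots> = (\<Sum>(m, f)\<leftarrow>xs. cnj (f u) * ip M m (ev M ys) u)"
    using xs by (intro arg_cong[of _ _ sum_list] map_cong)
      (auto simp: in_lists_conv_set inner)
  finally show "ip P xs ys u = ip M (ev M xs) (ev M ys) u"
    by (simp add: ip_ev_left xs ys ev_closed)
qed

lemma hn_P: "xs \<in> L \<Longrightarrow> hn P xs = hn M (ev M xs)"
  by (simp add: hn_def ip_P)

lemma diff_P_L: "xs \<in> L \<Longrightarrow> ys \<in> L \<Longrightarrow> diff P xs ys \<in> L"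
  using scl_L by (simp add: diff_def)

lemma ev_diff: "xs \<in> L \<Longrightarrow> ys \<in> L \<Longrightarrow> ev M (diff P xs ys) = diff M (ev M xs) (ev M ys)"
  using scl_L by (simp add: diff_def ev_append ev_scl)

lemma hn_diff_P: "xs \<in> L \<Longrightarrow> ys \<in> L \<Longrightarrow> hn P (diff P xs ys) = hn M (diff M (ev M xs) (ev M ys))"
  by (simp add: hn_P diff_P_L ev_diff)

lemma cauchy_P: "cauchy_seq P (hn P) s \<longleftrightarrow> (\<forall>n. s n \<in> L) \<and> cauchy_seq M (hn M) (\<lambda>n. ev M (s n))"
  unfolding cauchy_seq_def P_sel by (auto simp: hn_diff_P ev_closed)

lemma convergent_cauchy:
  assumes s: "\<And>n. s n \<in> carr M" and m: "m \<in> carr M"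
    and lim: "(\<lambda>n. hn M (diff M (s n) m)) \<longlonglongrightarrow> 0"
  shows "cauchy_seq M (hn M) s"
  unfolding cauchy_seq_def
proof (intro conjI allI impI s)
  fix e :: real assume "e > 0"
  then obtain k where k: "\<forall>n\<ge>k. norm (hn M (diff M (s n) m) - 0) < e/2"
    using LIMSEQ_D[OF lim half_gt_zero] by blast
  have "hn M (diff M (s i) (s j)) < e" if "i \<ge> k" "j \<ge> k" for i j
  proof -
    have "hn M (diff M (s i) (s j)) \<le> hn M (diff M (s i) m) + hn M (diff M m (s j))"
      by (rule hn_triangle[OF s m s])
    also have "hn M (diff M m (s j)) = hn M (diff M (s j) m)"
      by (rule hn_diff_commute[OF m s])
    finally show ?thesis using k that by (smt (verit) field_sum_of_halves real_norm_def)
  qed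
  then show "\<exists>k. \<forall>i\<ge>k. \<forall>j\<ge>k. hn M (diff M (s i) (s j)) < e" by blast
qed

text \<open>By isometry, two sequences of tensors are equivalent when their evaluations have the
  same limit. Every operation of the completion is computed below by finding such a limit in
  \<open>M\<close>.\<close>

lemma cauchy_class_eq:
  assumes s: "\<And>n. s n \<in> L" and m: "m \<in> carr M"
    and lim: "(\<lambda>n. hn M (diff M (ev M (s n)) m)) \<longlonglongrightarrow> 0"
  shows "cauchy_class B P s = cls m"
proof (intro set_eqI iffI)
  fix t assume "t \<in> cauchy_class B P s"
  then have t: "\<And>n. t n \<in> L" and d: "(\<lambda>n. hn P (diff P (s n) (t n))) \<longlonglongrightarrow> 0"
    by (auto simp: cauchy_class_def cauchy_P)
  have "(\<lambda>n. hn M (diff M (ev M (t n)) m)) \<longlonglongrightarrow> 0"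
  proof (rule hn_LIMSEQ_0)
    show "hn M (diff M (ev M (t n)) m) \<le> hn P (diff P (s n) (t n)) + hn M (diff M (ev M (s n)) m)" for n
      using hn_triangle[OF ev_closed[OF t] ev_closed[OF s] m, of n n]
        hn_diff_commute[OF ev_closed[OF t] ev_closed[OF s], of n n] by (simp add: hn_diff_P s t)
    show "(\<lambda>n. hn P (diff P (s n) (t n)) + hn M (diff M (ev M (s n)) m)) \<longlonglongrightarrow> 0"
      using tendsto_add[OF d lim] by simp
  qed (simp add: closed ev_closed t m)
  with t show "t \<in> cls m" by (simp add: tcls_def)
next
  fix t assume "t \<in> cls m"
  then have t: "\<And>n. t n \<in> L" and tl: "(\<lambda>n. hn M (diff M (ev M (t n)) m)) \<longlonglongrightarrow> 0"
    by (auto simp: tcls_def)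
  have "cauchy_seq P (hn P) t"
    using t convergent_cauchy[OF ev_closed[OF t] m tl] by (simp add: cauchy_P)
  moreover have "(\<lambda>n. hn M (diff M (ev M (s n)) (ev M (t n)))) \<longlonglongrightarrow> 0"
  proof (rule hn_LIMSEQ_0)
    show "hn M (diff M (ev M (s n)) (ev M (t n)))
        \<le> hn M (diff M (ev M (s n)) m) + hn M (diff M (ev M (t n)) m)" for n
      using hn_triangle[OF ev_closed[OF s] m ev_closed[OF t], of n n]
        hn_diff_commute[OF m ev_closed[OF t], of n] by simp
    show "(\<lambda>n. hn M (diff M (ev M (s n)) m) + hn M (diff M (ev M (t n)) m)) \<longlonglongrightarrow> 0"
      using tendsto_add[OF lim tl] by simp
  qed (simp add: closed ev_closed s t)
  ultimately show "t \<in> cauchy_class B P s" by (simp add: cauchy_class_def hn_diff_P s t)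
qed

section \<open>Vectors vanishing off U as points of the tensor product\<close>

lemma van_restrict: "f \<in> van X V \<Longrightarrow> (\<And>u. u \<notin> U \<Longrightarrow> f u = 0) \<Longrightarrow> f \<in> van X U"
  by (auto simp: van_def)

lemma ip_vanish:
  assumes "m \<in> MU" and "y \<in> carr M" and "u \<notin> U"
  shows "ip M m y u = 0" and "ip M y m u = 0"
  using Cauchy_Schwarz[of m y u] Cauchy_Schwarz[of y m u] assms
  by (simp_all add: vanish_carr vanish_pn)

lemma ip_in_C0: "m \<in> MU \<Longrightarrow> y \<in> carr M \<Longrightarrow> ip M m y \<in> van X U" "m \<in> MU \<Longrightarrow> y \<in> carr M \<Longrightarrow> ip M y m \<in> van X U"
  by (auto intro!: van_restrict ip_in simp: vanish_carr ip_vanish)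

lemma act_vanish: "m \<in> carr M \<Longrightarrow> f \<in> van X U \<Longrightarrow> act M m f \<in> MU"
  by (rule vanishI) (simp_all add: act_closed C0V pn_act van_zero_outside)

lemma pn_diff_act: "m \<in> carr M \<Longrightarrow> f \<in> van X V \<Longrightarrow> pn M u (diff M m (act M m f)) = cmod (1 - f u) * pn M u m"
proof -
  assume m: "m \<in> carr M" and f: "f \<in> van X V"
  have "ip M (diff M m (act M m f)) (diff M m (act M m f)) u
      = (1 - f u) * cnj (1 - f u) * ip M m m u"
    using m f by (simp add: ip_simps closed algebra_simps)
  then show ?thesis by (simp add: pn_def norm_mult real_sqrt_mult del: complex_cnj_diff)
qed

text \<open>The approximate unit is adapted to <m, m> at level \<epsilon>^2 because the seminorm is
  the square root of this function: where f differs from 1, \<open>m\<close> already has seminorm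
  below \<epsilon>.\<close>

lemma vanish_approx:
  assumes m: "m \<in> MU" and "\<epsilon> > 0"
  obtains f where "f \<in> van X U" and "\<And>x. cnj (f x) = f x" and "\<And>x. cmod (f x) \<le> 1"
    and "hn M (diff M m (act M m f)) \<le> \<epsilon>"
proof -
  have "\<epsilon>\<^sup>2 > 0" using assms(2) by simp
  then obtain f where f: "f \<in> van X U" "\<And>x. cmod (f x) \<le> 1" "\<And>x. cmod (1 - f x) \<le> 1"
      "\<And>x. cnj (f x) = f x" "\<And>x. cmod (ip M m m x) \<ge> \<epsilon>\<^sup>2 \<Longrightarrow> f x = 1"
    using approx_unit[OF ip_in_C0(1)[OF m vanish_carr[OF m]]] by metis
  have "hn M (diff M m (act M m f)) \<le> \<epsilon>"
  proof (rule hn_le)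
    fix u
    show "pn M u (diff M m (act M m f)) \<le> \<epsilon>"
    proof (cases "cmod (ip M m m u) \<ge> \<epsilon>\<^sup>2")
      case True
      with f(5) assms(2) show ?thesis by (simp add: pn_diff_act vanish_carr[OF m] C0V f(1))
    next
      case False
      then have "pn M u m \<le> \<epsilon>" using assms(2) by (simp add: pn_def real_le_lsqrt)
      moreover have "cmod (1 - f u) * pn M u m \<le> 1 * pn M u m"
        using f(3) by (intro mult_right_mono) simp_all
      ultimately show ?thesis by (simp add: pn_diff_act vanish_carr[OF m] C0V f(1))
    qed
  qed (use assms in simp)
  with f show thesis by (intro that)
qed

text \<open>The tensors m \<otimes> f_n evaluate to m f_n, which tends to \<open>m\<close> along an
  approximate unit. Nonemptiness makes the choice in \<open>rep\<close> meaningful.\<close>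

lemma cls_nonempty:
  assumes m: "m \<in> MU"
  shows "cls m \<noteq> {}"
proof -
  have "\<exists>f. f \<in> van X U \<and> hn M (diff M m (act M m f)) \<le> inverse (real (Suc n))" for n
    using vanish_approx[OF m, of "inverse (real (Suc n))"] by (metis inverse_Suc)
  then obtain f where f: "\<And>n. f n \<in> van X U"
    and b: "\<And>n. hn M (diff M m (act M m (f n))) \<le> inverse (real (Suc n))" by metis
  have mc: "m \<in> carr M" by (rule vanish_carr[OF m])
  have ev: "ev M [(m, f n)] = act M m (f n)" for n
    by (rule ip_eqI) (use mc f in \<open>simp_all add: ev_closed ip_ev ip_act act_closed C0V\<close>)
  have "(\<lambda>n. hn M (diff M (ev M [(m, f n)]) m)) \<longlonglongrightarrow> 0"
    unfolding ev
  proof (rule hn_LIMSEQ_0[OF _ _ LIMSEQ_inverse_real_of_nat])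
    show "hn M (diff M (act M m (f n)) m) \<le> inverse (real (Suc n))" for n
      using b[of n] hn_diff_commute[OF mc act_closed[OF mc C0V[OF f[of n]]]] by simp
  qed (use mc f in \<open>simp add: closed C0V\<close>)
  then have "(\<lambda>n. [(m, f n)]) \<in> cls m" using mc f by (simp add: tcls_def)
  then show ?thesis by blast
qed

lemma rep_cls: "m \<in> MU \<Longrightarrow> rep (cls m) \<in> cls m"
  using cls_nonempty[of m] unfolding rep_def by (simp add: some_in_eq)

lemma rep_L: "m \<in> MU \<Longrightarrow> rep (cls m) n \<in> L"
  using rep_cls[of m] by (simp add: tcls_def)

lemma rep_lim: "m \<in> MU \<Longrightarrow> (\<lambda>n. hn M (diff M (ev M (rep (cls m) n)) m)) \<longlonglongrightarrow> 0"
  using rep_cls[of m] by (simp add: tcls_def)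

lemma cls_inj:
  assumes "m \<in> MU" and "m' \<in> MU" and "cls m = cls m'"
  shows "m = m'"
  by (rule limit_unique[OF ev_closed[OF rep_L[OF assms(1)]] vanish_carr[OF assms(1)]
      vanish_carr[OF assms(2)] rep_lim[OF assms(1)] rep_lim[OF assms(2), folded assms(3)]])

lemma limit_vanish:
  assumes s: "\<And>n. s n \<in> L" and m: "m \<in> carr M"
    and lim: "(\<lambda>n. hn M (diff M (ev M (s n)) m)) \<longlonglongrightarrow> 0"
  shows "m \<in> MU"
  unfolding vanish_def
proof (intro CollectI conjI allI impI m)
  fix u assume u: "u \<notin> U"
  have "ip M m (ev M xs) u = 0" if "xs \<in> L" for xs
  proof -
    have "(\<Sum>(m', f)\<leftarrow>xs. ip M m m' u * f u) = 0"
      using that u by (induction xs) (auto simp: van_zero_outside)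
    then show ?thesis by (simp add: ip_ev that m)
  qed
  then have "(\<lambda>n. ip M m (ev M (s n)) u) = (\<lambda>n. 0)" using s by simp
  with ip_LIMSEQ[OF ev_closed[OF s] m m lim, of u] show "ip M m m u = 0"
    by (simp add: LIMSEQ_const_iff)
qed

lemma cauchy_limit:
  assumes "cauchy_seq P (hn P) s"
  obtains m where "m \<in> MU" and "(\<lambda>n. hn M (diff M (ev M (s n)) m)) \<longlonglongrightarrow> 0"
proof -
  from assms have s: "\<And>n. s n \<in> L" and c: "cauchy_seq M (hn M) (\<lambda>n. ev M (s n))"
    by (simp_all add: cauchy_P)
  then obtain m where m: "m \<in> carr M" "(\<lambda>n. hn M (diff M (ev M (s n)) m)) \<longlonglongrightarrow> 0"
    using complete unfolding norm_complete_def by blast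
  show thesis by (rule that[OF limit_vanish[OF s m] m(2)])
qed

text \<open>The evaluations of a Cauchy sequence of tensors converge, as \<open>M\<close> is
  complete, and their limit vanishes off \<open>U\<close>; conversely each such vector is a limit of
  evaluations. So no new points arise in the completion.\<close>

lemma carr_T: "carr T = cls ` MU"
proof -
  have "carr T = cauchy_class B P ` {s. cauchy_seq P (hn P) s}"
    by (simp add: tensor_def completion_def)
  also have "\<dots> = cls ` MU"
  proof (intro equalityI subsetI)
    fix c assume "c \<in> cauchy_class B P ` {s. cauchy_seq P (hn P) s}"
    then obtain s where s: "cauchy_seq P (hn P) s" and c: "c = cauchy_class B P s" by auto
    from s obtain m where m: "m \<in> MU" "(\<lambda>n. hn M (diff M (ev M (s n)) m)) \<longlonglongrightarrow> 0"
      by (rule cauchy_limit)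
    have "c = cls m"
      unfolding c using s m by (intro cauchy_class_eq) (auto simp: cauchy_P vanish_carr)
    with m show "c \<in> cls ` MU" by blast
  next
    fix c assume "c \<in> cls ` MU"
    then obtain m where m: "m \<in> MU" and c: "c = cls m" by auto
    have "cauchy_class B P (rep (cls m)) = cls m"
      by (rule cauchy_class_eq[OF rep_L[OF m] vanish_carr[OF m] rep_lim[OF m]])
    moreover have "cauchy_seq P (hn P) (rep (cls m))"
      using convergent_cauchy[OF ev_closed[OF rep_L[OF m]] vanish_carr[OF m] rep_lim[OF m]] rep_L[OF m]
      by (simp add: cauchy_P)
    ultimately show "c \<in> cauchy_class B P ` {s. cauchy_seq P (hn P) s}" unfolding c by blast
  qed
  finally show ?thesis .
qed

lemma zer_MU: "zer M \<in> MU"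
  by (rule vanishI) (simp_all add: zer_closed)

lemma add_MU:
  assumes "m \<in> MU" and "m' \<in> MU"
  shows "add M m m' \<in> MU"
proof (rule vanishI)
  show "pn M u (add M m m') = 0" if "u \<notin> U" for u
    using pn_add[OF assms[THEN vanish_carr], of u] vanish_pn[OF assms(1) that]
      vanish_pn[OF assms(2) that] pn_nonneg[of M u "add M m m'"] by linarith
qed (use assms in \<open>simp add: vanish_carr add_closed\<close>)

lemma scl_MU: "m \<in> MU \<Longrightarrow> scl M c m \<in> MU"
  by (rule vanishI) (auto simp: vanish_carr scl_closed vanish_pn pn_scl)

section \<open>Operations and inner product of the completion\<close>

lemma zer_T: "zer T = cls (zer M)"
proof -
  have "ev M [] = zer M" by (simp add: ev_def vsum_Nil)
  then have "cauchy_class B P (\<lambda>_. zer P) = cls (zer M)"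
    by (intro cauchy_class_eq) (simp_all add: zer_closed)
  then show ?thesis by (simp add: tensor_def completion_def)
qed

lemma add_T:
  assumes "m \<in> MU" and "m' \<in> MU"
  shows "add T (cls m) (cls m') = cls (add M m m')"
proof -
  let ?s = "rep (cls m)" and ?t = "rep (cls m')"
  note c = vanish_carr[OF assms(1)] vanish_carr[OF assms(2)]
    ev_closed[OF rep_L[OF assms(1)]] ev_closed[OF rep_L[OF assms(2)]]
  have "cauchy_class B P (\<lambda>n. ?s n @ ?t n) = cls (add M m m')"
  proof (rule cauchy_class_eq)
    show "?s n @ ?t n \<in> L" for n using rep_L[OF assms(1), of n] rep_L[OF assms(2), of n] by simp
    show "add M m m' \<in> carr M" using c by (simp add: add_closed)
    show "(\<lambda>n. hn M (diff M (ev M (?s n @ ?t n)) (add M m m'))) \<longlonglongrightarrow> 0"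
    proof (rule hn_LIMSEQ_0)
      fix n
      have "diff M (ev M (?s n @ ?t n)) (add M m m')
          = add M (diff M (ev M (?s n)) m) (diff M (ev M (?t n)) m')"
        by (rule ip_eqI)
          (simp_all add: c ev_append rep_L[OF assms(1)] rep_L[OF assms(2)] closed ip_simps)
      then show "hn M (diff M (ev M (?s n @ ?t n)) (add M m m'))
          \<le> hn M (diff M (ev M (?s n)) m) + hn M (diff M (ev M (?t n)) m')"
        using c by (simp add: hn_add closed)
    next
      show "(\<lambda>n. hn M (diff M (ev M (?s n)) m) + hn M (diff M (ev M (?t n)) m')) \<longlonglongrightarrow> 0"
        using tendsto_add[OF rep_lim[OF assms(1)] rep_lim[OF assms(2)]] by simp
    qed (simp add: c closed ev_append rep_L[OF assms(1)] rep_L[OF assms(2)])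
  qed
  then show ?thesis by (simp add: tensor_def completion_def)
qed

lemma scl_T:
  assumes "m \<in> MU"
  shows "scl T r (cls m) = cls (scl M r m)"
proof -
  let ?s = "rep (cls m)"
  note c = vanish_carr[OF assms(1)] ev_closed[OF rep_L[OF assms(1)]]
  have "cauchy_class B P (\<lambda>n. scl P r (?s n)) = cls (scl M r m)"
  proof (rule cauchy_class_eq)
    show "scl P r (?s n) \<in> L" for n using scl_L[OF rep_L[OF assms(1)]] by simp
    show "scl M r m \<in> carr M" using c by (simp add: scl_closed)
    show "(\<lambda>n. hn M (diff M (ev M (scl P r (?s n))) (scl M r m))) \<longlonglongrightarrow> 0"
    proof (rule hn_LIMSEQ_0)
      fix n
      have "diff M (ev M (scl P r (?s n))) (scl M r m) = scl M r (diff M (ev M (?s n)) m)"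
        by (rule ip_eqI)
          (simp_all add: c ev_scl rep_L[OF assms(1)] closed ip_simps algebra_simps)
      then show "hn M (diff M (ev M (scl P r (?s n))) (scl M r m))
          \<le> cmod r * hn M (diff M (ev M (?s n)) m)"
        using hn_scl_le[of "diff M (ev M (?s n)) m" r] c by (simp add: closed)
    next
      show "(\<lambda>n. cmod r * hn M (diff M (ev M (?s n)) m)) \<longlonglongrightarrow> 0"
        using tendsto_mult_right_zero[OF rep_lim[OF assms(1)]] by simp
    qed (simp add: c closed ev_scl rep_L[OF assms(1)])
  qed
  then show ?thesis by (simp add: tensor_def completion_def)
qed

text \<open>Here \<open>w\<close> and \<open>w'\<close> play the role of \<open>v\<close> and
  \<open>v'\<close> multiplied by \<open>b\<close>, known only through inner products. The form is
  weak because \<open>b\<close> may lie outside the algebra for which \<open>act M\<close> is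
  meaningful.\<close>

lemma pn_weak_act:
  assumes "v \<in> carr M" "v' \<in> carr M" "w \<in> carr M" "w' \<in> carr M"
    and "\<And>y u. y \<in> carr M \<Longrightarrow> ip M y w u = ip M y v u * b u"
    and "\<And>y u. y \<in> carr M \<Longrightarrow> ip M y w' u = ip M y v' u * b u"
  shows "pn M u (diff M w w') = cmod (b u) * pn M u (diff M v v')"
proof -
  have r: "ip M y (diff M w w') u = ip M y (diff M v v') u * b u" if "y \<in> carr M" for y
    using assms that by (simp add: ip_diff algebra_simps)
  have l: "ip M (diff M w w') y u = cnj (b u) * ip M (diff M v v') y u" if "y \<in> carr M" for y
  proof -
    have "ip M (diff M w w') y u = cnj (ip M y (diff M w w') u)"
      using assms that by (simp add: ip_cnj closed)
    also have "\<dots> = cnj (b u) * cnj (ip M y (diff M v v') u)"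
      by (simp add: r that)
    finally show ?thesis using assms that by (simp add: ip_cnj closed)
  qed
  have "ip M (diff M w w') (diff M w w') u = cnj (b u) * b u * ip M (diff M v v') (diff M v v') u"
    using assms by (simp add: r l closed)
  then show ?thesis by (simp add: pn_def norm_mult real_sqrt_mult)
qed

lemma hn_weak_act:
  assumes "v \<in> carr M" "v' \<in> carr M" "w \<in> carr M" "w' \<in> carr M"
    and "\<And>y u. y \<in> carr M \<Longrightarrow> ip M y w u = ip M y v u * b u"
    and "\<And>y u. y \<in> carr M \<Longrightarrow> ip M y w' u = ip M y v' u * b u"
    and c: "0 \<le> c" "\<And>u. cmod (b u) \<le> c"
  shows "hn M (diff M w w') \<le> c * hn M (diff M v v')"
proof (rule hn_le)
  have d: "diff M v v' \<in> carr M" using assms by (simp add: closed)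
  show "0 \<le> c * hn M (diff M v v')" using c hn_nonneg[OF d] by simp
  show "pn M u (diff M w w') \<le> c * hn M (diff M v v')" for u
  proof -
    have "pn M u (diff M w w') = cmod (b u) * pn M u (diff M v v')"
      by (rule pn_weak_act[OF assms(1-6)])
    also have "\<dots> \<le> c * hn M (diff M v v')"
      using c pn_le_hn[OF d] by (intro mult_mono) simp_all
    finally show ?thesis .
  qed
qed

text \<open>A function \<open>b\<close> of C(X) can act on the C_0(U)-legs of the tensors
  representing \<open>m\<close>. Since \<open>b\<close> is bounded, the new evaluations are again
  Cauchy, and their limit has the inner products that characterise
  \<open>mact M m b\<close>.\<close>

lemma mact_MU:
  assumes m: "m \<in> MU" and b: "b \<in> cont_funs X"
  shows "mact M m b \<in> MU" and "y \<in> carr M \<Longrightarrow> ip M y (mact M m b) u = ip M y m u * b u"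
proof -
  let ?s = "rep (cls m)"
  let ?t = "\<lambda>n. map (\<lambda>(m, f). (m, \<lambda>x. f x * b x)) (?s n)"
  obtain c where c: "0 \<le> c" "\<And>u. cmod (b u) \<le> c" using cont_bounded[OF b] by metis
  note sL = rep_L[OF m] and tL = act_L[OF rep_L[OF m] b]
  note s_cauchy = convergent_cauchy[OF ev_closed[OF sL] vanish_carr[OF m] rep_lim[OF m]]
  have "cauchy_seq M (hn M) (\<lambda>n. ev M (?t n))"
    unfolding cauchy_seq_def
  proof (intro conjI allI impI)
    show "ev M (?t n) \<in> carr M" for n by (rule ev_closed[OF tL])
    fix e :: real assume "e > 0"
    then have "e / (c + 1) > 0" using c by simp
    then obtain k where k: "\<forall>i\<ge>k. \<forall>j\<ge>k. hn M (diff M (ev M (?s i)) (ev M (?s j))) < e / (c + 1)"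
      using s_cauchy unfolding cauchy_seq_def by blast
    have "hn M (diff M (ev M (?t i)) (ev M (?t j))) < e" if "i \<ge> k" "j \<ge> k" for i j
    proof -
      have "hn M (diff M (ev M (?t i)) (ev M (?t j))) \<le> c * hn M (diff M (ev M (?s i)) (ev M (?s j)))"
        by (rule hn_weak_act[where b = b]) (simp_all add: ev_closed sL tL ip_ev_act b c del: map_map)
      also have "\<dots> \<le> c * (e / (c + 1))"
        using k that c by (intro mult_left_mono) (auto intro: less_imp_le)
      also have "\<dots> < e" using c \<open>e > 0\<close> by (simp add: divide_simps)
      finally show ?thesis .
    qed
    then show "\<exists>k. \<forall>i\<ge>k. \<forall>j\<ge>k. hn M (diff M (ev M (?t i)) (ev M (?t j))) < e" by blast
  qed
  then obtain m' where m': "m' \<in> carr M" and lim: "(\<lambda>n. hn M (diff M (ev M (?t n)) m')) \<longlonglongrightarrow> 0"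
    using complete unfolding norm_complete_def by blast
  have ip': "ip M y m' u = ip M y m u * b u" if y: "y \<in> carr M" for y u
  proof (rule LIMSEQ_unique)
    show "(\<lambda>n. ip M y (ev M (?t n)) u) \<longlonglongrightarrow> ip M y m' u"
      by (rule ip_LIMSEQ[OF ev_closed[OF tL] m' y lim])
    show "(\<lambda>n. ip M y (ev M (?t n)) u) \<longlonglongrightarrow> ip M y m u * b u"
      using tendsto_mult_right[OF ip_LIMSEQ[OF ev_closed[OF sL] vanish_carr[OF m] y rep_lim[OF m]], of u "b u"]
      by (simp add: ip_ev_act[OF sL b y])
  qed
  have eq: "mact M m b = m'" by (rule mact_eqI[OF m' ip'])
  show "mact M m b \<in> MU" unfolding eq by (rule limit_vanish[OF tL m' lim])
  show "y \<in> carr M \<Longrightarrow> ip M y (mact M m b) u = ip M y m u * b u" unfolding eq by (rule ip')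
qed

lemma act_T:
  assumes m: "m \<in> MU" and b: "b \<in> cont_funs X"
  shows "act T (cls m) b = cls (mact M m b)"
proof -
  let ?s = "rep (cls m)"
  obtain c where c: "0 \<le> c" "\<And>u. cmod (b u) \<le> c" using cont_bounded[OF b] by metis
  note sL = rep_L[OF m] and tL = act_L[OF rep_L[OF m] b]
  have "cauchy_class B P (\<lambda>n. act P (?s n) b) = cls (mact M m b)"
  proof (rule cauchy_class_eq)
    show "act P (?s n) b \<in> L" for n using tL by simp
    show mc: "mact M m b \<in> carr M" using vanish_carr[OF mact_MU(1)[OF m b]] .
    show "(\<lambda>n. hn M (diff M (ev M (act P (?s n) b)) (mact M m b))) \<longlonglongrightarrow> 0"
    proof (rule hn_LIMSEQ_0)
      show "hn M (diff M (ev M (act P (?s n) b)) (mact M m b)) \<le> c * hn M (diff M (ev M (?s n)) m)" for n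
        by (rule hn_weak_act[where b = b])
          (simp_all add: ev_closed sL tL mc vanish_carr[OF m] ip_ev_act b mact_MU(2)[OF m b] c)
      show "(\<lambda>n. c * hn M (diff M (ev M (?s n)) m)) \<longlonglongrightarrow> 0"
        using tendsto_mult_right_zero[OF rep_lim[OF m]] by simp
    qed (use tL mc in \<open>simp add: closed ev_closed\<close>)
  qed
  then show ?thesis by (simp add: tensor_def completion_def)
qed

lemma ip_T:
  assumes m: "m \<in> MU" and m': "m' \<in> MU"
  shows "ip T (cls m) (cls m') = ip M m m'"
proof -
  let ?s = "\<lambda>n. ev M (rep (cls m) n)" and ?t = "\<lambda>n. ev M (rep (cls m') n)"
  note c = vanish_carr[OF m] vanish_carr[OF m'] ev_closed[OF rep_L[OF m]] ev_closed[OF rep_L[OF m']]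
  have eq: "nrm B (diff B (ip P (rep (cls m) n) (rep (cls m') n)) b)
      = (SUP u. cmod (ip M (?s n) (?t n) u - b u))" for n b
    by (simp add: ip_P rep_L m m')
  have lim: "(\<lambda>n. SUP u. cmod (ip M (?s n) (?t n) u - ip M m m' u)) \<longlonglongrightarrow> 0"
  proof (rule Lim_null_comparison[OF always_eventually], rule allI)
    fix n
    let ?d = "diff M (?s n) m" and ?e = "diff M (?t n) m'"
    let ?r = "hn M ?d * hn M ?e + hn M ?d * hn M m' + hn M m * hn M ?e"
    have le: "cmod (ip M (?s n) (?t n) u - ip M m m' u) \<le> ?r" for u
    proof -
      have "ip M (?s n) (?t n) u - ip M m m' u = ip M ?d ?e u + ip M ?d m' u + ip M m ?e u"
        using c by (simp add: ip_simps closed)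
      then have "cmod (ip M (?s n) (?t n) u - ip M m m' u)
          = cmod (ip M ?d ?e u + ip M ?d m' u + ip M m ?e u)" by simp
      also have "\<dots> \<le> cmod (ip M ?d ?e u) + cmod (ip M ?d m' u) + cmod (ip M m ?e u)"
        by (rule order_trans[OF norm_triangle_ineq add_right_mono[OF norm_triangle_ineq]])
      also have "\<dots> \<le> ?r"
        using c by (intro add_mono Cauchy_Schwarz_hn) (simp_all add: closed)
      finally show ?thesis .
    qed
    have "(SUP u. cmod (ip M (?s n) (?t n) u - ip M m m' u)) \<le> ?r"
      by (rule SUP_cmod_le[OF le])
    moreover have "0 \<le> (SUP u. cmod (ip M (?s n) (?t n) u - ip M m m' u))"
      by (rule order_trans[OF norm_ge_zero SUP_cmod_ge[OF le]])
    ultimately show "norm (SUP u. cmod (ip M (?s n) (?t n) u - ip M m m' u)) \<le> ?r" by simp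
  next
    show "(\<lambda>n. hn M (diff M (?s n) m) * hn M (diff M (?t n) m') + hn M (diff M (?s n) m) * hn M m'
        + hn M m * hn M (diff M (?t n) m')) \<longlonglongrightarrow> 0"
      using tendsto_add[OF tendsto_add[OF tendsto_mult[OF rep_lim[OF m] rep_lim[OF m']]
            tendsto_mult_left_zero[OF rep_lim[OF m]]] tendsto_mult_right_zero[OF rep_lim[OF m']]]
      by simp
  qed
  \<comment> \<open>The candidates \<open>b\<close> and \<open>ip M m m'\<close> are known to lie in
    the ideals for \<open>W\<close> and for \<open>V\<close>; their differences from the
    approximants are therefore bounded inside C(X), which contains both.\<close>
  have uniq: "b = ip M m m'"
    if b: "b \<in> van X W" and bl: "(\<lambda>n. SUP u. cmod (ip M (?s n) (?t n) u - b u)) \<longlonglongrightarrow> 0" for b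
  proof
    fix u
    have "(\<lambda>n. ip M (?s n) (?t n) u - b' u) \<longlonglongrightarrow> 0"
      if b': "b' \<in> cont_funs X" and l: "(\<lambda>n. SUP u. cmod (ip M (?s n) (?t n) u - b' u)) \<longlonglongrightarrow> 0" for b'
    proof (rule Lim_null_comparison[OF always_eventually l], rule allI)
      fix n
      have "(\<lambda>u. ip M (?s n) (?t n) u - b' u) \<in> van X (topspace X)"
        using van_cont[OF ip_in[OF c(3,4)]] b' by (intro van_diff) (simp_all only: van_topspace)
      then obtain r where "\<And>u. cmod (ip M (?s n) (?t n) u - b' u) \<le> r" using van_bounded by metis
      then show "norm (ip M (?s n) (?t n) u - b' u) \<le> (SUP u. cmod (ip M (?s n) (?t n) u - b' u))"
        by (rule SUP_cmod_ge)
    qed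
    from this[OF van_cont[OF b] bl] this[OF van_cont[OF ip_in[OF c(1,2)]] lim]
    show "b u = ip M m m' u"
      by (rule LIMSEQ_unique[OF LIM_zero_cancel LIM_zero_cancel])
  qed
  have inW: "ip M m m' \<in> van X W" using ip_in_C0(1)[OF m c(2)] van_mono[OF UW] by blast
  have "ip T (cls m) (cls m') = (THE b. b \<in> van X W \<and>
      (\<lambda>n. SUP u. cmod (ip M (?s n) (?t n) u - b u)) \<longlonglongrightarrow> 0)"
    by (simp add: tensor_def completion_def eq[simplified])
  also have "\<dots> = ip M m m'"
    by (rule the_equality) (simp only: inW lim simp_thms, rule uniq, simp_all only:)
  finally show ?thesis .
qed

lemma fmod_submod: "fmod (van X W) (submod U M)"
proof (unfold_locales, goal_cases)
  case (12 f) then show ?case using van_bounded by metis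
next
  case (13 x y)
  then show ?case using ip_in_C0(1)[of x y] van_mono[OF UW] by (auto simp: vanish_carr)
next
  case (19 x b)
  then show ?case by (auto intro: mact_MU van_cont)
next
  case (20 x y b u)
  then show ?case by (auto simp: vanish_carr intro: mact_MU van_cont)
next
  case 5 then show ?case by (simp add: vanish_carr add_commute)
next
  case 18 then show ?case by (auto simp: vanish_carr intro: ip_definite)
qed (simp_all add: vanish_carr zer_MU add_MU scl_MU closed ip_simps add_assoc add_zer diff_self
  scl_one scl_scl scl_add_left scl_add_right ip_cnj ip_pos)

lemma fmod_T: "fmod (van X W) T"
  by (rule fmod_transport[OF fmod_submod, where \<phi> = cls])
    (simp_all add: carr_T zer_T add_T scl_T ip_T act_T van_cont)

lemma cls_fadj: "restrict cls MU \<in> fadj (submod U M) T"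
  and inv_cls_fadj: "restrict (the_inv_into MU cls) (carr T) \<in> fadj T (submod U M)"
proof -
  have inj: "inj_on cls MU" using cls_inj by (auto simp: inj_on_def)
  have inv: "the_inv_into MU cls (cls m) = m" if "m \<in> MU" for m
    by (rule the_inv_into_f_f[OF inj that])
  show "restrict cls MU \<in> fadj (submod U M) T"
    by (rule fadj_isometry[where \<psi> = "the_inv_into MU cls"]) (auto simp: carr_T inv ip_T)
  show "restrict (the_inv_into MU cls) (carr T) \<in> fadj T (submod U M)"
    by (rule fadj_isometry[where \<psi> = cls]) (auto simp: carr_T inv ip_T)
qed

lemma inv_cls: "m \<in> MU \<Longrightarrow> the_inv_into MU cls (cls m) = m"
  using cls_inj by (intro the_inv_into_f_f) (auto simp: inj_on_def)

lemma diff_T: "m \<in> MU \<Longrightarrow> m' \<in> MU \<Longrightarrow> diff T (cls m) (cls m') = cls (diff M m m')"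
  by (simp add: diff_def scl_T add_T scl_MU)

lemma hn_T: "m \<in> MU \<Longrightarrow> hn T (cls m) = hn M m"
  by (simp add: hn_def ip_T)

end

section \<open>Restriction and extension of operators\<close>

lemma fadj_submod_target:
  assumes "vanish U N = carr N"
  shows "fadj M (submod U N) = fadj M N"
  using assms by (simp add: fadj_def fbound_def is_adj_def)

lemma is_adj_submod_target:
  assumes "vanish U N = carr N"
  shows "is_adj M (submod U N) T R = is_adj M N T R"
  using assms by (simp add: is_adj_def)

text \<open>\<open>M\<close> is a module over C(X) and \<open>N\<close> over C_0(U). Operators
  between them are seen in two ways: M \<rightarrow> \<open>QN\<close> over C(X), where
  \<open>QN\<close> is \<open>N\<close> with the larger action, and \<open>QM\<close> \<rightarrow>
  N over C_0(U).\<close>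

locale module_pair = M: tensored X "topspace X" M U U + N: tensored X U N U "topspace X"
  for X :: "'x topology" and U :: "'x set"
    and M :: "('x \<Rightarrow> complex, 'm, 'y) hmod_scheme" and N :: "('x \<Rightarrow> complex, 'n, 'z) hmod_scheme"
begin

abbreviation MU where "MU \<equiv> vanish U M"
abbreviation QM where "QM \<equiv> submod U M"
abbreviation QN where "QN \<equiv> submod U N"

lemma vanish_N: "vanish U N = carr N"
  by (auto simp: vanish_def intro: van_zero_outside[OF N.ip_in])

lemma U_sub: "U \<subseteq> topspace X"
  by (rule M.UV)

sublocale MQ: fmod_pair "van X (topspace X)" M QN
  by (intro fmod_pair.intro M.fmod_axioms N.fmod_submod)

sublocale QN: fmod_pair "van X U" QM N
  by (intro fmod_pair.intro N.fmod_axioms M.fmod_submod)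

lemma MU_carr: "m \<in> MU \<Longrightarrow> m \<in> carr M"
  by (rule vanish_carr)

lemma act_MU: "z \<in> carr M \<Longrightarrow> f \<in> van X U \<Longrightarrow> act M z f \<in> MU"
  by (rule M.act_vanish)

lemma mact_N: "y \<in> carr N \<Longrightarrow> f \<in> van X U \<Longrightarrow> mact N y f = act N y f"
  by (rule N.mact_eq_act)

text \<open>As an operator into \<open>QN\<close>, \<open>T\<close> commutes with the action of
  C(X); on C_0(U) that action agrees with the given one on \<open>N\<close>.\<close>

lemma adj_act_local:
  assumes "is_adj M N T R" and "z \<in> carr M" and "f \<in> van X U"
  shows "T (act M z f) = act N (T z) f"
proof -
  have "is_adj M QN T R" using assms(1) by (simp add: is_adj_submod_target[OF vanish_N])
  then have "T (act M z f) = mact N (T z) f"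
    using MQ.adj_act[of T R z f] assms(2,3) M.C0V by simp
  then show ?thesis using mact_N is_adj_fun[OF assms(1,2)] assms(3) by simp
qed

lemma pn_N_outside: "y \<in> carr N \<Longrightarrow> u \<notin> U \<Longrightarrow> pn N u y = 0"
  using vanish_pn[of y U N u] by (simp add: vanish_N)

text \<open>
  A module map \<open>M \<rightarrow> N\<close> is determined near a point of \<open>U\<close> by its values at elements \<open>z f\<close>, which
  vanish off \<open>U\<close>.
\<close>

lemma local_bound:
  assumes G: "\<And>z. z \<in> carr M \<Longrightarrow> G z \<in> carr N"
    and act: "\<And>z f. \<lbrakk>z \<in> carr M; f \<in> van X U\<rbrakk> \<Longrightarrow> G (act M z f) = act N (G z) f"
    and bd: "\<And>m. m \<in> MU \<Longrightarrow> hn N (G m) \<le> c * hn M m" and c: "0 \<le> c" and z: "z \<in> carr M"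
  shows "hn N (G z) \<le> c * hn M z"
proof (rule hn_le)
  show c0: "0 \<le> c * hn M z" using c M.hn_nonneg[OF z] by simp
  fix u
  show "pn N u (G z) \<le> c * hn M z"
  proof (cases "u \<in> U")
    case False
    then show ?thesis using c0 G[OF z] by (simp add: pn_N_outside)
  next
    case True
    then obtain f where f: "f \<in> van X U" "f u = 1" "\<And>x. cmod (f x) \<le> 1"
      using M.bump[OF M.U] by metis
    have m: "act M z f \<in> MU" by (rule act_MU[OF z f(1)])
    have "pn N u (G z) = pn N u (G (act M z f))"
      using f by (simp add: act z G N.pn_act)
    also have "\<dots> \<le> hn N (G (act M z f))"
      by (rule N.pn_le_hn[OF G[OF MU_carr[OF m]]])
    also have "\<dots> \<le> c * hn M (act M z f)" by (rule bd[OF m])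
    also have "\<dots> \<le> c * hn M z"
    proof (rule mult_left_mono[OF _ c], rule hn_le)
      show "pn M v (act M z f) \<le> hn M z" for v
      proof -
        have "pn M v (act M z f) = pn M v z * cmod (f v)"
          by (rule M.pn_act[OF z M.C0V[OF f(1)]])
        also have "\<dots> \<le> pn M v z * 1"
          by (rule mult_left_mono[OF f(3)]) simp
        finally show ?thesis using M.pn_le_hn[OF z, of v] by simp
      qed
    qed (rule M.hn_nonneg[OF z])
    finally show ?thesis .
  qed
qed

text \<open>The old adjoint still serves: vectors of \<open>N\<close> are null off \<open>U\<close>,
  adjointable maps preserve this, so \<open>R\<close> maps into the submodule.\<close>

lemma is_adj_restrict:
  assumes T: "is_adj M N T R"
  shows "is_adj QM N (restrict T MU) R"
proof (rule is_adjI)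
  have T': "is_adj M QN T R" using T by (simp add: is_adj_submod_target[OF vanish_N])
  interpret QM: fmod_pair "van X (topspace X)" QN M
    by (intro fmod_pair.intro M.fmod_axioms N.fmod_submod)
  show "R y \<in> carr QM" if y: "y \<in> carr N" for y
    unfolding submod_sel
  proof (rule vanishI)
    show "R y \<in> carr M" by (rule is_adj_adj[OF T y])
    show "pn M u (R y) = 0" if u: "u \<notin> U" for u
      using QM.adj_pn_eq_0[OF MQ.is_adj_sym[OF T'], of y u] y pn_N_outside[OF y u]
      by (simp add: vanish_N)
  qed
qed (use is_adj_fun[OF T] is_adj_ip[OF T] in \<open>simp_all add: MU_carr\<close>)

lemma fadj_restrict:
  assumes "T \<in> fadj M N"
  shows "restrict T MU \<in> fadj QM N"
proof -
  obtain R c where T: "is_adj M N T R" "fbound M N c T" using assms by (rule fadjE)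
  have "fbound QM N c (restrict T MU)" using T(2) by (simp add: fbound_def MU_carr)
  with is_adj_restrict[OF T(1)] show ?thesis by (intro fadjI) simp_all
qed

text \<open>At a point of \<open>U\<close>, a bump function replaces \<open>z\<close> by a vector of
  the submodule with the same image at that point; off \<open>U\<close> all pairings in
  \<open>N\<close> vanish.\<close>

lemma fadj_eqI:
  assumes "T1 \<in> fadj M N" and "T2 \<in> fadj M N" and eq: "\<And>m. m \<in> MU \<Longrightarrow> T1 m = T2 m"
  shows "T1 = T2"
proof (rule extensionalityI[OF fadj_ext fadj_ext])
  fix z assume z: "z \<in> carr M"
  obtain R1 where T1: "is_adj M N T1 R1" using assms(1) by (rule fadjE)
  obtain R2 where T2: "is_adj M N T2 R2" using assms(2) by (rule fadjE)
  show "T1 z = T2 z"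
  proof (rule N.ip_eqI)
    fix w u assume w: "w \<in> carr N"
    show "ip N w (T1 z) u = ip N w (T2 z) u"
    proof (cases "u \<in> U")
      case True
      then obtain f where f: "f \<in> van X U" "f u = 1" "\<And>x. cmod (f x) \<le> 1"
        using M.bump[OF M.U] by metis
      have "act N (T1 z) f = act N (T2 z) f"
        using eq[OF act_MU[OF z f(1)]] by (simp add: adj_act_local[OF T1 z f(1)] adj_act_local[OF T2 z f(1)])
      then have "ip N w (act N (T1 z) f) u = ip N w (act N (T2 z) f) u" by simp
      then show ?thesis
        using f w is_adj_fun[OF T1 z] is_adj_fun[OF T2 z] by (simp add: N.ip_act)
    next
      case False
      then show ?thesis
        using van_zero_outside[OF N.ip_in[OF w is_adj_fun[OF T1 z]]]
          van_zero_outside[OF N.ip_in[OF w is_adj_fun[OF T2 z]]] by simp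
    qed
  qed (rule is_adj_fun[OF T1 z], rule is_adj_fun[OF T2 z])
qed (use assms in auto)

text \<open>The value of an extension at \<open>z\<close> must represent y \<mapsto> <z, R y>. Once
  these vectors exist, \<open>R\<close> is an adjoint of the extension and
  \<open>local_bound\<close> keeps the bound of \<open>T\<close>, so their existence isolates the
  whole difficulty.\<close>

lemma fadj_extend:
  assumes "T \<in> fadj QM N" and R: "is_adj QM N T R"
    and ex: "\<And>z. z \<in> carr M \<Longrightarrow> \<exists>w\<in>carr N. \<forall>y\<in>carr N. \<forall>u. ip N w y u = ip M z (R y) u"
  obtains T' where "T' \<in> fadj M N" and "\<And>m. m \<in> MU \<Longrightarrow> T' m = T m"
proof -
  from ex obtain E where E: "\<And>z. z \<in> carr M \<Longrightarrow> E z \<in> carr N"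
    and Ei: "\<And>z y u. \<lbrakk>z \<in> carr M; y \<in> carr N\<rbrakk> \<Longrightarrow> ip N (E z) y u = ip M z (R y) u"
    by metis
  define T' where "T' = restrict E (carr M)"
  have Rm: "R y \<in> MU" if "y \<in> carr N" for y using is_adj_adj[OF R that] by simp
  have adj: "is_adj M N T' R"
    by (rule is_adjI) (simp_all add: T'_def E Ei Rm MU_carr)
  have eq: "T' m = T m" if m: "m \<in> MU" for m
  proof (rule N.ip_eqI)
    fix w u assume w: "w \<in> carr N"
    have "ip N (T' m) w u = ip N (T m) w u"
      using is_adj_ip[OF adj MU_carr[OF m] w] is_adj_ip[OF R _ w, of m] m by simp
    then have "cnj (ip N (T' m) w u) = cnj (ip N (T m) w u)" by simp
    then show "ip N w (T' m) u = ip N w (T m) u"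
      using w m fadj_mem[OF assms(1), of m] is_adj_fun[OF adj MU_carr[OF m]] by (simp add: N.ip_cnj)
  qed (use m fadj_mem[OF assms(1), of m] is_adj_fun[OF adj MU_carr[OF m]] in simp_all)
  obtain c where c: "fbound QM N c T" using assms(1) by (rule fadjE)
  have "fbound M N c T'"
    unfolding fbound_def
  proof (intro conjI ballI)
    show c0: "0 \<le> c" using c by (simp add: fbound_def)
    fix z assume z: "z \<in> carr M"
    show "hn N (T' z) \<le> c * hn M z"
    proof (rule local_bound[OF is_adj_fun[OF adj] adj_act_local[OF adj] _ c0 z])
      show "hn N (T' m) \<le> c * hn M m" if "m \<in> MU" for m
        using c that unfolding eq[OF that] by (simp add: fbound_def)
    qed
  qed
  then have "T' \<in> fadj M N" using adj by (intro fadjI) (simp_all add: T'_def)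
  then show thesis using eq that by blast
qed

text \<open>On the left the scalars act through \<open>mact N\<close>, on the right through
  \<open>act N\<close>. With right legs in \<open>MU\<close> the scalars belong to C_0(U), where the
  two actions coincide.\<close>

lemma finite_rank_agree:
  assumes ps: "ps \<in> lists (carr N \<times> MU)" and m: "m \<in> MU"
  shows "finite_rank_op M QN ps m = finite_rank_op QM N ps m"
proof (rule N.ip_eqI)
  have ps': "ps \<in> lists (carr N \<times> carr M)" using ps by (auto simp: in_lists_conv_set MU_carr)
  show "finite_rank_op M QN ps m \<in> carr N" 
    using MQ.finite_rank_closed[of m ps] ps' m by (simp add: vanish_N MU_carr)
  show "finite_rank_op QM N ps m \<in> carr N"
    using QN.finite_rank_closed[of m ps] ps m by simp
  show "ip N w (finite_rank_op M QN ps m) u = ip N w (finite_rank_op QM N ps m) u"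
    if "w \<in> carr N" for w u
    using MQ.ip_finite_rank[of m ps w u] QN.ip_finite_rank[of m ps w u] ps ps' m that
    by (simp add: vanish_N MU_carr)
qed

lemma finite_rank_N: "z \<in> carr M \<Longrightarrow> ps \<in> lists (carr N \<times> carr M) \<Longrightarrow> finite_rank_op M QN ps z \<in> carr N"
  using MQ.finite_rank_closed[of z ps] by (simp add: vanish_N)

lemma finite_rank_act_local:
  assumes "z \<in> carr M" and "ps \<in> lists (carr N \<times> carr M)" and "f \<in> van X U"
  shows "finite_rank_op M QN ps (act M z f) = act N (finite_rank_op M QN ps z) f"
  using MQ.finite_rank_act[of z ps f] assms M.C0V mact_N[OF finite_rank_N[OF assms(1,2)] assms(3)]
  by (simp add: vanish_N)

lemma lists_MU: "ps \<in> lists (carr N \<times> MU) \<Longrightarrow> ps \<in> lists (carr N \<times> carr M)"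
  by (auto simp: in_lists_conv_set MU_carr)

lemma act_diff_N:
  assumes "x \<in> carr N" "y \<in> carr N" "f \<in> van X U"
  shows "diff N (act N x f) (act N y f) = act N (diff N x y) f"
  by (rule N.ip_eqI) (use assms in \<open>simp_all add: N.closed N.ip_simps algebra_simps\<close>)

text \<open>Finite-rank approximants of \<open>T\<close> have their right legs in \<open>MU\<close>,
  hence are defined on all of \<open>M\<close>. They stay Cauchy there, and the limit of their
  values at \<open>z\<close> is the vector required by \<open>fadj_extend\<close>.\<close>

lemma fcomp_extend:
  assumes T: "T \<in> fcomp QM N"
  obtains T' where "T' \<in> fadj M N" and "\<And>m. m \<in> MU \<Longrightarrow> T' m = T m"
proof -
  have Ta: "T \<in> fadj QM N" using T fcomp_subset by blast
  then obtain R where R: "is_adj QM N T R" by (rule fadjE)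
  have "\<exists>ps \<in> lists (carr N \<times> MU).
      fbound QM N (inverse (real (Suc n))) (\<lambda>z. diff N (T z) (finite_rank_op QM N ps z))" for n
    using T unfolding fcomp_def by simp
  then obtain ps where ps: "\<And>n. ps n \<in> lists (carr N \<times> MU)"
    and bd: "\<And>n. fbound QM N (inverse (real (Suc n))) (\<lambda>z. diff N (T z) (finite_rank_op QM N (ps n) z))"
    by metis
  note ps' = lists_MU[OF ps]
  let ?K = "\<lambda>n. finite_rank_op M QN (ps n)"
  have close: "hn N (diff N (T m) (?K n m)) \<le> inverse (real (Suc n)) * hn M m" if m: "m \<in> MU" for m n
    using bd[of n] m unfolding fbound_def finite_rank_agree[OF ps m] by simp
  have Tm: "T m \<in> carr N" if "m \<in> MU" for m using fadj_mem[OF Ta, of m] that by simp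
  \<comment> \<open>On the submodule both approximants are close to \<open>T\<close>; their
    difference is a C_0(U)-module map, so \<open>local_bound\<close> carries the same estimate to
    \<open>M\<close>.\<close>
  have cauchy_bd: "hn N (diff N (?K i z) (?K j z))
      \<le> (inverse (real (Suc i)) + inverse (real (Suc j))) * hn M z" if z: "z \<in> carr M" for z i j
  proof (rule local_bound[OF _ _ _ _ z])
    show "diff N (?K i z) (?K j z) \<in> carr N" if "z \<in> carr M" for z
      using that by (simp add: N.closed finite_rank_N ps')
    show "diff N (?K i (act M z f)) (?K j (act M z f)) = act N (diff N (?K i z) (?K j z)) f"
      if "z \<in> carr M" "f \<in> van X U" for z f
      using that by (simp add: finite_rank_act_local ps' act_diff_N finite_rank_N)
    show "hn N (diff N (?K i m) (?K j m))
      \<le> (inverse (real (Suc i)) + inverse (real (Suc j))) * hn M m" if m: "m \<in> MU" for m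
    proof -
      have "hn N (diff N (?K i m) (?K j m))
          \<le> hn N (diff N (?K i m) (T m)) + hn N (diff N (T m) (?K j m))"
        by (rule N.hn_triangle) (simp_all add: finite_rank_N ps' MU_carr m Tm)
      also have "hn N (diff N (?K i m) (T m)) = hn N (diff N (T m) (?K i m))"
        by (rule N.hn_diff_commute) (simp_all add: finite_rank_N ps' MU_carr m Tm)
      finally show ?thesis using close[OF m, of i] close[OF m, of j] by (simp only: distrib_right)
    qed
  qed simp
  show thesis
  proof (rule fadj_extend[OF Ta R _ that])
    fix z assume z: "z \<in> carr M"
    have Kz: "?K n z \<in> carr N" for n by (simp add: finite_rank_N ps' z)
    have "cauchy_seq N (hn N) (\<lambda>n. ?K n z)"
      unfolding cauchy_seq_def
    proof (intro conjI allI impI Kz)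
      fix e :: real assume "e > 0"
      define h where "h = hn M z + 1"
      have h: "h > 0" "hn M z \<le> h" using M.hn_nonneg[OF z] by (simp_all add: h_def)
      obtain k where k: "inverse (real (Suc k)) < e / (2 * h)"
        using reals_Archimedean[of "e / (2 * h)"] \<open>e > 0\<close> h by auto
      have "hn N (diff N (?K i z) (?K j z)) < e" if "i \<ge> k" "j \<ge> k" for i j
      proof -
        have inv: "inverse (real (Suc i)) \<le> inverse (real (Suc k))"
          "inverse (real (Suc j)) \<le> inverse (real (Suc k))"
          using that by (simp_all add: le_imp_inverse_le)
        have "hn N (diff N (?K i z) (?K j z))
            \<le> (inverse (real (Suc i)) + inverse (real (Suc j))) * hn M z"
          by (rule cauchy_bd[OF z])
        also have "\<dots> \<le> (inverse (real (Suc i)) + inverse (real (Suc j))) * h"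
          by (rule mult_left_mono[OF h(2)]) simp
        also have "\<dots> < (e / (2 * h) + e / (2 * h)) * h"
          by (rule mult_strict_right_mono[OF _ h(1)]) (use inv k in linarith)
        also have "\<dots> = e" using h by (simp add: field_simps)
        finally show ?thesis .
      qed
      then show "\<exists>k. \<forall>i\<ge>k. \<forall>j\<ge>k. hn N (diff N (?K i z) (?K j z)) < e" by blast
    qed
    then obtain w where w: "w \<in> carr N" and lim: "(\<lambda>n. hn N (diff N (?K n z) w)) \<longlonglongrightarrow> 0"
      using N.complete unfolding norm_complete_def by blast
    have "ip N w y u = ip M z (R y) u" if y: "y \<in> carr N" for y u
    proof -
      have Ry: "R y \<in> MU" using is_adj_adj[OF R y] by simp
      have "ip N y w u = ip M (R y) z u"
      proof (cases "u \<in> U")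
        case False
        then show ?thesis
          using van_zero_outside[OF N.ip_in[OF y w]] M.ip_vanish(1)[OF Ry z] by simp
      next
        case True
        then obtain f where f: "f \<in> van X U" "f u = 1" "\<And>x. cmod (f x) \<le> 1"
          using M.bump[OF M.U] by metis
        \<comment> \<open>At \<open>u\<close> the vectors \<open>?m\<close> and \<open>z\<close>
          have the same pairings, but \<open>?m\<close> lies in the submodule, where the
          approximants converge to \<open>T\<close>.\<close>
        let ?m = "act M z f"
        have m: "?m \<in> MU" by (rule act_MU[OF z f(1)])
        have "(\<lambda>n. hn N (diff N (?K n ?m) (T ?m))) \<longlonglongrightarrow> 0"
        proof (rule N.hn_LIMSEQ_0)
          fix n
          have Kn: "?K n ?m \<in> carr N" by (simp add: finite_rank_N ps' MU_carr m)
          then show "diff N (?K n ?m) (T ?m) \<in> carr N" by (rule N.diff_closed[OF _ Tm[OF m]])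
          show "hn N (diff N (?K n ?m) (T ?m)) \<le> inverse (real (Suc n)) * hn M ?m"
            using close[OF m, of n] N.hn_diff_commute[OF Kn Tm[OF m]] by simp
        qed (rule tendsto_mult_left_zero[OF LIMSEQ_inverse_real_of_nat])
        then have "(\<lambda>n. ip N y (?K n ?m) u) \<longlonglongrightarrow> ip N y (T ?m) u"
          by (intro N.ip_LIMSEQ) (simp_all add: finite_rank_N ps' MU_carr m Tm y)
        moreover have "ip N y (?K n ?m) u = ip N y (?K n z) u" for n
          using f y by (simp add: finite_rank_act_local z ps' N.ip_act Kz)
        moreover have "(\<lambda>n. ip N y (?K n z) u) \<longlonglongrightarrow> ip N y w u"
          by (rule N.ip_LIMSEQ[OF Kz w y lim])
        ultimately have "ip N y w u = ip N y (T ?m) u"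
          using LIMSEQ_unique by simp
        also have "\<dots> = ip M (R y) ?m u"
          using QN.is_adj_ip_right[OF R, of ?m y u] m y by simp
        also have "\<dots> = ip M (R y) z u"
          using f z by (simp add: M.ip_act MU_carr[OF Ry] M.C0V)
        finally show ?thesis .
      qed
      then have "cnj (ip N y w u) = cnj (ip M (R y) z u)" by simp
      then show ?thesis using w y z by (simp add: N.ip_cnj M.ip_cnj MU_carr[OF Ry])
    qed
    with w show "\<exists>w\<in>carr N. \<forall>y\<in>carr N. \<forall>u. ip N w y u = ip M z (R y) u" by blast
  qed
qed

text \<open>The approximants of the restriction also approximate the extension, with the same error,
  since the difference is a module map to which \<open>local_bound\<close> applies.\<close>

lemma fcomp_of_restrict:
  assumes T': "T' \<in> fadj M N" and T: "T \<in> fcomp QM N" and eq: "\<And>m. m \<in> MU \<Longrightarrow> T' m = T m"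
  shows "T' \<in> fcomp M QN"
  unfolding fcomp_def
proof (intro CollectI conjI allI impI)
  show "T' \<in> fadj M QN" using T' by (simp add: fadj_submod_target[OF vanish_N])
  obtain R where R: "is_adj M N T' R" using T' by (rule fadjE)
  fix \<epsilon> :: real assume "\<epsilon> > 0"
  then obtain ps where ps: "ps \<in> lists (carr N \<times> MU)"
    and bd: "fbound QM N \<epsilon> (\<lambda>z. diff N (T z) (finite_rank_op QM N ps z))"
    using T unfolding fcomp_def by auto
  note ps' = lists_MU[OF ps]
  have "fbound M QN \<epsilon> (\<lambda>z. diff N (T' z) (finite_rank_op M QN ps z))"
    unfolding fbound_def hn_submod
  proof (intro conjI ballI)
    fix z assume z: "z \<in> carr M"
    show "hn N (diff N (T' z) (finite_rank_op M QN ps z)) \<le> \<epsilon> * hn M z"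
    proof (rule local_bound[OF _ _ _ _ z])
      show "diff N (T' z) (finite_rank_op M QN ps z) \<in> carr N" if "z \<in> carr M" for z
        using that by (simp add: N.closed finite_rank_N ps' is_adj_fun[OF R])
      show "diff N (T' (act M z f)) (finite_rank_op M QN ps (act M z f))
          = act N (diff N (T' z) (finite_rank_op M QN ps z)) f"
        if "z \<in> carr M" "f \<in> van X U" for z f
        using that by (simp add: finite_rank_act_local ps' act_diff_N finite_rank_N
            adj_act_local[OF R] is_adj_fun[OF R])
      show "hn N (diff N (T' m) (finite_rank_op M QN ps m)) \<le> \<epsilon> * hn M m" if m: "m \<in> MU" for m
        using bd m unfolding fbound_def eq[OF m] finite_rank_agree[OF ps m] by simp
    qed (use \<open>\<epsilon> > 0\<close> in simp)
  qed (use \<open>\<epsilon> > 0\<close> in simp)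
  then show "\<exists>ps\<in>lists (carr QN \<times> carr M). fbound M QN \<epsilon> (\<lambda>z. diff QN (T' z) (finite_rank_op M QN ps z))"
    using ps' by (auto simp: vanish_N)
qed

lemma finite_rank_Cons:
  assumes "z \<in> carr M"
  shows "finite_rank_op M QN ((y, x) # ps) z = add N (mact N y (ip M x z)) (finite_rank_op M QN ps z)"
  using assms by (simp add: finite_rank_op_def vsum_def)

text \<open>\<open>y \<otimes> x\<^sup>*\<close> is close to \<open>y f \<otimes> x\<^sup>* = y \<otimes> (x f)\<^sup>*\<close> for real \<open>f\<close> in an approximate unit of \<open>C\<^sub>0(U)\<close>.\<close>

lemma finite_rank_approx:
  assumes "ps \<in> lists (carr N \<times> carr M)" and "\<epsilon> > 0"
  shows "\<exists>qs\<in>lists (carr N \<times> MU). \<forall>z\<in>carr M.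
    hn N (diff N (finite_rank_op M QN ps z) (finite_rank_op M QN qs z)) \<le> \<epsilon> * hn M z"
  using assms
proof (induction ps arbitrary: \<epsilon> rule: list.induct)
  case Nil
  have "hn N (diff N (finite_rank_op M QN [] z) (finite_rank_op M QN [] z)) \<le> \<epsilon> * hn M z"
    if z: "z \<in> carr M" for z
    using finite_rank_N[OF z, of "[]"] Nil(2) M.hn_nonneg[OF z] by simp
  then show ?case by blast
next
  case (Cons p ps)
  obtain y x where p: "p = (y, x)" by (cases p)
  have y: "y \<in> carr N" and x: "x \<in> carr M" and ps: "ps \<in> lists (carr N \<times> carr M)"
    using Cons.prems p by auto
  obtain qs where qs: "qs \<in> lists (carr N \<times> MU)" and bd: "\<And>z. z \<in> carr M \<Longrightarrow>
      hn N (diff N (finite_rank_op M QN ps z) (finite_rank_op M QN qs z)) \<le> \<epsilon> / 2 * hn M z"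
    using Cons.IH[OF ps, of "\<epsilon> / 2"] Cons.prems by auto
  \<comment> \<open>Replacing \<open>y\<close> by y f costs at most \<delta> in norm, hence \<delta>
    * \<open>hn M x\<close> in operator norm, which is at most \<epsilon>/2. The 1 keeps the
    denominator positive.\<close>
  define \<delta> where "\<delta> = \<epsilon> / (2 * (hn M x + 1))"
  have hx: "0 \<le> hn M x" by (rule M.hn_nonneg[OF x])
  have \<delta>: "\<delta> > 0" "\<delta> * hn M x \<le> \<epsilon> / 2"
    using Cons.prems(2) hx by (simp_all add: \<delta>_def divide_simps)
  obtain f where f: "f \<in> van X U" "\<And>x. cnj (f x) = f x"
    and yf: "hn N (diff N y (act N y f)) \<le> \<delta>"
    using N.vanish_approx[of y \<delta>] y \<delta>(1) vanish_N by metis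
  have xf: "act M x f \<in> MU" by (rule act_MU[OF x f(1)])
  have qs': "(y, act M x f) # qs \<in> lists (carr N \<times> MU)" using qs y xf by simp
  have "hn N (diff N (finite_rank_op M QN (p # ps) z) (finite_rank_op M QN ((y, act M x f) # qs) z))
      \<le> \<epsilon> * hn M z" if z: "z \<in> carr M" for z
  proof -
    let ?b = "ip M x z" and ?b' = "ip M (act M x f) z"
    let ?A = "diff N (mact N y ?b) (mact N y ?b')"
    let ?C = "diff N (finite_rank_op M QN ps z) (finite_rank_op M QN qs z)"
    have b: "?b \<in> cont_funs X" "?b' \<in> cont_funs X"
      using van_cont[OF M.ip_in] x z MU_carr[OF xf] by simp_all
    have mN: "mact N y ?b \<in> carr N" "mact N y ?b' \<in> carr N"
      using N.mact_MU(1)[of y] y b by (simp_all add: vanish_N)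
    have mi: "ip N w (mact N y c) u = ip N w y u * c u" if "w \<in> carr N" "c \<in> cont_funs X" for w c u
      using N.mact_MU(2)[of y c w u] y that by (simp add: vanish_N)
    have frN: "finite_rank_op M QN ps z \<in> carr N" "finite_rank_op M QN qs z \<in> carr N"
      using finite_rank_N z ps lists_MU[OF qs] by simp_all
    have yfN: "act N y f \<in> carr N" using y f by (simp add: N.closed)
    have d0: "diff N y (act N y f) \<in> carr N" using y f by (simp add: N.closed)
    have "hn N ?A \<le> \<delta> * hn M x * hn M z"
    proof (rule hn_le)
      show "0 \<le> \<delta> * hn M x * hn M z" using \<delta>(1) hx M.hn_nonneg[OF z] by simp
      fix u
      have b': "?b' v = f v * ?b v" for v using x z f by (simp add: M.ip_simps M.C0V)
      have "pn N u ?A = cmod (?b u) * pn N u (diff N y (act N y f))"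
        by (rule N.pn_weak_act[of y "act N y f" _ _ ?b])
          (simp_all add: y yfN mN mi b b' N.ip_act f(1))
      also have "\<dots> \<le> (hn M x * hn M z) * \<delta>"
        using M.Cauchy_Schwarz_hn[OF x z, of u] N.pn_le_hn[OF d0, of u] yf hx M.hn_nonneg[OF z]
        by (intro mult_mono) simp_all
      finally show "pn N u ?A \<le> \<delta> * hn M x * hn M z" by (simp add: mult_ac)
    qed
    also have "\<dots> \<le> \<epsilon> / 2 * hn M z"
      by (rule mult_right_mono[OF \<delta>(2) M.hn_nonneg[OF z]])
    finally have A: "hn N ?A \<le> \<epsilon> / 2 * hn M z" .
    have "diff N (finite_rank_op M QN (p # ps) z) (finite_rank_op M QN ((y, act M x f) # qs) z)
        = add N ?A ?C"
      unfolding p finite_rank_Cons[OF z]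
      by (rule N.ip_eqI) (use mN frN in \<open>simp_all add: N.closed N.ip_simps\<close>)
    then have "hn N (diff N (finite_rank_op M QN (p # ps) z)
        (finite_rank_op M QN ((y, act M x f) # qs) z)) \<le> hn N ?A + hn N ?C"
      using N.hn_add[of ?A ?C] mN frN by (simp add: N.closed)
    with A bd[OF z] show ?thesis by simp
  qed
  with qs' show ?case by blast
qed

text \<open>Approximants on \<open>M\<close> may have right legs outside the submodule. Half of
  \<epsilon> is spent on approximating \<open>T\<close>, the other half on moving the right legs
  into \<open>MU\<close>.\<close>

lemma fcomp_restrict:
  assumes "T \<in> fcomp M QN"
  shows "restrict T MU \<in> fcomp QM N"
  unfolding fcomp_def
proof (intro CollectI conjI allI impI)
  have Ta: "T \<in> fadj M N"
    using assms fcomp_subset[of M QN] by (auto simp: fadj_submod_target[OF vanish_N])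
  then show "restrict T MU \<in> fadj QM N" by (rule fadj_restrict)
  fix \<epsilon> :: real assume e: "\<epsilon> > 0"
  have "\<exists>ps\<in>lists (carr QN \<times> carr M).
      fbound M QN (\<epsilon> / 2) (\<lambda>z. diff QN (T z) (finite_rank_op M QN ps z))"
    using assms half_gt_zero[OF e] unfolding fcomp_def by blast
  then obtain ps where ps: "ps \<in> lists (carr N \<times> carr M)"
    and bd: "fbound M QN (\<epsilon> / 2) (\<lambda>z. diff N (T z) (finite_rank_op M QN ps z))"
    by (auto simp: vanish_N)
  obtain qs where qs: "qs \<in> lists (carr N \<times> MU)" and bd2: "\<And>z. z \<in> carr M \<Longrightarrow>
      hn N (diff N (finite_rank_op M QN ps z) (finite_rank_op M QN qs z)) \<le> \<epsilon> / 2 * hn M z"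
    using finite_rank_approx[OF ps half_gt_zero[OF e]] by blast
  have "fbound QM N \<epsilon> (\<lambda>z. diff N (restrict T MU z) (finite_rank_op QM N qs z))"
    unfolding fbound_def
  proof (intro conjI ballI)
    fix m assume "m \<in> carr QM"
    then have m: "m \<in> MU" and mc: "m \<in> carr M" by (simp_all add: MU_carr)
    have "hn N (diff N (T m) (finite_rank_op M QN qs m))
        \<le> hn N (diff N (T m) (finite_rank_op M QN ps m))
          + hn N (diff N (finite_rank_op M QN ps m) (finite_rank_op M QN qs m))"
      by (rule N.hn_triangle) (use mc ps lists_MU[OF qs] fadj_mem[OF Ta] in \<open>simp_all add: finite_rank_N\<close>)
    also have "\<dots> \<le> \<epsilon> / 2 * hn M m + \<epsilon> / 2 * hn M m"
      using bd bd2[OF mc] mc unfolding fbound_def by (intro add_mono) simp_all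
    finally have "hn N (diff N (T m) (finite_rank_op M QN qs m)) \<le> \<epsilon> * hn M m" by simp
    then show "hn N (diff N (restrict T MU m) (finite_rank_op QM N qs m)) \<le> \<epsilon> * hn QM m"
      using m by (simp add: finite_rank_agree[OF qs m])
  qed (use e in simp)
  then show "\<exists>ps\<in>lists (carr N \<times> carr QM).
      fbound QM N \<epsilon> (\<lambda>z. diff N (restrict T MU z) (finite_rank_op QM N ps z))"
    using qs by auto
qed

lemma fadj_extend_clopen:
  assumes cl: "closedin X U" and T: "T \<in> fadj QM N"
  obtains T' where "T' \<in> fadj M N" and "\<And>m. m \<in> MU \<Longrightarrow> T' m = T m"
proof -
  obtain R where R: "is_adj QM N T R" using T by (rule fadjE)
  \<comment> \<open>The indicator of \<open>U\<close> is continuous because \<open>U\<close> and its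
    complement are open. The adjoint \<open>R\<close> has values in the submodule, so multiplying
    \<open>z\<close> by \<open>e\<close> does not affect its pairings with them.\<close>
  define e :: "'x \<Rightarrow> complex" where "e = (\<lambda>x. if x \<in> U then 1 else 0)"
  have "continuous_map X euclidean e"
    unfolding continuous_map openin_subtopology
  proof (intro conjI allI impI)
    fix W :: "complex set"
    have c: "openin X (topspace X - U)" using cl by blast
    have "{x \<in> topspace X. e x \<in> W} = (if 1 \<in> W then U else {}) \<union> (if 0 \<in> W then topspace X - U else {})"
      using U_sub by (auto simp: e_def)
    then show "openin X {x \<in> topspace X. e x \<in> W}" using c M.U by auto
  qed simp
  then have e: "e \<in> van X U" using U_sub by (intro vanI) (auto simp: e_def)
  show thesis
  proof (rule fadj_extend[OF T R _ that])
    fix z assume z: "z \<in> carr M"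
    have m: "act M z e \<in> MU" by (rule act_MU[OF z e])
    have "ip N (T (act M z e)) y u = ip M z (R y) u" if y: "y \<in> carr N" for y u
    proof -
      have Ry: "R y \<in> MU" using is_adj_adj[OF R y] by simp
      have "ip N (T (act M z e)) y u = ip M (act M z e) (R y) u"
        using is_adj_ip[OF R _ y, of "act M z e" u] m by simp
      also have "\<dots> = ip M z (R y) u"
        using M.ip_vanish(2)[OF Ry z, of u] z e
        by (cases "u \<in> U") (simp_all add: M.ip_act_left MU_carr[OF Ry] M.C0V e_def)
      finally show ?thesis .
    qed
    moreover have "T (act M z e) \<in> carr N" using fadj_mem[OF T, of "act M z e"] m by simp
    ultimately show "\<exists>w\<in>carr N. \<forall>y\<in>carr N. \<forall>u. ip N w y u = ip M z (R y) u" by blast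
  qed
qed

end

section \<open>The adjunctions\<close>

locale tensored_pair = M: tensored X V M U W + N: tensored X V N U W
  for X :: "'x topology" and V :: "'x set"
    and M :: "('x \<Rightarrow> complex, 'm, 'y) hmod_scheme" and N :: "('x \<Rightarrow> complex, 'n, 'z) hmod_scheme"
    and U W :: "'x set"
begin

sublocale MN: fmod_pair "van X V" M N
  by (intro fmod_pair.intro M.fmod_axioms N.fmod_axioms)

lemma adj_vanish:
  assumes t: "is_adj M N t R" and m: "m \<in> vanish U M"
  shows "t m \<in> vanish U N"
proof (rule vanishI)
  show "t m \<in> carr N" by (rule is_adj_fun[OF t vanish_carr[OF m]])
  show "pn N u (t m) = 0" if "u \<notin> U" for u
    by (rule MN.adj_pn_eq_0[OF t vanish_carr[OF m] vanish_pn[OF m that]])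
qed

lemma map_L:
  assumes t: "is_adj M N t R" and xs: "xs \<in> lists (carr M \<times> van X U)"
  shows "map (\<lambda>(m, f). (t m, f)) xs \<in> lists (carr N \<times> van X U)"
  using xs is_adj_fun[OF t] by (auto simp: in_lists_conv_set)

lemma ev_map:
  assumes t: "is_adj M N t R" and xs: "xs \<in> lists (carr M \<times> van X U)"
  shows "ev N (map (\<lambda>(m, f). (t m, f)) xs) = t (ev M xs)"
proof (rule N.ip_eqI)
  note L = map_L[OF t xs]
  show "ev N (map (\<lambda>(m, f). (t m, f)) xs) \<in> carr N" by (rule N.ev_closed[OF L])
  show "t (ev M xs) \<in> carr N" by (rule is_adj_fun[OF t M.ev_closed[OF xs]])
  fix w u assume w: "w \<in> carr N"
  have "(\<Sum>(m, f)\<leftarrow>map (\<lambda>(m, f). (t m, f)) xs. ip N w m u * f u)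
      = (\<Sum>(m, f)\<leftarrow>xs. ip M (R w) m u * f u)"
    using xs w by (induction xs) (auto simp: MN.is_adj_ip_right[OF t])
  then show "ip N w (ev N (map (\<lambda>(m, f). (t m, f)) xs)) u = ip N w (t (ev M xs)) u"
    using N.ip_ev[OF L w, of u] M.ip_ev[OF xs is_adj_adj[OF t w], of u]
      MN.is_adj_ip_right[OF t M.ev_closed[OF xs] w, of u] by simp
qed

text \<open>Since \<open>t\<close> is C_0(U)-linear, evaluation intertwines
  \<open>t \<otimes> 1\<close> with \<open>t\<close> (\<open>ev_map\<close>), and boundedness of
  \<open>t\<close> passes this to limits. Under the identifications \<open>t \<otimes> 1\<close> is
  thus \<open>t\<close> restricted to the submodule.\<close>

lemma tensor_map_cls:
  assumes t: "t \<in> fadj M N" and m: "m \<in> vanish U M"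
  shows "tensor_map (function_alg (van X W)) M N (C0_corr (subtopology X U)) t (tcls X U M m)
    = tcls X U N (t m)"
proof -
  obtain R c where R: "is_adj M N t R" and c: "fbound M N c t" using t by (rule fadjE)
  let ?s = "\<lambda>n. map (\<lambda>(m, f). (t m, f)) (rep (tcls X U M m) n)"
  have "cauchy_class (function_alg (van X W)) N.P ?s = tcls X U N (t m)"
  proof (rule N.cauchy_class_eq)
    show "?s n \<in> N.L" for n by (rule map_L[OF R M.rep_L[OF m]])
    show tm: "t m \<in> carr N" by (rule is_adj_fun[OF R vanish_carr[OF m]])
    show "(\<lambda>n. hn N (diff N (ev N (?s n)) (t m))) \<longlonglongrightarrow> 0"
    proof (rule N.hn_LIMSEQ_0)
      fix n
      let ?d = "diff M (ev M (rep (tcls X U M m) n)) m"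
      have d: "?d \<in> carr M"
        by (rule M.diff_closed[OF M.ev_closed[OF M.rep_L[OF m]] vanish_carr[OF m]])
      have eq: "diff N (ev N (?s n)) (t m) = t ?d"
        by (simp only: ev_map[OF R M.rep_L[OF m]]
            MN.adj_diff[OF R M.ev_closed[OF M.rep_L[OF m]] vanish_carr[OF m]])
      show "diff N (ev N (?s n)) (t m) \<in> carr N" unfolding eq by (rule is_adj_fun[OF R d])
      show "hn N (diff N (ev N (?s n)) (t m)) \<le> c * hn M ?d"
        unfolding eq using c d by (simp add: fbound_def)
    qed (rule tendsto_mult_right_zero[OF M.rep_lim[OF m]])
  qed
  then show ?thesis using m by (simp add: tensor_map_def M.carr_T)
qed

lemma fadj_restrict_submod:
  assumes "t \<in> fadj M N"
  shows "restrict t (vanish U M) \<in> fadj (submod U M) (submod U N)"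
proof -
  interpret NM: tensored_pair X V N M U W by unfold_locales
  obtain R c where R: "is_adj M N t R" and c: "fbound M N c t" using assms by (rule fadjE)
  show ?thesis
  proof (rule fadjI)
    show "is_adj (submod U M) (submod U N) (restrict t (vanish U M)) R"
      by (rule is_adjI) (simp_all add: adj_vanish[OF R] NM.adj_vanish[OF MN.is_adj_sym[OF R]]
          is_adj_ip[OF R] vanish_carr)
    show "fbound (submod U M) (submod U N) c (restrict t (vanish U M))"
      using c by (simp add: fbound_def vanish_carr)
  qed simp
qed

text \<open>The operator is a composite of two unitary identifications with the restriction of
  \<open>t\<close> to the submodules, each of which is adjointable.\<close>

lemma tensor_map_fadj:
  assumes t: "t \<in> fadj M N"
  shows "tensor_map (function_alg (van X W)) M N (C0_corr (subtopology X U)) t \<in> fadj M.T N.T"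
proof -
  let ?inv = "restrict (the_inv_into (vanish U M) (tcls X U M)) (carr M.T)"
  let ?t = "compose (carr (submod U M)) (restrict (tcls X U N) (vanish U N)) (restrict t (vanish U M))"
  obtain R where R: "is_adj M N t R" using t by (rule fadjE)
  have "compose (carr M.T) ?t ?inv \<in> fadj M.T N.T"
    by (intro fadj_compose[OF M.inv_cls_fadj] fadj_compose[OF fadj_restrict_submod[OF t] N.cls_fadj])
  moreover have "compose (carr M.T) ?t ?inv
      = tensor_map (function_alg (van X W)) M N (C0_corr (subtopology X U)) t"
  proof (rule extensionalityI[of _ "carr M.T"])
    fix c assume "c \<in> carr M.T"
    then obtain m where m: "m \<in> vanish U M" "c = tcls X U M m" by (auto simp: M.carr_T)
    then show "compose (carr M.T) ?t ?inv c
        = tensor_map (function_alg (van X W)) M N (C0_corr (subtopology X U)) t c"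
      by (simp add: compose_def M.carr_T M.inv_cls tensor_map_cls[OF t] adj_vanish[OF R])
  qed (simp_all add: tensor_map_def compose_extensional)
  ultimately show ?thesis by simp
qed

end

text \<open>
  Identifying \<open>M \<otimes> F\<close> with the submodule of \<open>M\<close> vanishing off \<open>U\<close>, and \<open>N \<otimes> E\<close> with \<open>N\<close>, the
  operator corresponding to \<open>T\<close> is its extension to all of \<open>M\<close>.
\<close>

definition hom_ext :: "'x topology \<Rightarrow> 'x set \<Rightarrow> ('x \<Rightarrow> complex, 'm, 'y) hmod_scheme
    \<Rightarrow> ('x \<Rightarrow> complex, 'n, 'z) hmod_scheme
    \<Rightarrow> ((nat \<Rightarrow> ('m \<times> ('x \<Rightarrow> complex)) list) set \<Rightarrow> 'n)
    \<Rightarrow> 'm \<Rightarrow> (nat \<Rightarrow> ('n \<times> ('x \<Rightarrow> complex)) list) set" where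
  "hom_ext X U M N T = (THE T'.
     T' \<in> fadj M (tensor (function_alg (van X (topspace X))) N (C0_corr (subtopology X U))) \<and>
     (\<forall>m\<in>vanish U M. T' m = tcls X U N (T (tcls X U M m))))"

section \<open>The correspondence between operators on the two sides\<close>

context module_pair
begin

abbreviation TM where "TM \<equiv> M.T"
abbreviation TN where "TN \<equiv> N.T"
abbreviation clsM where "clsM \<equiv> tcls X U M"
abbreviation clsN where "clsN \<equiv> tcls X U N"
abbreviation thM where "thM \<equiv> restrict clsM MU"
abbreviation thN where "thN \<equiv> restrict clsN (carr N)"
abbreviation unM where "unM \<equiv> restrict (the_inv_into MU clsM) (carr TM)"
abbreviation unN where "unN \<equiv> restrict (the_inv_into (carr N) clsN) (carr TN)"

lemma carr_TN: "carr TN = clsN ` carr N"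
  using N.carr_T by (simp add: vanish_N)

lemma th_mem: "m \<in> MU \<Longrightarrow> clsM m \<in> carr TM" "n \<in> carr N \<Longrightarrow> clsN n \<in> carr TN"
  by (simp_all add: M.carr_T carr_TN)

lemma unM_cls: "m \<in> MU \<Longrightarrow> unM (clsM m) = m"
  using M.inv_cls[of m] th_mem(1)[of m] by simp

lemma unN_cls: "n \<in> carr N \<Longrightarrow> unN (clsN n) = n"
  using N.inv_cls[of n] th_mem(2)[of n] by (simp add: vanish_N)

lemma cls_unN: "c \<in> carr TN \<Longrightarrow> clsN (unN c) = c"
  and unN_mem: "c \<in> carr TN \<Longrightarrow> unN c \<in> carr N"
proof -
  assume "c \<in> carr TN"
  then obtain n where n: "n \<in> carr N" "c = clsN n" unfolding carr_TN by blast
  from unN_cls[OF n(1)] n show "clsN (unN c) = c" "unN c \<in> carr N" by simp_all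
qed

lemma thM_fadj: "thM \<in> fadj QM TM"
  by (rule M.cls_fadj)

lemma unM_fadj: "unM \<in> fadj TM QM"
  by (rule M.inv_cls_fadj)

lemma thN_fadj: "thN \<in> fadj QN TN"
  using N.cls_fadj by (simp only: vanish_N)

lemma unN_fadj: "unN \<in> fadj TN QN"
  using N.inv_cls_fadj by (simp only: vanish_N)

text \<open>The operator T' extends T after the identifications. As a relation it separates
  uniqueness, which always holds in both directions, from existence of extensions, which depends on
  compactness or on closedness of \<open>U\<close>.\<close>

definition rel where "rel T' T \<longleftrightarrow> (\<forall>m\<in>MU. T' m = clsN (T (clsM m)))"

lemma rel_unique:
  assumes "T1 \<in> fadj M TN" "T2 \<in> fadj M TN" "rel T1 T" "rel T2 T"
  shows "T1 = T2"
proof -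
  have "compose (carr M) unN T1 = compose (carr M) unN T2"
  proof (rule fadj_eqI)
    show "compose (carr M) unN T1 \<in> fadj M N" "compose (carr M) unN T2 \<in> fadj M N"
      using fadj_compose[OF assms(1) unN_fadj] fadj_compose[OF assms(2) unN_fadj]
      by (simp_all add: fadj_submod_target[OF vanish_N])
    show "compose (carr M) unN T1 m = compose (carr M) unN T2 m" if "m \<in> MU" for m
      using assms(3,4) that by (simp add: compose_def MU_carr rel_def)
  qed
  note eq = fun_cong[OF this]
  show ?thesis
  proof (rule extensionalityI[OF fadj_ext[OF assms(1)] fadj_ext[OF assms(2)]])
    fix z assume z: "z \<in> carr M"
    have "unN (T1 z) = unN (T2 z)" using eq[of z] by (simp only: compose_eq[OF z])
    then have "clsN (unN (T1 z)) = clsN (unN (T2 z))" by (rule arg_cong)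
    then show "T1 z = T2 z"
      by (simp only: cls_unN[OF fadj_mem[OF assms(1) z]] cls_unN[OF fadj_mem[OF assms(2) z]])
  qed
qed

lemma rel_unique_right:
  assumes "T1 \<in> fadj TM N" "T2 \<in> fadj TM N" "rel T' T1" "rel T' T2"
  shows "T1 = T2"
proof (rule extensionalityI[OF fadj_ext[OF assms(1)] fadj_ext[OF assms(2)]])
  fix c assume c: "c \<in> carr TM"
  then obtain m where m: "m \<in> MU" "c = clsM m" by (auto simp: M.carr_T)
  have "clsN (T1 c) = clsN (T2 c)"
    using assms(3,4) m(1) unfolding rel_def m(2) by simp
  then have "unN (clsN (T1 c)) = unN (clsN (T2 c))" by (rule arg_cong)
  then show "T1 c = T2 c"
    by (simp only: unN_cls[OF fadj_mem[OF assms(1) c]] unN_cls[OF fadj_mem[OF assms(2) c]])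
qed

lemma hom_ext_eqI:
  assumes "T' \<in> fadj M TN" and "rel T' T"
  shows "hom_ext X U M N T = T'"
  unfolding hom_ext_def
proof (rule the_equality)
  show "T' \<in> fadj M TN \<and> (\<forall>m\<in>MU. T' m = clsN (T (clsM m)))"
    using assms by (simp only: rel_def simp_thms)
  show "T'' = T'" if "T'' \<in> fadj M TN \<and> (\<forall>m\<in>MU. T'' m = clsN (T (clsM m)))" for T''
    by (rule rel_unique[OF _ assms(1) _ assms(2)]) (use that in \<open>simp_all add: rel_def del: ball_simps\<close>)
qed

text \<open>Undo the identification of \<open>N\<close>, restrict to \<open>MU\<close>, and
  precompose with the identification of M \<otimes> F. Compositions with adjointable operators and
  \<open>fcomp_restrict\<close> preserve compactness along the way.\<close>

lemma rel_restrict: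
  assumes "T' \<in> fadj M TN"
  obtains T where "T \<in> fadj TM N" and "rel T' T" and "T' \<in> fcomp M TN \<Longrightarrow> T \<in> fcomp TM N"
proof
  let ?T2 = "compose (carr M) unN T'"
  let ?T = "compose (carr TM) (restrict ?T2 MU) unM"
  have T2: "?T2 \<in> fadj M N"
    using fadj_compose[OF assms unN_fadj] by (simp add: fadj_submod_target[OF vanish_N])
  show "?T \<in> fadj TM N"
    by (rule fadj_compose[OF unM_fadj fadj_restrict[OF T2]])
  show "rel T' ?T"
    unfolding rel_def
  proof
    fix m assume m: "m \<in> MU"
    have "?T (clsM m) = unN (T' m)"
      using unM_cls[OF m] th_mem(1)[OF m] m by (simp add: compose_def MU_carr)
    then show "T' m = clsN (?T (clsM m))"
      using cls_unN[OF fadj_mem[OF assms MU_carr[OF m]]] by simp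
  qed
  assume "T' \<in> fcomp M TN"
  then have "?T2 \<in> fcomp M QN"
    by (rule fcomp_compose_left[OF M.fmod_axioms N.fmod_T N.fmod_submod _ unN_fadj])
  then have "restrict ?T2 MU \<in> fcomp QM N" by (rule fcomp_restrict)
  then show "?T \<in> fcomp TM N"
    by (rule fcomp_compose_right[OF M.fmod_T M.fmod_submod N.fmod_axioms _ unM_fadj])
qed

lemma rel_of_extension:
  assumes "T2 \<in> fadj M N" and "\<And>m. m \<in> MU \<Longrightarrow> T2 m = compose (carr QM) T thM m"
  shows "compose (carr M) thN T2 \<in> fadj M TN" and "rel (compose (carr M) thN T2) T"
proof -
  show "compose (carr M) thN T2 \<in> fadj M TN"
    using fadj_compose[OF _ thN_fadj] assms(1) by (simp add: fadj_submod_target[OF vanish_N])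
  show "rel (compose (carr M) thN T2) T"
    unfolding rel_def
  proof
    fix m assume m: "m \<in> MU"
    have "T2 m \<in> carr N" by (rule fadj_mem[OF assms(1) MU_carr[OF m]])
    then show "compose (carr M) thN T2 m = clsN (T (clsM m))"
      using assms(2)[OF m] m by (simp add: compose_def MU_carr)
  qed
qed

lemma rel_extend_compact:
  assumes "T \<in> fcomp TM N"
  obtains T' where "T' \<in> fcomp M TN" and "rel T' T"
proof -
  let ?T1 = "compose (carr QM) T thM"
  have T1: "?T1 \<in> fcomp QM N"
    by (rule fcomp_compose_right[OF M.fmod_submod M.fmod_T N.fmod_axioms assms thM_fadj])
  then obtain T2 where T2: "T2 \<in> fadj M N" "\<And>m. m \<in> MU \<Longrightarrow> T2 m = ?T1 m"
    using fcomp_extend by metis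
  have "T2 \<in> fcomp M QN" by (rule fcomp_of_restrict[OF T2(1) T1 T2(2)])
  then have "compose (carr M) thN T2 \<in> fcomp M TN"
    by (rule fcomp_compose_left[OF M.fmod_axioms N.fmod_submod N.fmod_T _ thN_fadj])
  with rel_of_extension(2)[OF T2] that show thesis by blast
qed

lemma rel_extend_clopen:
  assumes "closedin X U" and "T \<in> fadj TM N"
  obtains T' where "T' \<in> fadj M TN" and "rel T' T"
proof -
  let ?T1 = "compose (carr QM) T thM"
  have T1: "?T1 \<in> fadj QM N" by (rule fadj_compose[OF thM_fadj assms(2)])
  then obtain T2 where T2: "T2 \<in> fadj M N" "\<And>m. m \<in> MU \<Longrightarrow> T2 m = ?T1 m"
    using fadj_extend_clopen[OF assms(1)] by metis
  show thesis by (rule that[OF rel_of_extension[OF T2]])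
qed

text \<open>The correspondence is isometric: a bound passes to the restriction trivially and to the
  extension by \<open>local_bound\<close>. Both continuity constants of the local adjunction can
  therefore be 1.\<close>

lemma rel_fbound:
  assumes "T \<in> fadj TM N" and T': "T' \<in> fadj M TN" and rel: "rel T' T"
  shows "fbound TM N c T \<longleftrightarrow> fbound M TN c T'"
proof
  have hnN: "hn TN (clsN n) = hn N n" if "n \<in> carr N" for n
    using N.hn_T that by (simp add: vanish_N)
  have Tm: "T (clsM m) \<in> carr N" if "m \<in> MU" for m
    by (rule fadj_mem[OF assms(1) th_mem(1)[OF that]])
  {
    assume b: "fbound M TN c T'"
    show "fbound TM N c T"
      unfolding fbound_def
    proof (intro conjI ballI)
      show "0 \<le> c" using b by (simp add: fbound_def)
      fix x assume "x \<in> carr TM"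
      then obtain m where m: "m \<in> MU" "x = clsM m" by (auto simp: M.carr_T)
      have "hn N (T x) = hn TN (T' m)"
        using rel m hnN[OF Tm[OF m(1)]] by (simp add: rel_def)
      also have "\<dots> \<le> c * hn M m" using b MU_carr[OF m(1)] by (simp add: fbound_def)
      finally show "hn N (T x) \<le> c * hn TM x" using m by (simp add: M.hn_T)
    qed
  }
  {
    assume b: "fbound TM N c T"
    let ?T2 = "compose (carr M) unN T'"
    have T2: "?T2 \<in> fadj M N"
      using fadj_compose[OF T' unN_fadj] by (simp add: fadj_submod_target[OF vanish_N])
    obtain R where R: "is_adj M N ?T2 R" using T2 by (rule fadjE)
    show "fbound M TN c T'"
      unfolding fbound_def
    proof (intro conjI ballI)
      show c0: "0 \<le> c" using b by (simp add: fbound_def)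
      fix z assume z: "z \<in> carr M"
      have "hn N (?T2 z) \<le> c * hn M z"
      proof (rule local_bound[OF is_adj_fun[OF R] adj_act_local[OF R] _ c0 z])
        fix m assume m: "m \<in> MU"
        have "?T2 m = T (clsM m)"
        proof -
          have "?T2 m = unN (clsN (T (clsM m)))"
            using rel m by (simp only: compose_def MU_carr rel_def restrict_apply if_True)
          then show ?thesis by (simp only: unN_cls[OF Tm[OF m]])
        qed
        then have "hn N (?T2 m) \<le> c * hn TM (clsM m)"
          using b th_mem(1)[OF m] by (simp add: fbound_def)
        then show "hn N (?T2 m) \<le> c * hn M m" using m by (simp add: M.hn_T)
      qed
      moreover have "hn TN (T' z) = hn N (?T2 z)"
        using hnN[OF unN_mem[OF fadj_mem[OF T' z]]] cls_unN[OF fadj_mem[OF T' z]] z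
        by (simp add: compose_def)
      ultimately show "hn TN (T' z) \<le> c * hn M z" by simp
    qed
  }
qed

text \<open>By uniqueness on both sides of \<open>rel\<close>, a bijection only needs partners to
  exist within \<open>D\<close> and \<open>D'\<close>. The sets are left open so that compact and
  arbitrary adjointable operators are handled together.\<close>

lemma hom_ext_bij_betw:
  assumes D: "D \<subseteq> fadj TM N" and D': "D' \<subseteq> fadj M TN"
    and extend: "\<And>T. T \<in> D \<Longrightarrow> \<exists>T'\<in>D'. rel T' T"
    and restrict: "\<And>T'. T' \<in> D' \<Longrightarrow> \<exists>T\<in>D. rel T' T"
  shows "bij_betw (hom_ext X U M N) D D'"
proof -
  have ext: "hom_ext X U M N T \<in> D' \<and> rel (hom_ext X U M N T) T" if "T \<in> D" for T
  proof -
    from extend[OF that] obtain T' where "T' \<in> D'" "rel T' T" by blast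
    with hom_ext_eqI[of T' T] D' show ?thesis by auto
  qed
  have "inj_on (hom_ext X U M N) D"
  proof (rule inj_onI)
    fix T1 T2 assume T: "T1 \<in> D" "T2 \<in> D" "hom_ext X U M N T1 = hom_ext X U M N T2"
    then have "rel (hom_ext X U M N T1) T1" "rel (hom_ext X U M N T1) T2"
      using ext[of T1] ext[of T2] by auto
    with T D show "T1 = T2" using rel_unique_right[of T1 T2] by blast
  qed
  moreover have "hom_ext X U M N ` D = D'"
  proof (intro equalityI subsetI)
    fix T' assume T': "T' \<in> D'"
    from restrict[OF this] obtain T where T: "T \<in> D" "rel T' T" by blast
    then have "hom_ext X U M N T = T'" using hom_ext_eqI[of T' T] T' D' by auto
    with T show "T' \<in> hom_ext X U M N ` D" by blast
  qed (use ext in auto)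
  ultimately show ?thesis by (simp add: bij_betw_def)
qed

lemma hom_ext_op_add:
  assumes S: "S \<in> fadj TM N" "S' \<in> fadj M TN" "rel S' S"
    and T: "T \<in> fadj TM N" "T' \<in> fadj M TN" "rel T' T"
  shows "hom_ext X U M N (op_add TM N S T) = op_add M TN S' T'"
proof (rule hom_ext_eqI)
  interpret MT: fmod_pair "van X (topspace X)" M TN
    by (intro fmod_pair.intro M.fmod_axioms N.fmod_T)
  show "op_add M TN S' T' \<in> fadj M TN" by (rule MT.op_add_fadj[OF S(2) T(2)])
  show "rel (op_add M TN S' T') (op_add TM N S T)"
    unfolding rel_def
  proof
    fix m assume m: "m \<in> MU"
    have "S (clsM m) \<in> carr N" "T (clsM m) \<in> carr N"
      using fadj_mem[OF S(1)] fadj_mem[OF T(1)] th_mem(1)[OF m] by auto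
    then show "op_add M TN S' T' m = clsN (op_add TM N S T (clsM m))"
      using S(3) T(3) m th_mem(1)[OF m] MU_carr[OF m]
      by (simp add: op_add_def rel_def N.add_T vanish_N)
  qed
qed

lemma hom_ext_op_scl:
  assumes T: "T \<in> fadj TM N" "T' \<in> fadj M TN" "rel T' T"
  shows "hom_ext X U M N (op_scl TM N r T) = op_scl M TN r T'"
proof (rule hom_ext_eqI)
  interpret MT: fmod_pair "van X (topspace X)" M TN
    by (intro fmod_pair.intro M.fmod_axioms N.fmod_T)
  show "op_scl M TN r T' \<in> fadj M TN" by (rule MT.op_scl_fadj[OF T(2)])
  show "rel (op_scl M TN r T') (op_scl TM N r T)"
    unfolding rel_def
  proof
    fix m assume m: "m \<in> MU"
    have "T (clsM m) \<in> carr N"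
      using fadj_mem[OF T(1)] th_mem(1)[OF m] by auto
    then show "op_scl M TN r T' m = clsN (op_scl TM N r T (clsM m))"
      using T(3) m th_mem(1)[OF m] MU_carr[OF m]
      by (simp add: op_scl_def rel_def N.scl_T vanish_N)
  qed
qed

end

section \<open>The local adjunction, and the adjunction for clopen U\<close>

context compact_Hausdorff
begin

lemma tensored_hilbert_module:
  assumes "hilbert_module (function_alg (van X V)) M" and "openin X U" "U \<subseteq> V" "U \<subseteq> W"
  shows "tensored X V M U W"
proof -
  interpret H: hilbert_module "function_alg (van X V)" M by fact
  have "norm_complete M (hn M)" using H.module_complete by simp
  then show ?thesis
    using fmod_hilbert_module[OF assms(1)] compact_Hausdorff_axioms assms(2-)
    by (intro tensored.intro tensored_axioms.intro)
qed

lemma module_pair_hilbert_module: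
  assumes "openin X U" and "hilbert_module (function_alg (van X (topspace X))) M"
    and "hilbert_module (function_alg (van X U)) N"
  shows "module_pair X U M N"
  using assms openin_subset[OF assms(1)]
  by (intro module_pair.intro tensored_hilbert_module) auto

text \<open>An operator out of M' into the tensor product is determined by its values on the
  submodule, and there \<open>tensor_map\<close> acts through \<open>s\<close> and \<open>t\<close>.
  Hence it suffices to follow a vector vanishing off \<open>U\<close> around the square.\<close>

lemma hom_ext_natural:
  assumes U: "openin X U"
    and A: "A = function_alg (van X (topspace X))" and B: "B = function_alg (van X U)"
    and D: "\<And>M N. \<lbrakk>hilbert_module A M; hilbert_module B N\<rbrakk> \<Longrightarrow> D M N \<subseteq> fadj (tensor B M (C0_corr (subtopology X U))) N"
    and extend: "\<And>M N T. \<lbrakk>hilbert_module A M; hilbert_module B N; T \<in> D M N\<rbrakk>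
      \<Longrightarrow> \<exists>T'\<in>fadj M (tensor A N (C0_corr (subtopology X U))). module_pair.rel X U M N T' T"
  shows "natural_hom_map A B (C0_corr (subtopology X U)) (C0_corr (subtopology X U)) D (hom_ext X U)"
  unfolding natural_hom_map_def
proof (intro allI impI, elim conjE)
  fix M M' N N' s t T
  assume M: "hilbert_module A M" and M': "hilbert_module A M'" and N: "hilbert_module B N"
    and N': "hilbert_module B N'" and s: "s \<in> adjointable_ops A M' M"
    and t: "t \<in> adjointable_ops B N N'" and T: "T \<in> D M N"
  let ?F = "C0_corr (subtopology X U)"
  note sub = openin_subset[OF U]
  interpret MN: module_pair X U M N using module_pair_hilbert_module[OF U] M N A B by simp
  interpret MN': module_pair X U M' N' using module_pair_hilbert_module[OF U] M' N' A B by simp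
  interpret S: tensored_pair X "topspace X" M' M U U
    by (intro tensored_pair.intro MN.M.tensored_axioms MN'.M.tensored_axioms)
  interpret R: tensored_pair X U N N' U "topspace X"
    by (intro tensored_pair.intro MN.N.tensored_axioms MN'.N.tensored_axioms)
  have s': "s \<in> fadj M' M" and t': "t \<in> fadj N N'"
    using s t by (simp_all add: A B adjointable_ops_function_alg)
  obtain Rs where Rs: "is_adj M' M s Rs" using s' by (rule fadjE)
  have T': "T \<in> fadj (tensor B M ?F) N" using D[OF M N] T by blast
  obtain T1 where T1: "T1 \<in> fadj M (tensor A N ?F)" and rel: "MN.rel T1 T"
    using extend[OF M N T] by blast
  have eq: "hom_ext X U M N T = T1" by (rule MN.hom_ext_eqI) (use T1 rel A in simp_all)
  show "hom_ext X U M' N' (compose (carr (tensor B M' ?F)) t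
          (compose (carr (tensor B M' ?F)) T (tensor_map B M' M ?F s)))
       = compose (carr M') (tensor_map A N N' ?F t) (compose (carr M') (hom_ext X U M N T) s)"
    unfolding eq
  proof (rule MN'.hom_ext_eqI)
    have "tensor_map A N N' ?F t \<in> fadj (tensor A N ?F) (tensor A N' ?F)"
      using R.tensor_map_fadj[OF t'] by (simp only: A)
    then show "compose (carr M') (tensor_map A N N' ?F t) (compose (carr M') T1 s)
        \<in> fadj M' (tensor (function_alg (van X (topspace X))) N' ?F)"
      using fadj_compose[OF fadj_compose[OF s' T1]] by (simp only: A)
    show "MN'.rel (compose (carr M') (tensor_map A N N' ?F t) (compose (carr M') T1 s))
        (compose (carr (tensor B M' ?F)) t (compose (carr (tensor B M' ?F)) T (tensor_map B M' M ?F s)))"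
      unfolding MN'.rel_def
    proof
      fix m assume m: "m \<in> vanish U M'"
      have c: "tcls X U M' m \<in> carr (tensor B M' ?F)"
        using MN'.th_mem(1)[OF m] by (simp only: B)
      have sm: "s m \<in> vanish U M" by (rule S.adj_vanish[OF Rs m])
      have tms: "tensor_map B M' M ?F s (tcls X U M' m) = tcls X U M (s m)"
        using S.tensor_map_cls[OF s' m] by (simp only: B)
      have Tm: "T (tcls X U M (s m)) \<in> carr N"
        by (rule fadj_mem[OF T']) (use MN.th_mem(1)[OF sm] in \<open>simp only: B\<close>)
      have tmt: "tensor_map A N N' ?F t (tcls X U N n) = tcls X U N' (t n)" if "n \<in> carr N" for n
        using R.tensor_map_cls[OF t', of n] that by (simp only: A MN.vanish_N)
      have "compose (carr M') (tensor_map A N N' ?F t) (compose (carr M') T1 s) m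
          = tensor_map A N N' ?F t (T1 (s m))"
        using MN'.MU_carr[OF m] by (simp add: compose_def)
      also have "T1 (s m) = tcls X U N (T (tcls X U M (s m)))"
        using rel sm by (simp add: MN.rel_def)
      also have "tensor_map A N N' ?F t \<dots> = tcls X U N' (t (T (tcls X U M (s m))))"
        by (rule tmt[OF Tm])
      also have "t (T (tcls X U M (s m))) = compose (carr (tensor B M' ?F)) t
          (compose (carr (tensor B M' ?F)) T (tensor_map B M' M ?F s)) (tcls X U M' m)"
        using c tms by (simp add: compose_eq)
      finally show "compose (carr M') (tensor_map A N N' ?F t) (compose (carr M') T1 s) m
          = tcls X U N' (compose (carr (tensor B M' ?F)) t
            (compose (carr (tensor B M' ?F)) T (tensor_map B M' M ?F s)) (tcls X U M' m))" .
    qed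
  qed
qed

lemma locally_adjoint:
  assumes U: "openin X U"
  shows "locally_adjoint_tensor_functors TYPE('m) TYPE('n) (function_alg (van X (topspace X)))
    (function_alg (van X U)) (C0_corr (subtopology X U)) (C0_corr (subtopology X U))"
  unfolding locally_adjoint_tensor_functors_def Let_def
proof (rule exI[of _ "hom_ext X U"], rule conjI, intro allI impI, goal_cases)
  case (1 M N)
  then interpret module_pair X U M N by (elim conjE) (rule module_pair_hilbert_module[OF U])
  have ext: "\<exists>T'\<in>fcomp M TN. rel T' T" if "T \<in> fcomp TM N" for T
    using rel_extend_compact[OF that] by blast
  have res: "\<exists>T\<in>fcomp TM N. rel T' T" if "T' \<in> fcomp M TN" for T'
    using rel_restrict[of T'] fcomp_subset[of M TN] that by blast
  have rel: "hom_ext X U M N T \<in> fadj M TN \<and> rel (hom_ext X U M N T) T" if T: "T \<in> fcomp TM N" for T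
  proof -
    from ext[OF T] obtain T' where T': "T' \<in> fadj M TN" "rel T' T" using fcomp_subset[of M TN] by blast
    then show ?thesis using hom_ext_eqI[OF T'] by simp
  qed
  note sub = subsetD[OF fcomp_subset[of TM N]]
  have fb: "fbound TM N c T \<longleftrightarrow> fbound M TN c (hom_ext X U M N T)" if "T \<in> fcomp TM N" for T c
    using rel_fbound[OF sub[OF that]] rel[OF that] by blast
  show ?case
    unfolding compact_ops_function_alg op_bound_function_alg
  proof (intro conjI ballI allI)
    show "bij_betw (hom_ext X U M N) (fcomp TM N) (fcomp M TN)"
      by (rule hom_ext_bij_betw[OF fcomp_subset fcomp_subset ext res])
    show "hom_ext X U M N (op_add TM N S T) = op_add M TN (hom_ext X U M N S) (hom_ext X U M N T)"
      if "S \<in> fcomp TM N" "T \<in> fcomp TM N" for S T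
      using rel[OF that(1)] rel[OF that(2)] sub[OF that(1)] sub[OF that(2)]
      by (intro hom_ext_op_add) simp_all
    show "hom_ext X U M N (op_scl TM N r T) = op_scl M TN r (hom_ext X U M N T)"
      if "T \<in> fcomp TM N" for r T
      using rel[OF that] sub[OF that] by (intro hom_ext_op_scl) simp_all
    show "\<exists>C. \<forall>T\<in>fcomp TM N. \<forall>c. fbound TM N c T \<longrightarrow> fbound M TN (C * c) (hom_ext X U M N T)"
      using fb by (intro exI[of _ 1]) simp
    show "\<exists>C. \<forall>T\<in>fcomp TM N. \<forall>c. fbound M TN c (hom_ext X U M N T) \<longrightarrow> fbound TM N (C * c) T"
      using fb by (intro exI[of _ 1]) simp
  qed
next
  case 2
  show ?case
  proof (rule hom_ext_natural[OF U refl refl])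
    fix M N
    assume h: "hilbert_module (function_alg (van X (topspace X))) M"
      "hilbert_module (function_alg (van X U)) N"
    then interpret module_pair X U M N by (rule module_pair_hilbert_module[OF U])
    show "compact_ops (function_alg (van X U)) TM N \<subseteq> fadj TM N"
      unfolding compact_ops_function_alg by (rule fcomp_subset)
    show "\<exists>T'\<in>fadj M TN. rel T' T" if "T \<in> compact_ops (function_alg (van X U)) TM N" for T
      using rel_extend_compact[of T] that fcomp_subset[of M TN]
      unfolding compact_ops_function_alg by blast
  qed
qed

lemma adjoint_of_clopen:
  assumes U: "openin X U" and cl: "closedin X U"
  shows "adjoint_tensor_functors TYPE('m) TYPE('n) (function_alg (van X (topspace X)))
    (function_alg (van X U)) (C0_corr (subtopology X U)) (C0_corr (subtopology X U))"
  unfolding adjoint_tensor_functors_def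
proof (rule exI[of _ "hom_ext X U"], rule conjI, intro allI impI, goal_cases)
  case (1 M N)
  then interpret module_pair X U M N by (elim conjE) (rule module_pair_hilbert_module[OF U])
  show ?case
    unfolding adjointable_ops_function_alg
  proof (rule hom_ext_bij_betw[OF subset_refl subset_refl])
    show "\<exists>T'\<in>fadj M TN. rel T' T" if "T \<in> fadj TM N" for T
      using rel_extend_clopen[OF cl that] by blast
    show "\<exists>T\<in>fadj TM N. rel T' T" if "T' \<in> fadj M TN" for T'
      using rel_restrict[OF that] by blast
  qed
next
  case 2
  show ?case
  proof (rule hom_ext_natural[OF U refl refl])
    fix M N
    assume h: "hilbert_module (function_alg (van X (topspace X))) M"
      "hilbert_module (function_alg (van X U)) N"
    then interpret module_pair X U M N by (rule module_pair_hilbert_module[OF U])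
    show "adjointable_ops (function_alg (van X U)) TM N \<subseteq> fadj TM N"
      unfolding adjointable_ops_function_alg by (rule subset_refl)
    show "\<exists>T'\<in>fadj M TN. rel T' T" if "T \<in> adjointable_ops (function_alg (van X U)) TM N" for T
      using rel_extend_clopen[OF cl, of T] that unfolding adjointable_ops_function_alg by blast
  qed
qed

end

section \<open>The associated continuous fields\<close>

abbreviation fdist :: "('x \<Rightarrow> complex, 'm, 'z) hmod_scheme \<Rightarrow> 'x \<Rightarrow> 'm set \<Rightarrow> 'm set \<Rightarrow> real" where
  "fdist M z p q \<equiv> hnorm complex_alg (fibre M z) (diff (fibre M z) p q)"

abbreviation const_sec :: "'x topology \<Rightarrow> ('x \<Rightarrow> complex, 'm, 'z) hmod_scheme \<Rightarrow> 'm \<Rightarrow> 'x \<Rightarrow> 'm set" where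
  "const_sec Z M m \<equiv> \<lambda>z\<in>topspace Z. fib_class M z m"

section \<open>Calculation in fibres\<close>

context fmod
begin

lemma fib_class_pn: "fib_class M z m = {m' \<in> carr M. pn M z (diff M m m') = 0}"
  by (simp add: fib_class_def pn_eq_0_iff)

lemma pn_zero_trans:
  assumes "a \<in> carr M" "b \<in> carr M" "c \<in> carr M"
    and "pn M z (diff M a b) = 0" and "pn M z (diff M b c) = 0"
  shows "pn M z (diff M a c) = 0"
  using pn_triangle[OF assms(1-3), of z] assms(4,5) pn_nonneg[of M z "diff M a c"] by linarith

lemma fib_class_eq_iff:
  assumes m: "m \<in> carr M" and m': "m' \<in> carr M"
  shows "fib_class M z m = fib_class M z m' \<longleftrightarrow> pn M z (diff M m m') = 0"
proof
  assume eq: "fib_class M z m = fib_class M z m'"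
  have "m' \<in> fib_class M z m'" using m' by (simp add: fib_class_pn diff_self)
  then show "pn M z (diff M m m') = 0" unfolding eq[symmetric] by (simp add: fib_class_pn)
next
  assume z: "pn M z (diff M m m') = 0"
  then have z': "pn M z (diff M m' m) = 0" using pn_diff_commute[OF m m'] by simp
  show "fib_class M z m = fib_class M z m'"
    unfolding fib_class_pn using pn_zero_trans[OF m m' _ z] pn_zero_trans[OF m' m _ z'] by auto
qed

lemma rep_fib_class:
  assumes m: "m \<in> carr M"
  shows "rep (fib_class M z m) \<in> carr M" and "pn M z (diff M m (rep (fib_class M z m))) = 0"
    and "fib_class M z (rep (fib_class M z m)) = fib_class M z m"
proof -
  have "m \<in> fib_class M z m" using m by (simp add: fib_class_pn diff_self)
  then have "rep (fib_class M z m) \<in> fib_class M z m" unfolding rep_def by (rule someI)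
  then show r: "rep (fib_class M z m) \<in> carr M" and p: "pn M z (diff M m (rep (fib_class M z m))) = 0"
    by (simp_all add: fib_class_pn)
  show "fib_class M z (rep (fib_class M z m)) = fib_class M z m"
    using fib_class_eq_iff[OF m r, of z] p by simp
qed

text \<open>By Cauchy-Schwarz a vector that is null at \<open>z\<close> has zero pairings at
  \<open>z\<close>, so the inner product on a fibre does not depend on the representatives picked by
  \<open>rep\<close>.\<close>

lemma ip_pn_cong:
  assumes c: "a \<in> carr M" "b \<in> carr M" "a' \<in> carr M" "b' \<in> carr M"
    and a: "pn M z (diff M a a') = 0" and b: "pn M z (diff M b b') = 0"
  shows "ip M a b z = ip M a' b' z"
proof -
  have "ip M (diff M a a') b z = 0"
    using Cauchy_Schwarz[of "diff M a a'" b z] a c by (simp add: closed)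
  moreover have "ip M a' (diff M b b') z = 0"
    using Cauchy_Schwarz[of a' "diff M b b'" z] b c by (simp add: closed)
  ultimately show ?thesis using c by (simp add: ip_simps)
qed

lemma carr_fibre: "carr (fibre M z) = fib_class M z ` carr M"
  by (simp add: fibre_def)

lemma fib_mem: "m \<in> carr M \<Longrightarrow> fib_class M z m \<in> carr (fibre M z)"
  by (simp add: carr_fibre)

lemma ip_fibre: "\<lbrakk>m \<in> carr M; m' \<in> carr M\<rbrakk>
    \<Longrightarrow> ip (fibre M z) (fib_class M z m) (fib_class M z m') = ip M m m' z"
  unfolding fibre_def by simp (rule ip_pn_cong[symmetric]; simp add: rep_fib_class)

lemma add_fibre:
  assumes "m \<in> carr M" and "m' \<in> carr M"
  shows "add (fibre M z) (fib_class M z m) (fib_class M z m') = fib_class M z (add M m m')"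
proof -
  let ?r = "rep (fib_class M z m)" and ?r' = "rep (fib_class M z m')"
  note r = rep_fib_class[OF assms(1), of z] rep_fib_class[OF assms(2), of z]
  have "diff M (add M ?r ?r') (add M m m') = add M (diff M ?r m) (diff M ?r' m')"
    by (rule ip_eqI) (use assms r in \<open>simp_all add: closed ip_simps\<close>)
  then have "pn M z (diff M (add M ?r ?r') (add M m m')) \<le> pn M z (diff M ?r m) + pn M z (diff M ?r' m')"
    using pn_add[of "diff M ?r m" "diff M ?r' m'" z] assms r by (simp add: closed)
  also have "\<dots> = 0"
    using r(2,5) pn_diff_commute[OF assms(1) r(1), of z] pn_diff_commute[OF assms(2) r(4), of z] by simp
  finally have "pn M z (diff M (add M ?r ?r') (add M m m')) = 0"
    using pn_nonneg[of M z "diff M (add M ?r ?r') (add M m m')"] by linarith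
  then show ?thesis
    using fib_class_eq_iff[of "add M ?r ?r'" "add M m m'" z] assms r by (simp add: fibre_def closed)
qed

lemma scl_fibre:
  assumes "m \<in> carr M"
  shows "scl (fibre M z) c (fib_class M z m) = fib_class M z (scl M c m)"
proof -
  let ?r = "rep (fib_class M z m)"
  note r = rep_fib_class[OF assms, of z]
  have "diff M (scl M c ?r) (scl M c m) = scl M c (diff M ?r m)"
    by (rule ip_eqI) (use assms r in \<open>simp_all add: closed ip_simps algebra_simps\<close>)
  then have "pn M z (diff M (scl M c ?r) (scl M c m)) = 0"
    using assms r pn_diff_commute[OF assms r(1), of z] by (simp add: pn_scl closed)
  then show ?thesis
    using fib_class_eq_iff[of "scl M c ?r" "scl M c m" z] assms r by (simp add: fibre_def closed)
qed

lemma diff_fibre: "\<lbrakk>m \<in> carr M; m' \<in> carr M\<rbrakk>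
    \<Longrightarrow> diff (fibre M z) (fib_class M z m) (fib_class M z m') = fib_class M z (diff M m m')"
  by (simp add: diff_def add_fibre scl_fibre closed)

lemma hnorm_fibre: "m \<in> carr M \<Longrightarrow> hnorm complex_alg (fibre M z) (fib_class M z m) = pn M z m"
  by (simp add: hnorm_def ip_fibre complex_alg_def pn_def)

lemma fdist_fib: "\<lbrakk>m \<in> carr M; m' \<in> carr M\<rbrakk>
    \<Longrightarrow> fdist M z (fib_class M z m) (fib_class M z m') = pn M z (diff M m m')"
  by (simp add: diff_fibre hnorm_fibre closed)

lemma fdist_triangle:
  assumes "p \<in> carr (fibre M z)" "q \<in> carr (fibre M z)" "r \<in> carr (fibre M z)"
  shows "fdist M z p r \<le> fdist M z p q + fdist M z q r"
proof -
  obtain a b c where abc: "a \<in> carr M" "b \<in> carr M" "c \<in> carr M"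
    "p = fib_class M z a" "q = fib_class M z b" "r = fib_class M z c"
    using assms unfolding carr_fibre by blast
  then show ?thesis using pn_triangle[of a b c z] by (simp only: fdist_fib)
qed

lemma fdist_zer: "p \<in> carr (fibre M z) \<Longrightarrow> fdist M z p (fib_class M z (zer M)) = hnorm complex_alg (fibre M z) p"
proof -
  assume "p \<in> carr (fibre M z)"
  then obtain a where a: "a \<in> carr M" "p = fib_class M z a" unfolding carr_fibre by blast
  have "diff M a (zer M) = a"
    by (rule ip_eqI) (use a in \<open>simp_all add: closed ip_simps\<close>)
  then show ?thesis using a by (simp add: fdist_fib zer_closed hnorm_fibre)
qed

lemma hnorm_fibre_le: "\<lbrakk>p \<in> carr (fibre M z); m \<in> carr M\<rbrakk>
    \<Longrightarrow> \<bar>hnorm complex_alg (fibre M z) p - pn M z m\<bar> \<le> fdist M z p (fib_class M z m)"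
proof -
  assume "p \<in> carr (fibre M z)" and m: "m \<in> carr M"
  then obtain a where a: "a \<in> carr M" "p = fib_class M z a" unfolding carr_fibre by blast
  show ?thesis
    using pn_le_pn_diff[OF a(1) m, of z] pn_le_pn_diff[OF m a(1), of z] pn_diff_commute[OF a(1) m, of z]
    unfolding a(2) fdist_fib[OF a(1) m] hnorm_fibre[OF a(1)] by linarith
qed

lemma fib_class_trivial:
  assumes m: "m \<in> carr M" and z: "\<And>m'. m' \<in> carr M \<Longrightarrow> pn M z m' = 0"
  shows "fib_class M z m = carr M"
  using m z by (auto simp: fib_class_pn closed)

end

lemma locally_approximable_iff:
  "s \<in> locally_approximable Z (fibre M) G \<longleftrightarrow>
    s \<in> (\<Pi>\<^sub>E z\<in>topspace Z. carr (fibre M z)) \<and>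
    (\<forall>z\<in>topspace Z. \<forall>\<epsilon>>0. \<exists>W. openin Z W \<and> z \<in> W \<and> (\<exists>g\<in>G. \<forall>w\<in>W. fdist M w (s w) (g w) < \<epsilon>))"
  by (simp add: locally_approximable_def)

lemma locally_approximable_mono:
  "G \<subseteq> G' \<Longrightarrow> locally_approximable Z H G \<subseteq> locally_approximable Z H G'"
  unfolding locally_approximable_def by blast

section \<open>Tensoring with F as restriction of fields\<close>

context tensored
begin

abbreviation Z where "Z \<equiv> subtopology X U"
abbreviation MUsec where "MUsec \<equiv> {const_sec Z M m | m. m \<in> MU}"

text \<open>The map that evaluation induces on the fibres at \<open>z\<close>; on classes it sends
  the one of \<open>cls m\<close> to the one of \<open>m\<close> (\<open>theta_fib\<close>).\<close>

definition theta :: "'x \<Rightarrow> (nat \<Rightarrow> ('m \<times> ('x \<Rightarrow> complex)) list) set set \<Rightarrow> 'm set" where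
  "theta z p = fib_class M z (the_inv_into MU cls (rep p))"

lemma topspace_Z: "topspace Z = U"
  using openin_subset[OF U] by auto

lemma openin_Z: "openin Z S \<Longrightarrow> openin X S"
  using U openin_trans_full by blast

lemma pn_T: "m \<in> MU \<Longrightarrow> pn T z (cls m) = pn M z m"
  by (simp add: pn_def ip_T)

lemma diff_MU: "m \<in> MU \<Longrightarrow> m' \<in> MU \<Longrightarrow> diff M m m' \<in> MU"
  by (simp add: diff_def add_MU scl_MU)

lemma rep_fib_cls:
  assumes m: "m \<in> MU"
  obtains m' where "m' \<in> MU" and "rep (fib_class T z (cls m)) = cls m'"
    and "pn M z (diff M m m') = 0"
proof -
  interpret T: fmod "van X W" T by (rule fmod_T)
  have c: "cls m \<in> carr T" using m by (simp add: carr_T)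
  then obtain m' where m': "m' \<in> MU" "rep (fib_class T z (cls m)) = cls m'"
    using T.rep_fib_class(1)[OF c, of z] unfolding carr_T by blast
  have "pn M z (diff M m m') = 0"
    using T.rep_fib_class(2)[OF c, of z] m m' by (simp add: diff_T pn_T diff_MU)
  with m' that show thesis by blast
qed

lemma theta_fib:
  assumes m: "m \<in> MU"
  shows "theta z (fib_class T z (cls m)) = fib_class M z m"
proof -
  obtain m' where m': "m' \<in> MU" "rep (fib_class T z (cls m)) = cls m'" "pn M z (diff M m m') = 0"
    using rep_fib_cls[OF m] by metis
  then show ?thesis
    using fib_class_eq_iff[of m m' z] by (simp add: theta_def inv_cls vanish_carr[OF m] vanish_carr[OF m'(1)])
qed

lemma fibre_T: "carr (fibre T z) = (\<lambda>m. fib_class T z (cls m)) ` MU"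
proof -
  interpret T: fmod "van X W" T by (rule fmod_T)
  show ?thesis unfolding T.carr_fibre carr_T image_image ..
qed

lemma ip_theta:
  assumes "p \<in> carr (fibre T z)" and "q \<in> carr (fibre T z)"
  shows "ip (fibre M z) (theta z p) (theta z q) = ip (fibre T z) p q"
proof -
  interpret T: fmod "van X W" T by (rule fmod_T)
  obtain a b where ab: "a \<in> MU" "b \<in> MU" "p = fib_class T z (cls a)" "q = fib_class T z (cls b)"
    using assms unfolding fibre_T by blast
  show ?thesis
    unfolding ab(3,4) theta_fib[OF ab(1)] theta_fib[OF ab(2)]
    using ab(1,2) by (simp add: ip_fibre T.ip_fibre vanish_carr carr_T ip_T)
qed

lemma fdist_theta:
  assumes "p \<in> carr (fibre T z)" and "q \<in> carr (fibre T z)"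
  shows "fdist M z (theta z p) (theta z q) = fdist T z p q"
proof -
  interpret T: fmod "van X W" T by (rule fmod_T)
  obtain a b where ab: "a \<in> MU" "b \<in> MU" "p = fib_class T z (cls a)" "q = fib_class T z (cls b)"
    using assms unfolding fibre_T by blast
  have c: "cls a \<in> carr T" "cls b \<in> carr T" using ab by (simp_all add: carr_T)
  show ?thesis
    unfolding ab(3,4) theta_fib[OF ab(1)] theta_fib[OF ab(2)] T.fdist_fib[OF c]
      fdist_fib[OF vanish_carr[OF ab(1)] vanish_carr[OF ab(2)]]
    using ab(1,2) by (simp add: diff_T pn_T diff_MU)
qed

text \<open>Injectivity is isometry. For surjectivity, \<open>m\<close> and m f have the same class
  at \<open>z\<close> when f is 1 there, and m f belongs to the submodule.\<close>

lemma theta_bij: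
  assumes z: "z \<in> U"
  shows "bij_betw (theta z) (carr (fibre T z)) (carr (fibre M z))"
  unfolding bij_betw_def
proof (intro conjI equalityI subsetI)
  interpret T: fmod "van X W" T by (rule fmod_T)
  show "inj_on (theta z) (carr (fibre T z))"
  proof (rule inj_onI)
    fix p q assume p: "p \<in> carr (fibre T z)" and q: "q \<in> carr (fibre T z)" and eq: "theta z p = theta z q"
    obtain a b where ab: "a \<in> carr T" "b \<in> carr T" "p = fib_class T z a" "q = fib_class T z b"
      using p q unfolding T.carr_fibre by blast
    have "fdist M z (theta z q) (theta z q) = fdist T z q q" by (rule fdist_theta[OF q q])
    also have "\<dots> = 0" using ab by (simp add: T.fdist_fib T.diff_self)
    finally have "fdist T z p q = 0" using fdist_theta[OF p q] eq by simp
    then show "p = q" using T.fib_class_eq_iff[OF ab(1,2)] ab by (simp add: T.fdist_fib)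
  qed
  fix q
  {
    assume "q \<in> theta z ` carr (fibre T z)"
    then show "q \<in> carr (fibre M z)" by (auto simp: fibre_T theta_fib vanish_carr fib_mem)
  }
  {
    assume "q \<in> carr (fibre M z)"
    then obtain m where m: "m \<in> carr M" "q = fib_class M z m" unfolding carr_fibre by blast
    obtain f where f: "f \<in> van X U" "f z = 1" "\<And>x. cmod (f x) \<le> 1" using bump[OF U z] by metis
    have mf: "act M m f \<in> MU" by (rule act_vanish[OF m(1) f(1)])
    have "pn M z (diff M m (act M m f)) = 0" using pn_diff_act[OF m(1) C0V[OF f(1)], of z] f by simp
    then have "q = theta z (fib_class T z (cls (act M m f)))"
      using fib_class_eq_iff[OF m(1) vanish_carr[OF mf]] m by (simp add: theta_fib[OF mf])
    then show "q \<in> theta z ` carr (fibre T z)" using mf unfolding fibre_T by blast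
  }
qed

text \<open>Fibrewise \<open>theta\<close> is isometric and carries the generating section of
  \<open>cls m\<close> to that of \<open>m\<close>, so local approximability by generators means the
  same before and after.\<close>

lemma theta_sections:
  "(\<lambda>s. \<lambda>z\<in>topspace Z. theta z (s z)) ` sec (field_of Z T) = locally_approximable Z (fibre M) MUsec"
proof -
  interpret T: fmod "van X W" T by (rule fmod_T)
  have sec: "sec (field_of Z T) = locally_approximable Z (fibre T) {const_sec Z T m | m. m \<in> carr T}"
    by (simp add: field_of_def)
  have key: "(\<lambda>z\<in>U. theta z (s z)) \<in> locally_approximable Z (fibre M) MUsec
      \<longleftrightarrow> s \<in> locally_approximable Z (fibre T) {const_sec Z T m | m. m \<in> carr T}"
    if s: "s \<in> (\<Pi>\<^sub>E z\<in>U. carr (fibre T z))" for s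
  proof -
    have sz: "s z \<in> carr (fibre T z)" if "z \<in> U" for z using s that by auto
    have 1: "(\<lambda>z\<in>U. theta z (s z)) \<in> (\<Pi>\<^sub>E z\<in>U. carr (fibre M z))"
      using sz theta_bij unfolding bij_betw_def by auto
    have 2: "(\<exists>g\<in>MUsec. \<forall>w\<in>W'. fdist M w ((\<lambda>z\<in>U. theta z (s z)) w) (g w) < \<epsilon>)
        \<longleftrightarrow> (\<exists>g\<in>{const_sec Z T m | m. m \<in> carr T}. \<forall>w\<in>W'. fdist T w (s w) (g w) < \<epsilon>)"
      if W: "openin Z W'" for W' \<epsilon>
    proof -
      have WU: "W' \<subseteq> U" using openin_subset[OF W] by (simp only: topspace_Z)
      have eq: "fdist M w ((\<lambda>z\<in>U. theta z (s z)) w) (const_sec Z M m w)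
          = fdist T w (s w) (const_sec Z T (cls m) w)" if "w \<in> W'" "m \<in> MU" for w m
      proof -
        have w: "w \<in> U" using that WU by blast
        have "fib_class T w (cls m) \<in> carr (fibre T w)" using that(2) unfolding fibre_T by blast
        then show ?thesis
          using fdist_theta[OF sz[OF w], of "fib_class T w (cls m)"] w
          by (simp only: theta_fib[OF that(2)] topspace_Z restrict_apply if_True)
      qed
      show ?thesis
      proof
        assume "\<exists>g\<in>MUsec. \<forall>w\<in>W'. fdist M w ((\<lambda>z\<in>U. theta z (s z)) w) (g w) < \<epsilon>"
        then obtain m where m: "m \<in> MU"
          "\<forall>w\<in>W'. fdist M w ((\<lambda>z\<in>U. theta z (s z)) w) (const_sec Z M m w) < \<epsilon>" by blast
        then have "\<forall>w\<in>W'. fdist T w (s w) (const_sec Z T (cls m) w) < \<epsilon>" using eq by simp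
        then show "\<exists>g\<in>{const_sec Z T m | m. m \<in> carr T}. \<forall>w\<in>W'. fdist T w (s w) (g w) < \<epsilon>"
          using m(1) carr_T by blast
      next
        assume "\<exists>g\<in>{const_sec Z T m | m. m \<in> carr T}. \<forall>w\<in>W'. fdist T w (s w) (g w) < \<epsilon>"
        then obtain c where c: "c \<in> carr T" "\<forall>w\<in>W'. fdist T w (s w) (const_sec Z T c w) < \<epsilon>" by blast
        from c(1) obtain m where m: "m \<in> MU" "c = cls m" unfolding carr_T by blast
        then have "\<forall>w\<in>W'. fdist M w ((\<lambda>z\<in>U. theta z (s z)) w) (const_sec Z M m w) < \<epsilon>"
          using eq c(2) by simp
        then show "\<exists>g\<in>MUsec. \<forall>w\<in>W'. fdist M w ((\<lambda>z\<in>U. theta z (s z)) w) (g w) < \<epsilon>"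
          using m(1) by blast
      qed
    qed
    have 3: "(\<exists>W. openin Z W \<and> z \<in> W \<and> (\<exists>g\<in>MUsec. \<forall>w\<in>W. fdist M w ((\<lambda>z\<in>U. theta z (s z)) w) (g w) < \<epsilon>))
      \<longleftrightarrow> (\<exists>W. openin Z W \<and> z \<in> W \<and>
        (\<exists>g\<in>{const_sec Z T m | m. m \<in> carr T}. \<forall>w\<in>W. fdist T w (s w) (g w) < \<epsilon>))" for z \<epsilon>
      by (intro ex_cong1 conj_cong refl 2)
    show ?thesis
      unfolding locally_approximable_iff by (simp only: topspace_Z 1 s 3[unfolded topspace_Z] simp_thms)
  qed
  show ?thesis unfolding sec topspace_Z
  proof (intro equalityI subsetI)
    fix t assume "t \<in> (\<lambda>s. \<lambda>z\<in>U. theta z (s z)) `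
        locally_approximable Z (fibre T) {\<lambda>z\<in>U. fib_class T z m | m. m \<in> carr T}"
    then obtain s where t: "t = (\<lambda>z\<in>U. theta z (s z))"
      and s': "s \<in> locally_approximable Z (fibre T) {\<lambda>z\<in>U. fib_class T z m | m. m \<in> carr T}"
      by (rule imageE)
    from s' have s: "s \<in> locally_approximable Z (fibre T) {const_sec Z T m | m. m \<in> carr T}"
      by (simp only: topspace_Z)
    then have "s \<in> (\<Pi>\<^sub>E z\<in>U. carr (fibre T z))" by (simp only: locally_approximable_iff topspace_Z)
    from key[OF this] s show "t \<in> locally_approximable Z (fibre M) {\<lambda>z\<in>U. fib_class M z m | m. m \<in> MU}"
      unfolding t topspace_Z by (simp only:)
  next
    fix t assume "t \<in> locally_approximable Z (fibre M) {\<lambda>z\<in>U. fib_class M z m | m. m \<in> MU}"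
    then have t: "t \<in> locally_approximable Z (fibre M) MUsec" by (simp only: topspace_Z)
    then have tP: "t \<in> (\<Pi>\<^sub>E z\<in>U. carr (fibre M z))" by (simp only: locally_approximable_iff topspace_Z)
    define s where "s = (\<lambda>z\<in>U. the_inv_into (carr (fibre T z)) (theta z) (t z))"
    have inv: "s z \<in> carr (fibre T z) \<and> theta z (s z) = t z" if z: "z \<in> U" for z
    proof -
      have "t z \<in> theta z ` carr (fibre T z)" "inj_on (theta z) (carr (fibre T z))"
        using theta_bij[OF z] tP z unfolding bij_betw_def by auto
      then show ?thesis using z by (simp add: s_def the_inv_into_into f_the_inv_into_f)
    qed
    have sP: "s \<in> (\<Pi>\<^sub>E z\<in>U. carr (fibre T z))" using inv by (auto simp: s_def)
    have "(\<lambda>z\<in>U. theta z (s z)) = t"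
      by (rule extensionalityI[of _ U]) (use inv tP in \<open>auto simp: PiE_def\<close>)
    with key[OF sP] t have "s \<in> locally_approximable Z (fibre T) {const_sec Z T m | m. m \<in> carr T}"
      by (simp only:)
    with \<open>(\<lambda>z\<in>U. theta z (s z)) = t\<close> show "t \<in> (\<lambda>s. \<lambda>z\<in>U. theta z (s z)) `
        locally_approximable Z (fibre T) {\<lambda>z\<in>U. fib_class T z m | m. m \<in> carr T}"
      by (intro image_eqI[of _ _ s]) (simp_all only: topspace_Z)
  qed
qed

end

text \<open>Both routes apply \<open>t\<close>, but to different chosen representatives
  \<open>m1\<close> and \<open>?m2\<close>. These differ by a vector that is null at
  \<open>z\<close>, and \<open>t\<close> preserves null vectors.\<close>

lemma (in tensored_pair) theta_natural:
  assumes t: "t \<in> fadj M N" and p: "p \<in> carr (fibre M.T z)"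
  shows "N.theta z (fibre_map N.T (tensor_map (function_alg (van X W)) M N (C0_corr (subtopology X U)) t) z p)
    = fibre_map N t z (M.theta z p)"
proof -
  obtain R where R: "is_adj M N t R" using t by (rule fadjE)
  obtain m where m: "m \<in> vanish U M" "p = fib_class M.T z (tcls X U M m)"
    using p unfolding M.fibre_T by blast
  note mc = vanish_carr[OF m(1)]
  obtain m1 where m1: "m1 \<in> vanish U M" "rep p = tcls X U M m1" "pn M z (diff M m m1) = 0"
    using M.rep_fib_cls[OF m(1), of z] m(2) by metis
  note m1c = vanish_carr[OF m1(1)]
  let ?m2 = "rep (fib_class M z m)"
  note m2 = M.rep_fib_class[OF mc, of z]
  have "pn M z (diff M m1 m) = 0" using m1(3) M.pn_diff_commute[OF mc m1c] by simp
  then have "pn M z (diff M m1 ?m2) = 0" by (rule M.pn_zero_trans[OF m1c mc m2(1) _ m2(2)])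
  then have "pn N z (t (diff M m1 ?m2)) = 0"
    by (rule MN.adj_pn_eq_0[OF R M.diff_closed[OF m1c m2(1)]])
  then have "pn N z (diff N (t m1) (t ?m2)) = 0" by (simp only: MN.adj_diff[OF R m1c m2(1)])
  then have eq: "fib_class N z (t m1) = fib_class N z (t ?m2)"
    using N.fib_class_eq_iff[OF is_adj_fun[OF R m1c] is_adj_fun[OF R m2(1)]] by simp
  have "fibre_map N.T (tensor_map (function_alg (van X W)) M N (C0_corr (subtopology X U)) t) z p
      = fib_class N.T z (tcls X U N (t m1))"
    unfolding fibre_map_def m1(2) tensor_map_cls[OF t m1(1)] ..
  then show ?thesis
    unfolding fibre_map_def m(2) M.theta_fib[OF m(1)]
    using N.theta_fib[OF adj_vanish[OF R m1(1)]] eq by (simp add: fibre_map_def m(2))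
qed

lemma continuous_map_real_iff:
  "continuous_map X euclideanreal f \<longleftrightarrow>
    (\<forall>x\<in>topspace X. \<forall>\<epsilon>>0. \<exists>W. openin X W \<and> x \<in> W \<and> (\<forall>y\<in>W. \<bar>f y - f x\<bar> < \<epsilon>))"
proof -
  have "continuous_map X Met_TC.mtopology f \<longleftrightarrow>
      (\<forall>x\<in>topspace X. \<forall>\<epsilon>>0. \<exists>W. openin X W \<and> x \<in> W \<and> (\<forall>y\<in>W. f y \<in> Met_TC.mball (f x) \<epsilon>))"
    by (rule Met_TC.continuous_map_to_metric)
  then show ?thesis by (simp add: mtopology_is_euclidean dist_real_def abs_minus_commute)
qed

lemma continuous_map_realE:
  assumes "continuous_map X euclideanreal f" and "x \<in> topspace X" and "0 < \<epsilon>"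
  obtains W where "openin X W" and "x \<in> W" and "\<forall>y\<in>W. \<bar>f y - f x\<bar> < \<epsilon>"
proof -
  have "\<exists>W. openin X W \<and> x \<in> W \<and> (\<forall>y\<in>W. \<bar>f y - f x\<bar> < \<epsilon>)"
    using assms by (simp only: continuous_map_real_iff)
  then show thesis by (elim exE conjE) (rule that)
qed

lemma locally_approximableE:
  assumes s: "s \<in> locally_approximable Y H G" and z: "z \<in> topspace Y" and e: "0 < \<epsilon>"
  obtains W g where "openin Y W" and "z \<in> W" and "g \<in> G"
    and "\<forall>w\<in>W. hnorm complex_alg (H w) (diff (H w) (s w) (g w)) < \<epsilon>"
proof -
  have "\<forall>z\<in>topspace Y. \<forall>\<epsilon>>0. \<exists>W. openin Y W \<and> z \<in> W \<and>
      (\<exists>g\<in>G. \<forall>w\<in>W. hnorm complex_alg (H w) (diff (H w) (s w) (g w)) < \<epsilon>)"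
    using s unfolding locally_approximable_def mem_Collect_eq by (rule conjunct2)
  then have "\<exists>W. openin Y W \<and> z \<in> W \<and>
      (\<exists>g\<in>G. \<forall>w\<in>W. hnorm complex_alg (H w) (diff (H w) (s w) (g w)) < \<epsilon>)"
    using z e by simp
  then show thesis by (elim exE conjE bexE) (rule that)
qed

context fmod
begin

lemma const_sec_approximable:
  assumes "m \<in> carr M" and "m \<in> D" and D: "D \<subseteq> carr M"
  shows "const_sec Y M m \<in> locally_approximable Y (fibre M) {const_sec Y M m | m. m \<in> D}"
  unfolding locally_approximable_iff
proof (intro conjI ballI allI impI)
  show "const_sec Y M m \<in> (\<Pi>\<^sub>E z\<in>topspace Y. carr (fibre M z))"
    using assms(1) by (auto simp: fib_mem)
  fix z \<epsilon> assume z: "z \<in> topspace Y" and e: "(\<epsilon> :: real) > 0"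
  have close: "\<forall>w\<in>topspace Y. fdist M w (const_sec Y M m w) (const_sec Y M m w) < \<epsilon>"
    using assms(1) e by (simp add: fdist_fib diff_self)
  have mem: "const_sec Y M m \<in> {const_sec Y M m | m. m \<in> D}" using assms(2) by blast
  show "\<exists>W. openin Y W \<and> z \<in> W \<and> (\<exists>g\<in>{const_sec Y M m | m. m \<in> D}.
      \<forall>w\<in>W. fdist M w (const_sec Y M m w) (g w) < \<epsilon>)"
  proof (rule exI[of _ "topspace Y"], intro conjI)
    show "\<exists>g\<in>{const_sec Y M m | m. m \<in> D}.
        \<forall>w\<in>topspace Y. fdist M w (const_sec Y M m w) (g w) < \<epsilon>"
      using mem by (rule rev_bexI) (rule close)
  qed (simp_all add: z)
qed

lemma approximable_carr:
  assumes "s \<in> locally_approximable Y (fibre M) G" and "z \<in> topspace Y"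
  shows "s z \<in> carr (fibre M z)"
proof -
  have "s \<in> (\<Pi>\<^sub>E z\<in>topspace Y. carr (fibre M z))"
    using assms(1) unfolding locally_approximable_iff by (rule conjunct1)
  then show ?thesis using assms(2) by (rule PiE_mem)
qed

lemma approximable_const:
  assumes s: "s \<in> locally_approximable Y (fibre M) {const_sec Y M m | m. m \<in> D}"
    and z: "z \<in> topspace Y" and e: "\<epsilon> > 0"
  obtains W m where "openin Y W" and "z \<in> W" and "m \<in> D"
    and "\<forall>w\<in>W. fdist M w (s w) (fib_class M w m) < \<epsilon>"
proof -
  obtain W g where W: "openin Y W" "z \<in> W" and g: "g \<in> {const_sec Y M m | m. m \<in> D}"
    and b: "\<forall>w\<in>W. fdist M w (s w) (g w) < \<epsilon>"
    using s z e by (rule locally_approximableE)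
  from g obtain m where m: "m \<in> D" "g = const_sec Y M m" by blast
  have "fdist M w (s w) (fib_class M w m) < \<epsilon>" if w: "w \<in> W" for w
    using bspec[OF b w] w openin_subset[OF W(1)] unfolding m(2) by (simp add: subset_iff)
  then show thesis by (intro that[OF W m(1)] ballI)
qed

lemma approximableI:
  assumes s: "s \<in> (\<Pi>\<^sub>E z\<in>topspace Y. carr (fibre M z))"
    and ap: "\<And>z \<epsilon>. \<lbrakk>z \<in> topspace Y; 0 < \<epsilon>\<rbrakk> \<Longrightarrow> \<exists>W m. openin Y W \<and> z \<in> W \<and> m \<in> D \<and>
      (\<forall>w\<in>W. fdist M w (s w) (fib_class M w m) < \<epsilon>)"
  shows "s \<in> locally_approximable Y (fibre M) {const_sec Y M m | m. m \<in> D}"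
  unfolding locally_approximable_iff
proof (intro conjI s ballI allI impI)
  fix z \<epsilon> assume "z \<in> topspace Y" and "(\<epsilon> :: real) > 0"
  from ap[OF this] obtain W m where W: "openin Y W" "z \<in> W" and m: "m \<in> D"
    and b: "\<forall>w\<in>W. fdist M w (s w) (fib_class M w m) < \<epsilon>" by blast
  have close: "\<forall>w\<in>W. fdist M w (s w) (const_sec Y M m w) < \<epsilon>"
    using b openin_subset[OF W(1)] by (simp add: subset_iff)
  have mem: "const_sec Y M m \<in> {const_sec Y M m | m. m \<in> D}" using m by blast
  show "\<exists>W. openin Y W \<and> z \<in> W \<and> (\<exists>g\<in>{const_sec Y M m | m. m \<in> D}.
      \<forall>w\<in>W. fdist M w (s w) (g w) < \<epsilon>)"
  proof (rule exI[of _ W], intro conjI W)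
    show "\<exists>g\<in>{const_sec Y M m | m. m \<in> D}. \<forall>w\<in>W. fdist M w (s w) (g w) < \<epsilon>"
      using mem by (rule rev_bexI) (rule close)
  qed
qed

end

lemma sec_field_of: "sec (field_of Y M) = locally_approximable Y (fibre M) {const_sec Y M m | m. m \<in> carr M}"
  and fib_field_of: "fib (field_of Y M) = fibre M"
  by (simp_all add: field_of_def)

context tensored
begin

text \<open>Restricted sections are locally close to generators \<open>m\<close> of the field on X;
  near a point of \<open>U\<close>, \<open>m\<close> is in turn close to m f with f a bump function.
  So the elements of the submodule already generate.\<close>

lemma restrict_sections:
  "locally_approximable Z (fibre M) MUsec = sec (restrict_field X U (field_of X M))"
proof -
  have R: "sec (restrict_field X U (field_of X M))
      = locally_approximable Z (fibre M) ((\<lambda>s. restrict s U) ` sec (field_of X M))"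
    by (simp add: restrict_field_def fib_field_of)
  show ?thesis unfolding R
  proof (intro equalityI subsetI)
    have "MUsec \<subseteq> (\<lambda>s. restrict s U) ` sec (field_of X M)"
    proof
      fix g assume "g \<in> MUsec"
      then obtain m where m: "m \<in> MU" "g = const_sec Z M m" by blast
      have "const_sec X M m \<in> sec (field_of X M)"
        unfolding sec_field_of by (rule const_sec_approximable) (use vanish_carr[OF m(1)] in simp_all)
      moreover have "g = restrict (const_sec X M m) U"
        using openin_subset[OF U] unfolding m(2) by (intro ext) (auto simp: restrict_def)
      ultimately show "g \<in> (\<lambda>s. restrict s U) ` sec (field_of X M)" by blast
    qed
    from locally_approximable_mono[OF this]
    show "s \<in> locally_approximable Z (fibre M) ((\<lambda>s. restrict s U) ` sec (field_of X M))"
      if "s \<in> locally_approximable Z (fibre M) MUsec" for s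
      using that by (rule subsetD)
  next
    fix s assume s: "s \<in> locally_approximable Z (fibre M) ((\<lambda>s. restrict s U) ` sec (field_of X M))"
    show "s \<in> locally_approximable Z (fibre M) MUsec"
    proof (rule approximableI)
      show "s \<in> (\<Pi>\<^sub>E z\<in>topspace Z. carr (fibre M z))"
        using s unfolding locally_approximable_iff by (rule conjunct1)
      fix z and \<epsilon> :: real assume zZ: "z \<in> topspace Z" and e: "\<epsilon> > 0"
      have z: "z \<in> U" using zZ by (simp only: topspace_Z)
      have zX: "z \<in> topspace X" using z openin_subset[OF U] by blast
      have e3: "\<epsilon> / 3 > 0" using e by simp
      obtain W1 g' where W1: "openin Z W1" "z \<in> W1" and g': "g' \<in> (\<lambda>s. restrict s U) ` sec (field_of X M)"
        and b1': "\<forall>w\<in>W1. fdist M w (s w) (g' w) < \<epsilon> / 3"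
        using s zZ e3 by (rule locally_approximableE)
      from g' obtain g where g: "g \<in> sec (field_of X M)" and gr: "g' = restrict g U" by blast
      note b1 = b1'[unfolded gr]
      obtain W2 m where W2: "openin X W2" "z \<in> W2" and m: "m \<in> carr M"
        and b2: "\<forall>w\<in>W2. fdist M w (g w) (fib_class M w m) < \<epsilon> / 3"
        using g[unfolded sec_field_of] zX e3 by (rule approximable_const)
      obtain f where f: "f \<in> van X U" "f z = 1" "\<And>x. cmod (f x) \<le> 1" using bump[OF U z] by metis
      \<comment> \<open>Where \<open>f\<close> is within \<delta> of 1, replacing \<open>m\<close>
        by m f costs at most \<delta> * \<open>hn M m\<close> < \<epsilon>/3, the last third of the
        error; the 1 keeps the denominator positive.\<close>
      define \<delta> where "\<delta> = \<epsilon> / (3 * (hn M m + 1))"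
      have hm: "0 \<le> hn M m" by (rule hn_nonneg[OF m])
      have \<delta>: "\<delta> > 0" "\<delta> * hn M m < \<epsilon> / 3"
        using e hm by (simp_all add: \<delta>_def divide_simps)
      define W3 where "W3 = {w \<in> topspace X. f w \<in> ball 1 \<delta>}"
      have W3: "openin X W3" "z \<in> W3"
        using openin_continuous_map_preimage[OF van_contD[OF f(1)], of "ball 1 \<delta>"] zX f \<delta>
        by (simp_all add: W3_def)
      have mf: "act M m f \<in> MU" by (rule act_vanish[OF m f(1)])
      note mfc = vanish_carr[OF mf]
      let ?W = "W1 \<inter> (W2 \<inter> W3 \<inter> U)"
      have WZ: "openin Z ?W"
        using openin_Z[OF W1(1)] W2(1) W3(1) U by (simp add: openin_open_subtopology openin_Int le_infI2)
      have "fdist M w (s w) (fib_class M w (act M m f)) < \<epsilon>" if w: "w \<in> ?W" for w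
      proof -
        have wU: "w \<in> U" and wX: "w \<in> topspace X" using w openin_subset[OF U] by auto
        have c: "s w \<in> carr (fibre M w)" "g w \<in> carr (fibre M w)"
          using approximable_carr[OF s, of w] approximable_carr[OF g[unfolded sec_field_of] wX] wU wX
          by simp_all
        have "fdist M w (fib_class M w m) (fib_class M w (act M m f)) = cmod (1 - f w) * pn M w m"
          using m mfc f by (simp add: fdist_fib pn_diff_act C0V)
        also have "\<dots> \<le> \<delta> * hn M m"
          using w \<delta>(1) pn_le_hn[OF m, of w] by (intro mult_mono) (auto simp: W3_def dist_norm)
        also have "\<dots> < \<epsilon> / 3" by (rule \<delta>)
        finally have b3: "fdist M w (fib_class M w m) (fib_class M w (act M m f)) < \<epsilon> / 3" .
        have "fdist M w (s w) (g w) < \<epsilon> / 3" using bspec[OF b1, of w] w wU by simp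
        moreover have "fdist M w (g w) (fib_class M w m) < \<epsilon> / 3" using b2 w by simp
        ultimately show ?thesis
          using b3 fdist_triangle[OF c fib_mem[OF mfc]] fdist_triangle[OF c(2) fib_mem[OF m] fib_mem[OF mfc]]
          by linarith
      qed
      then show "\<exists>W m. openin Z W \<and> z \<in> W \<and> m \<in> MU \<and>
          (\<forall>w\<in>W. fdist M w (s w) (fib_class M w m) < \<epsilon>)"
        using WZ W1(2) W2(2) W3(2) z mf by blast
    qed
  qed
qed

lemma field_iso_restrict: "field_iso Z theta (field_of Z T) (restrict_field X U (field_of X M))"
  unfolding field_iso_def theta_sections restrict_sections
  by (simp add: fib_field_of restrict_field_def topspace_Z theta_bij ip_theta)

end

section \<open>Tensoring with E as extension of fields by zero\<close>

locale extended = tensored X U M U "topspace X"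
  for X :: "'x topology" and U and M :: "('x \<Rightarrow> complex, 'm, 'z) hmod_scheme"
begin

lemma MU_eq: "MU = carr M"
  by (auto simp: vanish_def intro: van_zero_outside[OF ip_in])

lemma pn_T_outside:
  assumes "c \<in> carr T" and "z \<notin> U"
  shows "pn T z c = 0"
proof -
  obtain m where m: "m \<in> MU" "c = cls m" using assms(1) unfolding carr_T by blast
  then show ?thesis using vanish_pn[OF m(1) assms(2)] by (simp add: pn_T)
qed

definition theta0 where "theta0 z p = (if z \<in> U then theta z p else undefined)"

abbreviation EF where "EF \<equiv> extend_field X U (field_of Z M)"
abbreviation H' where "H' \<equiv> (\<lambda>x. if x \<in> U then fibre M x else zero_hilbert_space)"

lemma fib_EF: "fib EF = H'"
  unfolding extend_field_def fib_field_of Let_def by simp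

lemma sec_EF: "sec EF = {s \<in> (\<Pi>\<^sub>E x\<in>topspace X. carr (H' x)). restrict s U \<in> sec (field_of Z M) \<and>
    continuous_map X euclideanreal (\<lambda>x. hnorm complex_alg (H' x) (s x))}"
  unfolding extend_field_def fib_field_of Let_def by simp

lemma zero_hilbert_sel: "carr zero_hilbert_space = {undefined}" "ip zero_hilbert_space p q = 0"
    "hnorm complex_alg zero_hilbert_space p = 0"
  by (simp_all add: zero_hilbert_space_def hnorm_def complex_alg_def)

text \<open>Off \<open>U\<close> every vector of the tensor product is null, so the only class is
  the whole carrier; this matches the zero space in the extended field.\<close>

lemma fibre_outside:
  assumes "z \<notin> U"
  shows "carr (fibre T z) = {carr T}"
proof -
  interpret T: fmod "van X (topspace X)" T by (rule fmod_T)
  have "fib_class T z c = carr T" if "c \<in> carr T" for c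
    by (rule T.fib_class_trivial[OF that pn_T_outside[OF _ assms]])
  then show ?thesis unfolding T.carr_fibre using T.zer_closed by auto
qed

lemma theta0_fibre: "p \<in> carr (fibre T z) \<Longrightarrow> theta0 z p \<in> carr (H' z)"
  using theta_bij[of z] by (auto simp: theta0_def zero_hilbert_sel bij_betw_def)

lemma theta0_bij: "bij_betw (theta0 z) (carr (fibre T z)) (carr (H' z))"
proof (cases "z \<in> U")
  case True
  then show ?thesis
    using theta_bij[OF True] bij_betw_cong[of "carr (fibre T z)" "theta0 z" "theta z"]
    by (simp add: theta0_def)
next
  case False
  then show ?thesis by (simp add: fibre_outside zero_hilbert_sel theta0_def bij_betw_def)
qed

lemma ip_theta0:
  assumes p: "p \<in> carr (fibre T z)" and q: "q \<in> carr (fibre T z)"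
  shows "ip (H' z) (theta0 z p) (theta0 z q) = ip (fibre T z) p q"
proof (cases "z \<in> U")
  case True
  then show ?thesis using ip_theta[OF p q] by (simp add: theta0_def)
next
  case False
  interpret T: fmod "van X (topspace X)" T by (rule fmod_T)
  obtain a b where ab: "a \<in> carr T" "b \<in> carr T" "p = fib_class T z a" "q = fib_class T z b"
    using p q unfolding T.carr_fibre by blast
  have "ip (fibre T z) p q = 0"
    using T.Cauchy_Schwarz[OF ab(1,2), of z] pn_T_outside[OF ab(1) False] ab
    by (simp add: T.ip_fibre)
  then show ?thesis using False by (simp add: zero_hilbert_sel)
qed

lemma hnorm_theta0:
  "p \<in> carr (fibre T z) \<Longrightarrow> hnorm complex_alg (H' z) (theta0 z p) = hnorm complex_alg (fibre T z) p"
  using ip_theta0[of p z p] by (simp add: hnorm_def)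

text \<open>What has to be shown beyond \<open>U\<close> is continuity of the norm. A section is
  locally uniformly close to an element \<open>c\<close>, and the norm of \<open>c\<close> is
  continuous because <c, c> is a continuous function on X.\<close>

lemma theta0_sections_subset:
  assumes s: "s \<in> sec (field_of X T)"
  shows "(\<lambda>z\<in>topspace X. theta0 z (s z)) \<in> sec EF"
proof -
  interpret T: fmod "van X (topspace X)" T by (rule fmod_T)
  note UX = openin_subset[OF U]
  note sa = s[unfolded sec_field_of]
  let ?t = "\<lambda>z\<in>topspace X. theta0 z (s z)"
  have sz: "s z \<in> carr (fibre T z)" if "z \<in> topspace X" for z
    by (rule T.approximable_carr[OF sa that])
  have tP: "?t \<in> (\<Pi>\<^sub>E x\<in>topspace X. carr (H' x))"
    by (rule restrict_PiE_iff[THEN iffD2]) (use sz theta0_fibre in blast)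
  have sU: "restrict s U \<in> sec (field_of Z T)"
    unfolding sec_field_of
  proof (rule T.approximableI)
    show "restrict s U \<in> (\<Pi>\<^sub>E z\<in>topspace Z. carr (fibre T z))"
      unfolding topspace_Z by (rule restrict_PiE_iff[THEN iffD2]) (use sz UX in blast)
    fix z and \<epsilon> :: real assume zZ: "z \<in> topspace Z" and e: "\<epsilon> > 0"
    have z: "z \<in> U" and zX: "z \<in> topspace X" using zZ UX by (auto simp only: topspace_Z)
    obtain W m where W: "openin X W" "z \<in> W" "m \<in> carr T"
      "\<forall>w\<in>W. fdist T w (s w) (fib_class T w m) < \<epsilon>"
      using sa zX e by (rule T.approximable_const)
    have "openin Z (W \<inter> U)" using W(1) by (auto simp: openin_subtopology)
    moreover have "\<forall>w\<in>W \<inter> U. fdist T w (restrict s U w) (fib_class T w m) < \<epsilon>" using W(4) by simp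
    ultimately show "\<exists>W m. openin Z W \<and> z \<in> W \<and> m \<in> carr T \<and>
        (\<forall>w\<in>W. fdist T w (restrict s U w) (fib_class T w m) < \<epsilon>)"
      using W(2,3) z by blast
  qed
  have "restrict ?t U = (\<lambda>z\<in>topspace Z. theta z (restrict s U z))"
    unfolding topspace_Z using UX by (intro ext) (auto simp: restrict_def theta0_def)
  moreover have "(\<lambda>z\<in>topspace Z. theta z (restrict s U z)) \<in> locally_approximable Z (fibre M) MUsec"
    using theta_sections sU by blast
  ultimately have tU: "restrict ?t U \<in> sec (field_of Z M)"
    unfolding sec_field_of by (simp only: MU_eq)
  have "continuous_map X euclideanreal (\<lambda>x. hnorm complex_alg (fibre T x) (s x))"
    unfolding continuous_map_real_iff
  proof (intro ballI allI impI)
    fix z and \<epsilon> :: real assume z: "z \<in> topspace X" and e: "\<epsilon> > 0"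
    have e3: "\<epsilon> / 3 > 0" using e by simp
    obtain W1 c where W1: "openin X W1" "z \<in> W1" and c: "c \<in> carr T"
      and b1: "\<forall>w\<in>W1. fdist T w (s w) (fib_class T w c) < \<epsilon> / 3"
      using sa z e3 by (rule T.approximable_const)
    have "continuous_map X euclideanreal (\<lambda>x. norm (ip T c c x))"
      by (rule continuous_map_norm[OF van_contD[OF T.ip_in[OF c c]]])
    then have "continuous_map X euclideanreal (\<lambda>x. pn T x c)"
      unfolding pn_def by (rule continuous_map_sqrt)
    then obtain W2 where W2: "openin X W2" "z \<in> W2"
      and b2: "\<forall>w\<in>W2. \<bar>pn T w c - pn T z c\<bar> < \<epsilon> / 3"
      using z e3 by (rule continuous_map_realE)
    have "\<bar>hnorm complex_alg (fibre T w) (s w) - hnorm complex_alg (fibre T z) (s z)\<bar> < \<epsilon>"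
      if w: "w \<in> W1 \<inter> W2" for w
    proof -
      have w12: "w \<in> W1" "w \<in> W2" using w by simp_all
      then have "w \<in> topspace X" using openin_subset[OF W1(1)] by blast
      from T.hnorm_fibre_le[OF sz[OF this] c] T.hnorm_fibre_le[OF sz[OF z] c]
        bspec[OF b1 w12(1)] bspec[OF b1 W1(2)] bspec[OF b2 w12(2)]
      show ?thesis by linarith
    qed
    then show "\<exists>W. openin X W \<and> z \<in> W \<and>
        (\<forall>y\<in>W. \<bar>hnorm complex_alg (fibre T y) (s y) - hnorm complex_alg (fibre T z) (s z)\<bar> < \<epsilon>)"
      using W1 W2 by (intro exI[of _ "W1 \<inter> W2"]) blast
  qed
  then have "continuous_map X euclideanreal (\<lambda>x. hnorm complex_alg (H' x) (?t x))"
    by (rule continuous_map_eq) (use sz hnorm_theta0 in simp)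
  with tP tU show ?thesis unfolding sec_EF by blast
qed

text \<open>On \<open>U\<close> the section is pulled back by \<open>theta_sections\<close>. At a
  point off \<open>U\<close> the norm is 0 and continuous, hence small nearby, so the zero element
  of the tensor product approximates the section there.\<close>

lemma theta0_sections_supset:
  assumes t: "t \<in> sec EF"
  shows "\<exists>s\<in>sec (field_of X T). t = (\<lambda>z\<in>topspace X. theta0 z (s z))"
proof -
  interpret T: fmod "van X (topspace X)" T by (rule fmod_T)
  note UX = openin_subset[OF U]
  from t have tP: "t \<in> (\<Pi>\<^sub>E x\<in>topspace X. carr (H' x))"
    and tU: "restrict t U \<in> sec (field_of Z M)"
    and nc: "continuous_map X euclideanreal (\<lambda>x. hnorm complex_alg (H' x) (t x))"
    unfolding sec_EF by blast+
  have "restrict t U \<in> locally_approximable Z (fibre M) MUsec"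
    using tU by (simp only: sec_field_of MU_eq)
  then have "restrict t U \<in> (\<lambda>s. \<lambda>z\<in>topspace Z. theta z (s z)) ` sec (field_of Z T)"
    by (simp only: theta_sections)
  then obtain s where s: "s \<in> sec (field_of Z T)"
    and st: "restrict t U = (\<lambda>z\<in>topspace Z. theta z (s z))" by blast
  note sa = s[unfolded sec_field_of]
  have sz: "s z \<in> carr (fibre T z)" if "z \<in> U" for z
    by (rule T.approximable_carr[OF sa]) (simp only: topspace_Z that)
  have stz: "t z = theta z (s z)" if "z \<in> U" for z
    using fun_cong[OF st, of z] that by (simp only: topspace_Z restrict_apply if_True)
  \<comment> \<open>Off \<open>U\<close> the value \<open>carr T\<close> is forced: it is the only
    element of the fibre.\<close>
  define s' where "s' = (\<lambda>z\<in>topspace X. if z \<in> U then s z else carr T)"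
  have s'z: "s' z \<in> carr (fibre T z)" if "z \<in> topspace X" for z
    using that sz[of z] fibre_outside[of z] by (cases "z \<in> U") (simp_all add: s'_def)
  have ts': "t z = theta0 z (s' z)" if z: "z \<in> topspace X" for z
  proof (cases "z \<in> U")
    case True
    then show ?thesis using stz z by (simp add: s'_def theta0_def)
  next
    case False
    then have "t z \<in> {undefined}" using tP z by (auto simp: zero_hilbert_sel PiE_def Pi_def)
    with False show ?thesis by (simp add: theta0_def)
  qed
  have "s' \<in> sec (field_of X T)"
    unfolding sec_field_of
  proof (rule T.approximableI)
    show "s' \<in> (\<Pi>\<^sub>E z\<in>topspace X. carr (fibre T z))"
      using s'z by (auto simp: s'_def)
    fix z and \<epsilon> :: real assume z: "z \<in> topspace X" and e: "\<epsilon> > 0"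
    show "\<exists>W m. openin X W \<and> z \<in> W \<and> m \<in> carr T \<and>
        (\<forall>w\<in>W. fdist T w (s' w) (fib_class T w m) < \<epsilon>)"
    proof (cases "z \<in> U")
      case True
      then have zZ: "z \<in> topspace Z" by (simp only: topspace_Z)
      obtain W m where W: "openin Z W" "z \<in> W" "m \<in> carr T"
        "\<forall>w\<in>W. fdist T w (s w) (fib_class T w m) < \<epsilon>"
        using sa zZ e by (rule T.approximable_const)
      have "W \<subseteq> U" using openin_subset[OF W(1)] by (simp only: topspace_Z)
      then have "\<forall>w\<in>W. fdist T w (s' w) (fib_class T w m) < \<epsilon>"
        using W(4) UX by (auto simp: s'_def subset_iff)
      then show ?thesis using openin_Z[OF W(1)] W(2,3) by blast
    next
      case False
      have "hnorm complex_alg (H' z) (t z) = 0" using False by (simp add: zero_hilbert_sel)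
      obtain W where W: "openin X W" "z \<in> W"
        and "\<forall>w\<in>W. \<bar>hnorm complex_alg (H' w) (t w) - hnorm complex_alg (H' z) (t z)\<bar> < \<epsilon>"
        using nc z e by (rule continuous_map_realE)
      with \<open>hnorm complex_alg (H' z) (t z) = 0\<close>
      have b: "\<bar>hnorm complex_alg (H' w) (t w)\<bar> < \<epsilon>" if "w \<in> W" for w
        using that by simp
      have "fdist T w (s' w) (fib_class T w (zer T)) < \<epsilon>" if w: "w \<in> W" for w
      proof -
        have wX: "w \<in> topspace X" using w openin_subset[OF W(1)] by blast
        have "fdist T w (s' w) (fib_class T w (zer T)) = hnorm complex_alg (fibre T w) (s' w)"
          by (rule T.fdist_zer[OF s'z[OF wX]])
        also have "\<dots> = hnorm complex_alg (H' w) (t w)"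
          by (simp only: ts'[OF wX] hnorm_theta0[OF s'z[OF wX]])
        finally show ?thesis using b[OF w] by linarith
      qed
      then show ?thesis using W T.zer_closed by blast
    qed
  qed
  moreover have "t = (\<lambda>z\<in>topspace X. theta0 z (s' z))"
    by (rule extensionalityI[of _ "topspace X"]) (use tP ts' in \<open>auto simp: PiE_def\<close>)
  ultimately show ?thesis by blast
qed

lemma field_iso_extend: "field_iso X theta0 (field_of X T) EF"
  unfolding field_iso_def fib_field_of fib_EF
proof (intro conjI ballI)
  show "(\<lambda>s. \<lambda>z\<in>topspace X. theta0 z (s z)) ` sec (field_of X T) = sec EF"
    using theta0_sections_subset theta0_sections_supset by blast
qed (simp_all only: theta0_bij ip_theta0)

end

context compact_Hausdorff
begin

lemma tensor_is_restriction:
  assumes U: "openin X U"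
  shows "tensor_is_restriction TYPE('m) X U (C0_corr (subtopology X U))"
  unfolding tensor_is_restriction_def Let_def C_alg_eq_van C0_alg_eq_van[OF U]
proof (rule exI[of _ "\<lambda>M. tensored.theta X M U"], intro conjI allI impI ballI, goal_cases)
  case (1 M)
  then interpret tensored X "topspace X" M U U
    by (rule tensored_hilbert_module[OF _ U openin_subset[OF U] subset_refl])
  show ?case by (rule field_iso_restrict)
next
  case (2 M N t u p)
  then have M: "hilbert_module (function_alg (van X (topspace X))) M"
    and N: "hilbert_module (function_alg (van X (topspace X))) N"
    and t: "t \<in> fadj M N" by (simp_all add: adjointable_ops_function_alg)
  interpret tensored_pair X "topspace X" M N U U
    by (intro tensored_pair.intro tensored_hilbert_module[OF _ U openin_subset[OF U] subset_refl] M N)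
  show ?case by (rule theta_natural[OF t 2(3)])
qed

lemma tensor_is_extension:
  assumes U: "openin X U"
  shows "tensor_is_extension TYPE('n) X U (C0_corr (subtopology X U))"
  unfolding tensor_is_extension_def Let_def C_alg_eq_van C0_alg_eq_van[OF U]
proof (rule exI[of _ "\<lambda>M. extended.theta0 X U M"], intro conjI allI impI ballI, goal_cases)
  case (1 M)
  then interpret extended X U M
    by (intro extended.intro tensored_hilbert_module[OF _ U subset_refl openin_subset[OF U]])
  show ?case by (rule field_iso_extend)
next
  case (2 M N t u p)
  then have M: "hilbert_module (function_alg (van X U)) M"
    and N: "hilbert_module (function_alg (van X U)) N"
    and t: "t \<in> fadj M N" by (simp_all add: adjointable_ops_function_alg)
  interpret M: extended X U M
    by (intro extended.intro tensored_hilbert_module[OF _ U subset_refl openin_subset[OF U]] M)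
  interpret N: extended X U N
    by (intro extended.intro tensored_hilbert_module[OF _ U subset_refl openin_subset[OF U]] N)
  interpret tensored_pair X U M N U "topspace X"
    by (intro tensored_pair.intro M.tensored_axioms N.tensored_axioms)
  show ?case
    using theta_natural[OF t 2(3)] 2(2) by (simp add: M.theta0_def N.theta0_def)
qed

end

section \<open>An adjoint forces \<open>U\<close> to be closed\<close>

text \<open>A copy of \<open>K\<close> inside the type \<open>'m\<close>. It makes C(X) and C_0(U),
  as modules over themselves, objects of the categories whose universes are the given types.\<close>

definition transport :: "('k \<Rightarrow> 'm) \<Rightarrow> ('a, 'k, 'z) hmod_scheme \<Rightarrow> ('a, 'm) hmod" where
  "transport \<phi> K =
    \<lparr> carr = \<phi> ` carr K, zer = \<phi> (zer K),
      add = (\<lambda>p q. \<phi> (add K (inv \<phi> p) (inv \<phi> q))),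
      scl = (\<lambda>c p. \<phi> (scl K c (inv \<phi> p))),
      act = (\<lambda>p b. \<phi> (act K (inv \<phi> p) b)),
      ip = (\<lambda>p q. ip K (inv \<phi> p) (inv \<phi> q)) \<rparr>"

context
  fixes \<phi> :: "'k \<Rightarrow> 'm" and K :: "('a, 'k, 'z) hmod_scheme"
  assumes inj: "inj \<phi>"
begin

lemma transport_sel:
  "carr (transport \<phi> K) = \<phi> ` carr K" "zer (transport \<phi> K) = \<phi> (zer K)"
  "add (transport \<phi> K) (\<phi> x) (\<phi> y) = \<phi> (add K x y)"
  "scl (transport \<phi> K) c (\<phi> x) = \<phi> (scl K c x)"
  "act (transport \<phi> K) (\<phi> x) b = \<phi> (act K x b)"
  "ip (transport \<phi> K) (\<phi> x) (\<phi> y) = ip K x y"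
  by (simp_all add: transport_def inv_f_f[OF inj])

lemma diff_transport: "diff (transport \<phi> K) (\<phi> x) (\<phi> y) = \<phi> (diff K x y)"
  by (simp add: diff_def transport_sel)

lemma hnorm_transport: "hnorm A (transport \<phi> K) (\<phi> x) = hnorm A K x"
  by (simp add: hnorm_def transport_sel)

lemma hilbert_module_transport:
  assumes "hilbert_module A K"
  shows "hilbert_module A (transport \<phi> K)"
proof -
  interpret K: hilbert_module A K by fact
  have complete: "norm_complete (transport \<phi> K) (hnorm A (transport \<phi> K))"
    unfolding norm_complete_def
  proof (intro allI impI)
    fix s assume s: "cauchy_seq (transport \<phi> K) (hnorm A (transport \<phi> K)) s"
    then have "\<forall>n. \<exists>k\<in>carr K. s n = \<phi> k"
      by (auto simp: cauchy_seq_def transport_sel)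
    then obtain r where r: "\<And>n. r n \<in> carr K" "\<And>n. s n = \<phi> (r n)" by metis
    have "cauchy_seq K (hnorm A K) r"
      using s r by (simp add: cauchy_seq_def diff_transport hnorm_transport)
    then obtain x where "x \<in> carr K" "(\<lambda>n. hnorm A K (diff K (r n) x)) \<longlonglongrightarrow> 0"
      using K.module_complete unfolding norm_complete_def by blast
    then show "\<exists>x\<in>carr (transport \<phi> K).
        (\<lambda>n. hnorm A (transport \<phi> K) (diff (transport \<phi> K) (s n) x)) \<longlonglongrightarrow> 0"
      by (intro bexI[of _ "\<phi> x"]) (simp_all add: r diff_transport hnorm_transport transport_sel)
  qed
  note eqs = transport_sel diff_transport
  show ?thesis
  proof (unfold_locales, goal_cases)
    case 25 then show ?case by (rule complete)
  next
    case (23 x)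
    then show ?case using K.ip_positive by (auto simp: eqs)
  next
    case (24 x)
    then show ?case using K.ip_definite by (auto simp: eqs)
  qed (auto simp: eqs K.M.zer_closed K.M.add_closed K.M.scl_closed K.M.add_assoc K.M.add_zer
    K.M.diff_self K.M.scl_one K.M.scl_scl K.M.scl_add_left K.M.scl_add_right K.act_closed
    K.act_add_left K.act_add_right K.act_scl_left K.act_scl_right K.act_mul K.ip_closed
    K.ip_add K.ip_scl K.ip_act K.ip_star intro: arg_cong[OF K.M.add_commute])
qed

end

context compact_Hausdorff
begin

text \<open>A Yoneda argument. The identification \<theta> of C(X) \<otimes> F with C_0(U) is
  invertible, so every operator out of C(X) \<otimes> F into \<open>N\<close> is some
  \<open>t\<close> after \<theta>, and by naturality its image is \<open>t \<otimes> 1\<close> after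
  the image of \<theta>. By surjectivity multiplication by g is such an image; at the unit of C(X)
  this reads g = t h.\<close>

lemma adjoint_imp_dominating:
  fixes \<iota> :: "('x \<Rightarrow> complex) \<Rightarrow> 'm" and \<kappa> :: "('x \<Rightarrow> complex) \<Rightarrow> 'n"
  assumes U: "openin X U" and \<iota>: "inj \<iota>" and \<kappa>: "inj \<kappa>"
    and adj: "adjoint_tensor_functors TYPE('m) TYPE('n) (function_alg (van X (topspace X)))
      (function_alg (van X U)) (C0_corr (subtopology X U)) (C0_corr (subtopology X U))"
  obtains h where "h \<in> van X U"
    and "\<And>g. g \<in> van X U \<Longrightarrow> \<exists>c. \<forall>u\<in>U. cmod (g u) \<le> c * cmod (h u)"
proof -
  let ?F = "C0_corr (subtopology X U)"
  let ?A = "function_alg (van X (topspace X))" and ?B = "function_alg (van X U)"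
  note UX = openin_subset[OF U]
  define M where "M = transport \<iota> (C0_corr (subtopology X (topspace X)))"
  define N where "N = transport \<kappa> ?F"
  have hM: "hilbert_module ?A M" unfolding M_def
    by (rule hilbert_module_transport[OF \<iota> hilbert_module_C0_corr]) simp_all
  have hN: "hilbert_module ?B N" unfolding N_def
    by (rule hilbert_module_transport[OF \<kappa> hilbert_module_C0_corr[OF U subset_refl]])
  interpret module_pair X U M N by (rule module_pair_hilbert_module[OF U hM hN])
  have Mc: "carr M = \<iota> ` van X (topspace X)"
    by (simp add: M_def transport_sel[OF \<iota>] C0_funs_eq_van del: subtopology_topspace)
  have Mi: "ip M (\<iota> f) (\<iota> g) = (\<lambda>x. cnj (f x) * g x)" for f g
    by (simp add: M_def transport_sel[OF \<iota>])
  have Nc: "carr N = \<kappa> ` van X U"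
    by (simp add: N_def transport_sel[OF \<kappa>] C0_funs_eq_van[OF U])
  have Ni: "ip N (\<kappa> f) (\<kappa> g) = (\<lambda>x. cnj (f x) * g x)" for f g
    by (simp add: N_def transport_sel[OF \<kappa>])
  have Na: "act N (\<kappa> f) k = \<kappa> (\<lambda>x. f x * k x)" for f k
    by (simp add: N_def transport_sel[OF \<kappa>])
  have MUc: "MU = \<iota> ` van X U"
    using UX by (auto simp: vanish_def Mc Mi van_def cont_funs_def)
  have sub: "f \<in> van X (topspace X)" if "f \<in> van X U" for f
    using that van_mono[OF UX] by blast
  obtain \<Phi> :: "(_, 'm) hmod \<Rightarrow> (_, 'n) hmod \<Rightarrow> _"
    where bij: "bij_betw (\<Phi> M N) (fadj TM N) (fadj M TN)"
      and nat: "natural_hom_map ?A ?B ?F ?F (\<lambda>M N. adjointable_ops ?B (tensor ?B M ?F) N) \<Phi>"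
    using adj hM hN unfolding adjoint_tensor_functors_def adjointable_ops_function_alg by blast
  define j where "j = restrict (\<lambda>m. \<kappa> (inv \<iota> m)) MU"
  define j' where "j' = restrict (\<lambda>n. \<iota> (inv \<kappa> n)) (carr N)"
  have j: "j (\<iota> f) = \<kappa> f" "j' (\<kappa> f) = \<iota> f" if "f \<in> van X U" for f
    using that by (simp_all add: j_def j'_def MUc Nc inv_f_f[OF \<iota>] inv_f_f[OF \<kappa>])
  have jx: "j \<in> extensional MU" and jx': "j' \<in> extensional (carr N)"
    by (simp_all add: j_def j'_def)
  have j_adj: "j \<in> fadj QM N"
    by (rule fadj_isometry[where \<psi> = j']) (use jx in \<open>auto simp: MUc Nc j Mi Ni\<close>)
  have j'_adj: "j' \<in> fadj N QM"
    by (rule fadj_isometry[where \<psi> = j]) (use jx' in \<open>auto simp: MUc Nc j Mi Ni\<close>)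
  define \<theta> where "\<theta> = compose (carr TM) j unM"
  define \<theta>' where "\<theta>' = compose (carr N) thM j'"
  have \<theta>: "\<theta> \<in> fadj TM N" unfolding \<theta>_def by (rule fadj_compose[OF unM_fadj j_adj])
  have \<theta>': "\<theta>' \<in> fadj N TM" unfolding \<theta>'_def by (rule fadj_compose[OF j'_adj thM_fadj])
  have \<theta>'_\<theta>: "\<theta>' (\<theta> c) = c" if "c \<in> carr TM" for c
  proof -
    obtain m where m: "m \<in> MU" "c = clsM m" using \<open>c \<in> carr TM\<close> unfolding M.carr_T by blast
    obtain f where f: "f \<in> van X U" "m = \<iota> f" using m(1) unfolding MUc by blast
    have "\<theta> c = \<kappa> f"
      using unM_cls[OF m(1)] th_mem(1)[OF m(1)] j(1)[OF f(1)] f(2) m(2) by (simp add: \<theta>_def compose_def)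
    moreover have "\<theta>' (\<kappa> f) = clsM m"
      using f m(1) j(2)[OF f(1)] by (simp add: \<theta>'_def compose_def Nc)
    ultimately show ?thesis using m(2) by simp
  qed
  \<comment> \<open>The unit of C(X); by the convention for functions it is 0 off the space.\<close>
  define e :: "'x \<Rightarrow> complex" where "e = (\<lambda>x. if x \<in> topspace X then 1 else 0)"
  have e: "e \<in> van X (topspace X)"
  proof (rule vanI)
    show "continuous_map X euclidean e"
      by (rule continuous_map_eq[of _ _ "\<lambda>_. 1"]) (simp_all add: e_def)
  qed (simp_all add: e_def)
  have eM: "\<iota> e \<in> carr M" using e by (simp add: Mc)
  have ge: "(\<lambda>x. g x * e x) = g" if "g \<in> van X U" for g
    using that by (auto simp: e_def van_def cont_funs_def)
  have \<Theta>: "\<Phi> M N \<theta> \<in> fadj M TN" using bij \<theta> by (auto simp: bij_betw_def)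
  have "\<Phi> M N \<theta> (\<iota> e) \<in> carr TN" by (rule fadj_mem[OF \<Theta> eM])
  then obtain h where h: "h \<in> van X U" "\<Phi> M N \<theta> (\<iota> e) = clsN (\<kappa> h)"
    unfolding carr_TN Nc by blast
  have "\<exists>c. \<forall>u\<in>U. cmod (g u) \<le> c * cmod (h u)" if g: "g \<in> van X U" for g
  proof -
    \<comment> \<open>Multiplication by \<open>g\<close> from C(X) to C_0(U). Its adjoint is
      multiplication by the conjugate, and it sends the unit to \<open>g\<close>.\<close>
    define G0 where "G0 = restrict (\<lambda>m. \<kappa> (\<lambda>x. g x * inv \<iota> m x)) (carr M)"
    have G0: "G0 (\<iota> f) = \<kappa> (\<lambda>x. g x * f x)" if "f \<in> van X (topspace X)" for f
      using that by (simp add: G0_def Mc inv_f_f[OF \<iota>])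
    obtain c where c: "0 \<le> c" "\<And>x. cmod (g x) \<le> c" using van_bounded[OF g] by metis
    have G0_adj: "G0 \<in> fadj M N"
    proof (rule fadjI)
      show "G0 \<in> extensional (carr M)" by (simp add: G0_def)
      show "is_adj M N G0 (\<lambda>n. \<iota> (\<lambda>x. cnj (g x) * inv \<kappa> n x))"
      proof (rule is_adjI)
        show "G0 x \<in> carr N" if "x \<in> carr M" for x
          using that van_mult[OF g] by (auto simp: Mc Nc G0)
        show "\<iota> (\<lambda>x. cnj (g x) * inv \<kappa> y x) \<in> carr M" if "y \<in> carr N" for y
          using that van_mult[OF van_cnj[OF g]] sub by (auto simp: Mc Nc inv_f_f[OF \<kappa>])
        show "ip N (G0 x) y u = ip M x (\<iota> (\<lambda>x. cnj (g x) * inv \<kappa> y x)) u"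
          if "x \<in> carr M" "y \<in> carr N" for x y u
          using that by (auto simp: Mc Nc G0 Mi Ni inv_f_f[OF \<kappa>])
      qed
      show "fbound M N c G0"
        unfolding fbound_def
      proof (intro conjI ballI c(1))
        fix m assume m: "m \<in> carr M"
        then obtain f where f: "f \<in> van X (topspace X)" "m = \<iota> f" unfolding Mc by blast
        show "hn N (G0 m) \<le> c * hn M m"
        proof (rule hn_le)
          show "0 \<le> c * hn M m" using c(1) M.hn_nonneg[OF m] by simp
          fix u
          have "pn N u (G0 m) = cmod (g u) * pn M u m"
            unfolding f(2) G0[OF f(1)] pn_def Ni Mi by (simp add: norm_mult real_sqrt_mult)
          also have "\<dots> \<le> c * hn M m"
            by (rule mult_mono[OF c(2) M.pn_le_hn[OF m] c(1) pn_nonneg])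
          finally show "pn N u (G0 m) \<le> c * hn M m" .
        qed
      qed
    qed
    have G: "compose (carr M) thN G0 \<in> fadj M TN"
      using fadj_compose[OF _ thN_fadj] G0_adj by (simp add: fadj_submod_target[OF vanish_N])
    then have "compose (carr M) thN G0 \<in> \<Phi> M N ` fadj TM N"
      by (simp only: bij_betw_imp_surj_on[OF bij])
    then obtain T where \<Phi>T: "compose (carr M) thN G0 = \<Phi> M N T" and T: "T \<in> fadj TM N"
      by (rule imageE)
    \<comment> \<open>Since \<theta>' inverts \<theta>, \<open>T\<close> is \<open>t\<close> after
      \<theta>; this is the form to which naturality in the second variable applies, with the
      identity \<open>s\<close> in the first.\<close>
    define t where "t = compose (carr N) T \<theta>'"
    have t: "t \<in> fadj N N" unfolding t_def by (rule fadj_compose[OF \<theta>' T])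
    define s where "s = restrict (\<lambda>m. m) (carr M)"
    have s: "s \<in> fadj M M" by (rule fadj_isometry[where \<psi> = "\<lambda>m. m"]) (simp_all add: s_def)
    interpret MM: tensored_pair X "topspace X" M M U U
      by (intro tensored_pair.intro M.tensored_axioms)
    interpret NN: tensored_pair X U N N U "topspace X"
      by (intro tensored_pair.intro N.tensored_axioms)
    have eqT: "compose (carr TM) t (compose (carr TM) \<theta> (tensor_map ?B M M ?F s)) = T"
    proof (rule extensionalityI[OF compose_extensional fadj_ext[OF T]])
      fix c assume c: "c \<in> carr TM"
      then obtain m where m: "m \<in> MU" "c = clsM m" unfolding M.carr_T by blast
      have "tensor_map ?B M M ?F s c = c"
        unfolding m(2) MM.tensor_map_cls[OF s m(1)] using MU_carr[OF m(1)] by (simp add: s_def)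
      then show "compose (carr TM) t (compose (carr TM) \<theta> (tensor_map ?B M M ?F s)) c = T c"
        using c fadj_mem[OF \<theta> c] by (simp add: compose_eq t_def \<theta>'_\<theta>)
    qed
    have "hilbert_module ?A M \<and> hilbert_module ?A M \<and> hilbert_module ?B N \<and> hilbert_module ?B N \<and>
        s \<in> adjointable_ops ?A M M \<and> t \<in> adjointable_ops ?B N N \<and> \<theta> \<in> adjointable_ops ?B TM N"
      unfolding adjointable_ops_function_alg by (intro conjI hM hN s t \<theta>)
    then have "\<Phi> M N (compose (carr TM) t (compose (carr TM) \<theta> (tensor_map ?B M M ?F s)))
        = compose (carr M) (tensor_map ?A N N ?F t) (compose (carr M) (\<Phi> M N \<theta>) s)"
      by (rule nat[unfolded natural_hom_map_def, THEN spec, THEN spec, THEN spec, THEN spec,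
            THEN spec, THEN spec, THEN spec, THEN mp])
    then have "compose (carr M) thN G0
        = compose (carr M) (tensor_map ?A N N ?F t) (compose (carr M) (\<Phi> M N \<theta>) s)"
      unfolding eqT \<Phi>T[symmetric] .
    from fun_cong[OF this, of "\<iota> e"]
    have "thN (G0 (\<iota> e)) = tensor_map ?A N N ?F t (\<Phi> M N \<theta> (\<iota> e))"
      using eM by (simp add: compose_eq s_def)
    moreover have "G0 (\<iota> e) = \<kappa> g" using G0[OF e] ge[OF g] by simp
    moreover have "tensor_map ?A N N ?F t (clsN (\<kappa> h)) = clsN (t (\<kappa> h))"
      by (rule NN.tensor_map_cls[OF t]) (use h in \<open>simp add: vanish_N Nc\<close>)
    ultimately have "clsN (\<kappa> g) = clsN (t (\<kappa> h))"
      using g h(2) by (simp add: Nc)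
    then have gh: "\<kappa> g = t (\<kappa> h)"
      by (rule N.cls_inj[rotated 2]) (use g h fadj_mem[OF t] in \<open>simp_all add: vanish_N Nc\<close>)
    obtain R c where R: "is_adj N N t R" and c: "fbound N N c t" using t by (rule fadjE)
    \<comment> \<open>By linearity t (h k) is both (t h) k and (t k) h. At \<open>u\<close>, where
      \<open>k\<close> is 1, this gives g = k' h with k' = t k, and \<bar>k'\<bar> \<le>
      \<open>c\<close> because \<open>k\<close> has norm at most 1.\<close>
    have "cmod (g u) \<le> c * cmod (h u)" if u: "u \<in> U" for u
    proof -
      obtain k where k: "k \<in> van X U" "k u = 1" "\<And>x. cmod (k x) \<le> 1" using bump[OF U u] by metis
      have kN: "\<kappa> k \<in> carr N" and hN': "\<kappa> h \<in> carr N" using k h by (simp_all add: Nc)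
      obtain k' where k': "k' \<in> van X U" "t (\<kappa> k) = \<kappa> k'"
        using fadj_mem[OF t kN] unfolding Nc by blast
      have "act N (t (\<kappa> h)) k = t (act N (\<kappa> h) k)" by (rule NN.MN.adj_act[OF R hN' k(1), symmetric])
      also have "act N (\<kappa> h) k = act N (\<kappa> k) h" unfolding Na by (simp add: mult.commute)
      also have "t \<dots> = act N (t (\<kappa> k)) h" by (rule NN.MN.adj_act[OF R kN h(1)])
      finally have "(\<lambda>x. g x * k x) = (\<lambda>x. k' x * h x)"
        unfolding gh[symmetric] k'(2) Na by (rule injD[OF \<kappa>])
      from fun_cong[OF this, of u] have gu: "g u = k' u * h u" using k(2) by simp
      have "cmod (k' u) = pn N u (t (\<kappa> k))"
        unfolding k'(2) pn_def Ni by (simp add: norm_mult real_sqrt_mult_self)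
      also have "\<dots> \<le> hn N (t (\<kappa> k))" by (rule N.pn_le_hn[OF fadj_mem[OF t kN]])
      also have "\<dots> \<le> c * hn N (\<kappa> k)" using c kN by (simp add: fbound_def)
      also have "\<dots> \<le> c * 1"
      proof (rule mult_left_mono)
        show "hn N (\<kappa> k) \<le> 1"
        proof (rule hn_le)
          show "pn N v (\<kappa> k) \<le> 1" for v
            using k(3)[of v] unfolding pn_def Ni by (simp add: norm_mult real_sqrt_mult_self)
        qed simp
      qed (use c in \<open>simp add: fbound_def\<close>)
      finally have "cmod (k' u) \<le> c" by simp
      then show ?thesis unfolding gu norm_mult by (rule mult_right_mono) simp
    qed
    then show ?thesis by blast
  qed
  with h(1) show thesis by (rule that)
qed

lemma closed_of_dominating:
  assumes U: "openin X U" and h: "h \<in> van X U"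
    and dom: "\<And>g. g \<in> van X U \<Longrightarrow> \<exists>c. \<forall>u\<in>U. cmod (g u) \<le> c * cmod (h u)"
  shows "closedin X U"
proof -
  have pos: "cmod (h u) > 0" if u: "u \<in> U" for u
  proof -
    obtain k where k: "k \<in> van X U" "k u = 1" "\<And>x. cmod (k x) \<le> 1" using bump[OF U u] by metis
    from dom[OF k(1)] u obtain c where "cmod (k u) \<le> c * cmod (h u)" by blast
    with k(2) show ?thesis by auto
  qed
  have "(\<lambda>x. complex_of_real (sqrt (cmod (h x)))) \<in> van X U"
    by (rule van_compose[OF h]) (auto intro!: continuous_intros)
  from dom[OF this] obtain c0 where c0: "\<forall>u\<in>U. sqrt (cmod (h u)) \<le> c0 * cmod (h u)" by auto
  \<comment> \<open>For empty \<open>U\<close> the constant \<open>c0\<close> is arbitrary; the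
    maximum with 1 can be divided by in every case.\<close>
  define c where "c = max c0 1"
  have c: "c > 0" by (simp add: c_def)
  have low: "1 / c\<^sup>2 \<le> cmod (h u)" if u: "u \<in> U" for u
  proof -
    let ?r = "sqrt (cmod (h u))"
    have r: "?r > 0" "?r * ?r = cmod (h u)" using pos[OF u] by simp_all
    have "?r \<le> c0 * cmod (h u)" using c0 u by blast
    also have "\<dots> \<le> c * cmod (h u)" by (rule mult_right_mono) (simp_all add: c_def)
    finally have "?r * 1 \<le> ?r * (c * ?r)" using r(2) by (simp add: mult_ac)
    then have "1 \<le> c * ?r" using r(1) by (simp only: mult_le_cancel_left_pos)
    then have "1 / c \<le> ?r" using c by (simp add: field_simps)
    then have "(1 / c)\<^sup>2 \<le> ?r\<^sup>2" using c by (intro power_mono) simp_all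
    then show ?thesis by (simp add: power_divide)
  qed
  have "closedin X {x \<in> topspace X. h x \<in> {z. 1 / c\<^sup>2 \<le> cmod z}}"
    by (rule closedin_continuous_map_preimage[OF van_contD[OF h]])
      (auto intro!: closed_Collect_le continuous_intros)
  moreover have "x \<in> U" if "1 / c\<^sup>2 \<le> cmod (h x)" for x
  proof (rule ccontr)
    assume "x \<notin> U"
    then have "1 / c\<^sup>2 \<le> 0" using that van_zero_outside[OF h] by simp
    moreover have "1 / c\<^sup>2 > 0" using c by simp
    ultimately show False by linarith
  qed
  then have "{x \<in> topspace X. h x \<in> {z. 1 / c\<^sup>2 \<le> cmod z}} = U"
    using low openin_subset[OF U] by blast
  ultimately show ?thesis by simp
qed

end

theorem proposition4p3:
  fixes X :: "'x topology" and U :: "'x set"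
    and A B :: "('x \<Rightarrow> complex) calg"
    and F E :: "('x \<Rightarrow> complex, 'x \<Rightarrow> complex, 'x \<Rightarrow> complex) corr"
  assumes "compact_space X" and "Hausdorff_space X" and "openin X U"
    and "A = C_alg X" and "B = C0_alg (subtopology X U)"
    and "F = C0_corr (subtopology X U)" and "E = C0_corr (subtopology X U)"
    and "\<exists>\<iota> :: ('x \<Rightarrow> complex) \<Rightarrow> 'm. inj \<iota>" and "\<exists>\<kappa> :: ('x \<Rightarrow> complex) \<Rightarrow> 'n. inj \<kappa>"
  shows "correspondence A B F \<and> correspondence B A E \<and>
    tensor_is_restriction TYPE('m) X U F \<and>
    tensor_is_extension TYPE('n) X U E \<and>
    locally_adjoint_tensor_functors TYPE('m) TYPE('n) A B F E \<and>
    (adjoint_tensor_functors TYPE('m) TYPE('n) A B F E \<longleftrightarrow> openin X U \<and> closedin X U)"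
proof -
  interpret compact_Hausdorff X by (rule compact_Hausdorff.intro) fact+
  note U = \<open>openin X U\<close> and UX = openin_subset[OF \<open>openin X U\<close>]
  have A: "A = function_alg (van X (topspace X))" using assms(4) C_alg_eq_van by simp
  have B: "B = function_alg (van X U)" using assms(5) C0_alg_eq_van[OF U] by simp
  obtain \<iota> :: "('x \<Rightarrow> complex) \<Rightarrow> 'm" where \<iota>: "inj \<iota>" using assms(8) by blast
  obtain \<kappa> :: "('x \<Rightarrow> complex) \<Rightarrow> 'n" where \<kappa>: "inj \<kappa>" using assms(9) by blast
  have closed: "closedin X U" if "adjoint_tensor_functors TYPE('m) TYPE('n) A B F E"
    using adjoint_imp_dominating[OF U \<iota> \<kappa>] that closed_of_dominating[OF U]
    unfolding A B assms(6,7) by metis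
  show ?thesis
  proof (intro conjI iffI)
    show "correspondence A B F"
      unfolding A B assms(6) by (rule correspondence_C0_corr[OF U UX subset_refl])
    show "correspondence B A E"
      unfolding A B assms(7) by (rule correspondence_C0_corr[OF U subset_refl UX])
    show "tensor_is_restriction TYPE('m) X U F"
      unfolding assms(6) by (rule tensor_is_restriction[OF U])
    show "tensor_is_extension TYPE('n) X U E"
      unfolding assms(7) by (rule tensor_is_extension[OF U])
    show "locally_adjoint_tensor_functors TYPE('m) TYPE('n) A B F E"
      unfolding A B assms(6,7) by (rule locally_adjoint[OF U])
    show "openin X U" by (rule U)
    show "adjoint_tensor_functors TYPE('m) TYPE('n) A B F E" if "openin X U \<and> closedin X U"
      unfolding A B assms(6,7) using that by (intro adjoint_of_clopen[OF U]) simp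
  qed (rule closed)
qed

end
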